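(* Let $R,R'>0$, $2<p\le\infty$, $1\le q\le\infty$ and $\alpha\in\mathbb{R}$ with $0<\alpha<r+1$. Let $c\ge1$. Let $\tilde f_{n,\gamma}$ be the thresholding estimator defined in the context with $\Gamma_n=\{(j,k)\in\Lambda: j\le j_0\}$, where $j_0=j_0(n)$ is the integer such that $2^{j_0}\le n^c(\log n)^{-c}<2^{j_0+1}$. If $\gamma>c$, then for any $n\ge2$, $$\sup_{f\in\mathcal{B}^\alpha_{p,q}(R)\cap\mathbb{L}_1(R')\cap\mathbb{L}_2(R')}\mathbb{E}\big(\|\tilde f_{n,\gamma}-f\|_2^2\big)\le C\left(\frac{\log n}{n}\right)^{\frac{\alpha}{\alpha+1-\frac1p}},$$ where $C=C(\gamma,c,R,R',\alpha,p,\Phi)$ depends only on $R'$, $\gamma$, $c$, the parameters of the Besov ball and $\Phi$ (with $1/p=0$ if $p=\infty$).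
   Context: **Poisson model.** For a positive integer $n$, $N$ is a Poisson process on $\mathbb{R}$ with mean measure $n f(x)\,dx$, where $f\ge 0$, $f\in\mathbb{L}_1(\mathbb{R})\cap\mathbb{L}_2(\mathbb{R})$; $f$ is called the intensity. Suprema over $f$ are over intensities (nonnegative functions) in the given class. Write $\int g(x)\,dN_x=\sum_{T\in N}g(T)$. **Basis.** Let $\phi=1_{[0,1]}$, $r>0$, and let $\psi,\tilde\phi,\tilde\psi$ be functions such that: (1) $\tilde\phi,\tilde\psi$ are compactly supported; (2) $\tilde\phi,\tilde\psi$ belong to the Hölder space $C^{r+1}$; (3) $\psi$ is compactly supported and piecewise constant; (4) $\psi$ is orthogonal to polynomials of degree at most $r$; (5) with $\phi_k(x)=\phi(x-k)$, $\psi_{j,k}(x)=2^{j/2}\psi(2^jx-k)$, $\tilde\phi_k(x)=\tilde\phi(x-k)$, $\tilde\psi_{j,k}(x)=2^{j/2}\tilde\psi(2^jx-k)$, for all $j,j'\ge0$, $k,k'\in\mathbb{Z}$: $\int\psi_{j,k}\tilde\phi_{k'}=\int\phi_k\tilde\psi_{j',k'}=0$, $\int\phi_k\tilde\phi_{k'}=1_{k=k'}$, $\int\psi_{j,k}\tilde\psi_{j',k'}=1_{j=j',k=k'}$. The Haar basis ($\tilde\phi=\phi$, $\tilde\psi=\psi=1_{[0,1/2]}-1_{]1/2,1]}$) is also admitted, with $r=0$, although (2) fails. Put $\Phi=\{\phi,\psi,\tilde\phi,\tilde\psi\}$. Let $\Lambda=\{(j,k): j\ge -1,\ k\in\mathbb{Z}\}$;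 for $\lambda=(-1,k)$ set $\varphi_\lambda=\phi_k$, $\tilde\varphi_\lambda=\tilde\phi_k$; for $\lambda=(j,k)$, $j\ge0$, set $\varphi_\lambda=\psi_{j,k}$, $\tilde\varphi_\lambda=\tilde\psi_{j,k}$. Every $f\in\mathbb{L}_2$ decomposes as $f=\sum_{\lambda\in\Lambda}\beta_\lambda\tilde\varphi_\lambda$ with $\beta_\lambda=\int\varphi_\lambda f$ (write $\alpha_k=\beta_{(-1,k)}$, $\beta_{j,k}=\beta_{(j,k)}$ for $j\ge0$), and there are positive constants $c_1(\Phi),c_2(\Phi)$ depending only on $\Phi$ with $c_1(\Phi)\sum_\lambda\beta_\lambda^2\le\|f\|_2^2\le c_2(\Phi)\sum_\lambda\beta_\lambda^2$. **Estimator.** For $\gamma>0$ and $\lambda\in\Lambda$: $\hat\beta_\lambda=\frac1n\int\varphi_\lambda\,dN$, $\hat V_{\lambda,n}=\frac1{n^2}\int\varphi_\lambda^2\,dN$, $$\tilde V_{\lambda,n}=\hat V_{\lambda,n}+\sqrt{2\gamma\log n\,\hat V_{\lambda,n}\tfrac{\|\varphi_\lambda\|_\infty^2}{n^2}}+3\gamma\log n\,\tfrac{\|\varphi_\lambda\|_\infty^2}{n^2},\qquad \eta_{\lambda,\gamma}=\sqrt{2\gamma\tilde V_{\lambda,n}\log n}+\tfrac{\gamma\log n}{3n}\|\varphi_\lambda\|_\infty.$$ Given $\Gamma_n\subset\Lambda$, set $\tilde\beta_\lambda=\hat\beta_\lambda1_{\{|\hat\beta_\lambda|\ge\eta_{\lambda,\gamma}\}}1_{\{\lambda\in\Gamma_n\}}$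 and $\tilde f_{n,\gamma}=\sum_{\lambda\in\Lambda}\tilde\beta_\lambda\tilde\varphi_\lambda$. **Function classes.** For $1\le p,q\le\infty$, $0<\alpha<r+1$, $\|f\|_{\alpha,p,q}=\|(\alpha_k)_k\|_{\ell_p}+\big[\sum_{j\ge0}2^{jq(\alpha+\frac12-\frac1p)}\|(\beta_{j,k})_k\|_{\ell_p}^q\big]^{1/q}$ if $q<\infty$, with the bracket replaced by $\sup_{j\ge0}2^{j(\alpha+\frac12-\frac1p)}\|(\beta_{j,k})_k\|_{\ell_p}$ if $q=\infty$; $\mathcal{B}^\alpha_{p,q}(R)=\{f:\|f\|_{\alpha,p,q}\le R\}$. $\mathbb{L}_a(R)=\{f:\|f\|_a\le R\}$. *)

theory Defs
  imports "HOL-Probability.Probability"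
begin

section \<open>Norms\<close>

text \<open>Norms take values in \<^typ>\<open>ennreal\<close>, so that membership in a function class never rests
  on a default value for a divergent sum or integral. The library has no real power on
  \<^typ>\<open>ennreal\<close>; \<open>epowr\<close> is meant for exponents \<open>a > 0\<close> only.\<close>

definition epowr :: "ennreal \<Rightarrow> real \<Rightarrow> ennreal" where
  "epowr x a = (if x = \<infinity> then \<infinity> else ennreal (enn2real x powr a))"

definition seq_norm :: "ennreal \<Rightarrow> ('i \<Rightarrow> ennreal) \<Rightarrow> ennreal" where
  "seq_norm p a =
     (if p = \<infinity> then (SUP i. a i)
      else epowr (\<Sum>\<^sub>\<infinity>i. epowr (a i) (enn2real p)) (1 / enn2real p))"

definition L_norm :: "real \<Rightarrow> (real \<Rightarrow> real) \<Rightarrow> ennreal" where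
  "L_norm a f = epowr (\<integral>\<^sup>+x. ennreal (\<bar>f x\<bar> powr a) \<partial>lborel) (1 / a)"

definition L_space :: "real \<Rightarrow> (real \<Rightarrow> real) set" where
  "L_space a = {f \<in> borel_measurable lborel. L_norm a f < \<infinity>}"

definition L_ball :: "real \<Rightarrow> real \<Rightarrow> (real \<Rightarrow> real) set" where
  "L_ball a R = {f \<in> borel_measurable lborel. L_norm a f \<le> ennreal R}"

text \<open>Pointwise supremum norm, used for bounded functions only.\<close>

definition sup_norm :: "(real \<Rightarrow> real) \<Rightarrow> real" where
  "sup_norm g = (SUP x. \<bar>g x\<bar>)"

section \<open>Poisson processes\<close>

definition point_count :: "('w \<Rightarrow> real set) \<Rightarrow> real set \<Rightarrow> 'w \<Rightarrow> ennreal" where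
  "point_count N A \<omega> = emeasure (count_space UNIV) (N \<omega> \<inter> A)"

text \<open>A random countable set of points whose counts in disjoint measurable sets are independent
  and Poisson distributed. The explicit probabilities include mean \<open>0\<close>, which
  \<^const>\<open>poisson_pmf\<close> does not; \<open>0 ^ 0 = 1\<close> makes the count almost surely \<open>0\<close> then.\<close>

definition poisson_process :: "'w measure \<Rightarrow> ('w \<Rightarrow> real set) \<Rightarrow> real measure \<Rightarrow> bool" where
  "poisson_process M N \<mu> \<longleftrightarrow>
     prob_space M \<and>
     (\<forall>\<omega>\<in>space M. countable (N \<omega>)) \<and>
     (\<forall>A\<in>sets \<mu>. point_count N A \<in> borel_measurable M) \<and>
     (\<forall>A\<in>sets \<mu>. emeasure \<mu> A < \<infinity> \<longrightarrow>
        (\<forall>k::nat. measure M {\<omega> \<in> space M. point_count N A \<omega> = of_nat k}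
           = measure \<mu> A ^ k / fact k * exp (- measure \<mu> A))) \<and>
     (\<forall>A\<in>sets \<mu>. emeasure \<mu> A = \<infinity> \<longrightarrow> (AE \<omega> in M. point_count N A \<omega> = \<infinity>)) \<and>
     (\<forall>(I::nat set) A. finite I \<longrightarrow> A ` I \<subseteq> sets \<mu> \<longrightarrow> disjoint_family_on A I \<longrightarrow>
        prob_space.indep_vars M (\<lambda>_. borel) (\<lambda>i. point_count N (A i)) I)"

definition poisson_intensity :: "'w measure \<Rightarrow> ('w \<Rightarrow> real set) \<Rightarrow> nat \<Rightarrow> (real \<Rightarrow> real) \<Rightarrow> bool" where
  "poisson_intensity M N n f \<longleftrightarrow>
     poisson_process M N (density lborel (\<lambda>x. ennreal (real n * f x)))"

section \<open>Biorthogonal bases\<close>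

definition \<Lambda> :: "(int \<times> int) set" where
  "\<Lambda> = {(j, k). j \<ge> -1}"

text \<open>The function with index \<open>\<lambda>\<close> generated by a father function \<open>g\<close> and a mother function
  \<open>h\<close>; it serves both for the analysis functions and for the reconstruction functions.\<close>

definition wav :: "(real \<Rightarrow> real) \<Rightarrow> (real \<Rightarrow> real) \<Rightarrow> int \<times> int \<Rightarrow> real \<Rightarrow> real" where
  "wav g h = (\<lambda>(j, k) x.
     if j = -1 then g (x - of_int k)
     else 2 powr (of_int j / 2) * h (2 powr of_int j * x - of_int k))"

definition \<phi> :: "real \<Rightarrow> real" where
  "\<phi> = indicator {0..1}"

definition haar :: "real \<Rightarrow> real" where
  "haar x = indicator {0..1/2} x - indicator {1/2<..1} x"

definition compactly_supported :: "(real \<Rightarrow> real) \<Rightarrow> bool" where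
  "compactly_supported g \<longleftrightarrow> compact (closure {x. g x \<noteq> 0})"

text \<open>The values at the finitely many break points are arbitrary.\<close>

definition piecewise_constant :: "(real \<Rightarrow> real) \<Rightarrow> bool" where
  "piecewise_constant g \<longleftrightarrow>
     (\<exists>S. finite S \<and> (\<forall>x y. x \<le> y \<longrightarrow> {x..y} \<inter> S = {} \<longrightarrow> g x = g y))"

text \<open>Convention: \<open>s = m + \<delta>\<close> with \<open>m\<close> a natural number and \<open>0 < \<delta> \<le> 1\<close>, so that for integer
  \<open>s\<close> the derivative of order \<open>s - 1\<close> is Lipschitz.\<close>

definition holder_space :: "real \<Rightarrow> (real \<Rightarrow> real) set" where
  "holder_space s = {g. \<exists>m::nat. real m < s \<and> s \<le> real m + 1 \<and>
     (\<forall>i<m. \<forall>x. (deriv ^^ i) g differentiable (at x)) \<and>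
     (\<forall>i\<le>m. bounded (range ((deriv ^^ i) g))) \<and>
     (\<exists>L. \<forall>x y. \<bar>(deriv ^^ m) g x - (deriv ^^ m) g y\<bar> \<le> L * \<bar>x - y\<bar> powr (s - real m))}"

definition smooth_system :: "real \<Rightarrow> (real \<Rightarrow> real) \<Rightarrow> (real \<Rightarrow> real) \<Rightarrow> (real \<Rightarrow> real) \<Rightarrow> bool" where
  "smooth_system r \<psi> \<phi>' \<psi>' \<longleftrightarrow>
     r > 0 \<and>
     compactly_supported \<phi>' \<and> compactly_supported \<psi>' \<and>
     \<phi>' \<in> holder_space (r + 1) \<and> \<psi>' \<in> holder_space (r + 1) \<and>
     compactly_supported \<psi> \<and> piecewise_constant \<psi> \<and>
     (\<forall>P::real poly. real (degree P) \<le> r \<longrightarrow> (\<integral>x. \<psi> x * poly P x \<partial>lborel) = 0) \<and>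
     (\<forall>l\<in>\<Lambda>. \<forall>l'\<in>\<Lambda>. (\<integral>x. wav \<phi> \<psi> l x * wav \<phi>' \<psi>' l' x \<partial>lborel) = (if l = l' then 1 else 0))"

definition haar_system :: "real \<Rightarrow> (real \<Rightarrow> real) \<Rightarrow> (real \<Rightarrow> real) \<Rightarrow> (real \<Rightarrow> real) \<Rightarrow> bool" where
  "haar_system r \<psi> \<phi>' \<psi>' \<longleftrightarrow> r = 0 \<and> \<phi>' = \<phi> \<and> \<psi> = haar \<and> \<psi>' = haar"

definition coef :: "(real \<Rightarrow> real) \<Rightarrow> (real \<Rightarrow> real) \<Rightarrow> int \<times> int \<Rightarrow> real" where
  "coef \<psi> f l = (\<integral>x. wav \<phi> \<psi> l x * f x \<partial>lborel)"

text \<open>The moment, smoothness and biorthogonality conditions do not imply completeness: if \<open>\<psi>\<close>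
  and \<open>\<psi>'\<close> are replaced by \<open>\<lambda>x. sqrt 2 * \<psi> (2 * x)\<close> and \<open>\<lambda>x. sqrt 2 * \<psi>' (2 * x)\<close>, they still
  hold. Hence the \<open>L\<^sub>2\<close> expansion and the equivalence of norms are part of the notion of a basis.
  The expansion converges unconditionally in \<open>L\<^sub>2\<close>.\<close>

definition expansion :: "(real \<Rightarrow> real) \<Rightarrow> (real \<Rightarrow> real) \<Rightarrow> (real \<Rightarrow> real) \<Rightarrow> bool" where
  "expansion \<psi> \<phi>' \<psi>' \<longleftrightarrow> (\<forall>f\<in>L_space 2.
     ((\<lambda>F. L_norm 2 (\<lambda>x. f x - (\<Sum>l\<in>F. coef \<psi> f l * wav \<phi>' \<psi>' l x))) \<longlongrightarrow> 0)
       (finite_subsets_at_top \<Lambda>))"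

definition norm_equivalence :: "(real \<Rightarrow> real) \<Rightarrow> bool" where
  "norm_equivalence \<psi> \<longleftrightarrow> (\<exists>c1>0. \<exists>c2>0. \<forall>f\<in>L_space 2.
     ennreal c1 * (\<Sum>\<^sub>\<infinity>l\<in>\<Lambda>. ennreal ((coef \<psi> f l)\<^sup>2)) \<le> (L_norm 2 f)\<^sup>2 \<and>
     (L_norm 2 f)\<^sup>2 \<le> ennreal c2 * (\<Sum>\<^sub>\<infinity>l\<in>\<Lambda>. ennreal ((coef \<psi> f l)\<^sup>2)))"

definition biorthogonal_basis :: "real \<Rightarrow> (real \<Rightarrow> real) \<Rightarrow> (real \<Rightarrow> real) \<Rightarrow> (real \<Rightarrow> real) \<Rightarrow> bool" where
  "biorthogonal_basis r \<psi> \<phi>' \<psi>' \<longleftrightarrow>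
     (smooth_system r \<psi> \<phi>' \<psi>' \<or> haar_system r \<psi> \<phi>' \<psi>') \<and>
     expansion \<psi> \<phi>' \<psi>' \<and> norm_equivalence \<psi>"

section \<open>Besov balls\<close>

text \<open>\<^term>\<open>enn2real (1 / p)\<close> is \<open>1 / p\<close>, and \<open>0\<close> for \<open>p = \<infinity>\<close>. The \<open>l\<^sub>q\<close> norm of the weighted
  sequence of level norms is the bracket with weights \<open>2 powr (j * q * (\<alpha> + 1/2 - 1/p))\<close>, or the
  weighted supremum if \<open>q = \<infinity>\<close>.\<close>

definition besov_norm :: "(real \<Rightarrow> real) \<Rightarrow> real \<Rightarrow> ennreal \<Rightarrow> ennreal \<Rightarrow> (real \<Rightarrow> real) \<Rightarrow> ennreal" where
  "besov_norm \<psi> \<alpha> p q f =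
     seq_norm p (\<lambda>k::int. ennreal \<bar>coef \<psi> f (-1, k)\<bar>) +
     seq_norm q (\<lambda>j::nat. ennreal (2 powr (real j * (\<alpha> + 1/2 - enn2real (1 / p)))) *
       seq_norm p (\<lambda>k::int. ennreal \<bar>coef \<psi> f (int j, k)\<bar>))"

definition besov_ball ::
  "(real \<Rightarrow> real) \<Rightarrow> real \<Rightarrow> ennreal \<Rightarrow> ennreal \<Rightarrow> real \<Rightarrow> (real \<Rightarrow> real) set" where
  "besov_ball \<psi> \<alpha> p q R = {f. besov_norm \<psi> \<alpha> p q f \<le> ennreal R}"

section \<open>The thresholding estimator\<close>

text \<open>The argument \<open>X\<close> is the observed point configuration. For an integrable intensity it is
  almost surely finite, so the sums over \<open>X\<close> are finite sums almost surely.\<close>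

definition coef_hat :: "(real \<Rightarrow> real) \<Rightarrow> nat \<Rightarrow> real set \<Rightarrow> int \<times> int \<Rightarrow> real" where
  "coef_hat \<psi> n X l = 1 / real n * (\<Sum>\<^sub>\<infinity>T\<in>X. wav \<phi> \<psi> l T)"

definition V_hat :: "(real \<Rightarrow> real) \<Rightarrow> nat \<Rightarrow> real set \<Rightarrow> int \<times> int \<Rightarrow> real" where
  "V_hat \<psi> n X l = 1 / (real n)\<^sup>2 * (\<Sum>\<^sub>\<infinity>T\<in>X. (wav \<phi> \<psi> l T)\<^sup>2)"

definition V_tilde :: "(real \<Rightarrow> real) \<Rightarrow> real \<Rightarrow> nat \<Rightarrow> real set \<Rightarrow> int \<times> int \<Rightarrow> real" where
  "V_tilde \<psi> \<gamma> n X l =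
     V_hat \<psi> n X l
     + sqrt (2 * \<gamma> * ln (real n) * V_hat \<psi> n X l * ((sup_norm (wav \<phi> \<psi> l))\<^sup>2 / (real n)\<^sup>2))
     + 3 * \<gamma> * ln (real n) * ((sup_norm (wav \<phi> \<psi> l))\<^sup>2 / (real n)\<^sup>2)"

definition threshold :: "(real \<Rightarrow> real) \<Rightarrow> real \<Rightarrow> nat \<Rightarrow> real set \<Rightarrow> int \<times> int \<Rightarrow> real" where
  "threshold \<psi> \<gamma> n X l =
     sqrt (2 * \<gamma> * V_tilde \<psi> \<gamma> n X l * ln (real n))
     + \<gamma> * ln (real n) / (3 * real n) * sup_norm (wav \<phi> \<psi> l)"

definition coef_tilde ::
  "(real \<Rightarrow> real) \<Rightarrow> real \<Rightarrow> nat \<Rightarrow> (int \<times> int) set \<Rightarrow> real set \<Rightarrow> int \<times> int \<Rightarrow> real" where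
  "coef_tilde \<psi> \<gamma> n \<Gamma> X l =
     (if \<bar>coef_hat \<psi> n X l\<bar> \<ge> threshold \<psi> \<gamma> n X l \<and> l \<in> \<Gamma> then coef_hat \<psi> n X l else 0)"

definition estimator ::
  "(real \<Rightarrow> real) \<Rightarrow> (real \<Rightarrow> real) \<Rightarrow> (real \<Rightarrow> real) \<Rightarrow> real \<Rightarrow> nat \<Rightarrow> (int \<times> int) set
     \<Rightarrow> real set \<Rightarrow> real \<Rightarrow> real" where
  "estimator \<psi> \<phi>' \<psi>' \<gamma> n \<Gamma> X x =
     (\<Sum>\<^sub>\<infinity>l\<in>\<Lambda>. coef_tilde \<psi> \<gamma> n \<Gamma> X l * wav \<phi>' \<psi>' l x)"

definition max_level :: "real \<Rightarrow> nat \<Rightarrow> int" where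
  "max_level c n = (THE j0::int.
     2 powr of_int j0 \<le> real n powr c * ln (real n) powr (- c) \<and>
     real n powr c * ln (real n) powr (- c) < 2 powr (of_int j0 + 1))"

definition \<Gamma>_level :: "real \<Rightarrow> nat \<Rightarrow> (int \<times> int) set" where
  "\<Gamma>_level c n = {(j, k) \<in> \<Lambda>. j \<le> max_level c n}"

end

theory Submission
  imports Defs
begin

text \<open>Write \<open>L\<close> for \<open>ln n\<close>. For an index with analysis function \<open>w\<close> let \<open>\<beta>\<close> be the coefficient of
  \<open>f\<close>, \<open>b\<close> the supremum norm of \<open>w\<close>, and \<open>F\<close> the mass that \<open>f\<close> gives to \<open>{w \<noteq> 0}\<close>.

  By biorthogonality the coefficients of \<open>estimator - f\<close> are the errors of the thresholded
  coefficients (\<open>estimator_error\<close>), so the norm equivalence reduces the risk to the sum of the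
  risks of the coefficients.

  The analysis functions are step functions. An empirical coefficient is therefore a finite linear
  combination of independent Poisson counts, its Laplace transform is explicit, and Bernstein
  bounds with the true variance and a lower tail bound for the estimated variance follow. Together
  they show that, for every \<open>\<kappa>\<close> between \<open>0\<close> and \<open>1\<close>, the noise exceeds \<open>\<kappa>\<close> times the random threshold with
  probability at most \<open>3 * n powr (- \<kappa>\<^sup>2 * \<gamma>)\<close> (\<open>noise_exceeds_threshold\<close>). Since \<open>\<gamma> > c\<close>, some
  \<open>\<kappa> < 1\<close> still has \<open>\<kappa>\<^sup>2 * \<gamma> > c\<close>. If the noise is below \<open>\<kappa>\<close> times the threshold, keeping or
  killing the coefficient costs at most a constant times the smaller of \<open>\<beta>\<^sup>2\<close> and the squared
  threshold. The result is the oracle inequality \<open>coefficient_risk\<close>: up to a constant, the risk of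
  a coefficient is at most \<open>min (\<beta>\<^sup>2) (b\<^sup>2 * F * L / n) + (\<beta>\<^sup>2 + b\<^sup>2 * F / n) * n powr (- c)\<close>. There
  are infinitely many positions on each level, and the factor \<open>F\<close> makes the bound summable over
  them.

  On level \<open>j\<close> the supports overlap boundedly and \<open>f\<close> has mass at most \<open>R'\<close>, so \<open>b\<^sup>2 * F\<close> sums to
  \<open>O(2 ^ j)\<close> and the absolute values of the coefficients sum to \<open>O(2 powr (j / 2))\<close>. On the real
  line this \<open>l\<^sub>1\<close> bound replaces the compactness of the domain: interpolating it with the
  \<open>l\<^sub>p\<close> bound of the Besov ball gives \<open>O(2 powr (- \<rho> * j))\<close> for the sum of the squares, where
  \<open>\<rho> = \<alpha> / (1 - 1 / p)\<close> (\<open>besov_level_sum\<close>). Use \<open>b\<^sup>2 * F * L / n\<close> up to a level \<open>J\<close> and \<open>\<beta>\<^sup>2\<close>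
  beyond it. The two sums balance for \<open>2 ^ J \<approx> (n / L) powr (1 / (\<rho> + 1))\<close>, at the value
  \<open>(L / n) powr (\<rho> / (\<rho> + 1))\<close>, and \<open>\<rho> / (\<rho> + 1) = \<alpha> / (\<alpha> + 1 - 1 / p)\<close>. Because \<open>c \<ge> 1\<close>, the level
  \<open>J\<close> does not exceed the finest level of the estimator. The terms with \<open>n powr (- c)\<close> add up to
  \<open>O(1 / n)\<close>, because \<open>c \<ge> 1\<close> and the finest level satisfies \<open>2 powr j\<^sub>0 \<le> (n / L) powr c\<close>.\<close>

section \<open>Elementary inequalities\<close>

text \<open>After multiplication by the denominator the difference of the two sides, times \<open>exp (- y)\<close>, is
  the function \<open>G\<close> below. Its derivative is nonnegative because \<open>exp x\<close> dominates its quadratic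
  Taylor polynomial.\<close>

lemma exp_le_bernstein_quotient:
  fixes y :: real
  assumes "0 \<le> y" "y < 3"
  shows "exp y \<le> 1 + y + y\<^sup>2 / (2 * (1 - y / 3))"
proof -
  define G where "G = (\<lambda>y::real. exp (- y) * (2 + 4 * y / 3 + y\<^sup>2 / 3) - (2 - 2 * y / 3))"
  have "G 0 \<le> G y"
  proof (rule DERIV_nonneg_imp_nondecreasing[OF \<open>0 \<le> y\<close>])
    fix x :: real assume x: "0 \<le> x" "x \<le> y"
    have "(G has_real_derivative (2/3) * (1 - exp (- x) * (1 + x + x\<^sup>2 / 2))) (at x)"
      unfolding G_def
      by (auto intro!: derivative_eq_intros simp: field_simps power2_eq_square)
    moreover have "exp (- x) * (1 + x + x\<^sup>2 / 2) \<le> 1"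
      using exp_lower_Taylor_quadratic[OF x(1)]
      by (simp add: exp_minus field_simps)
    ultimately show "\<exists>d. (G has_real_derivative d) (at x) \<and> 0 \<le> d"
      by (intro exI[of _ "(2/3) * (1 - exp (- x) * (1 + x + x\<^sup>2 / 2))"]) auto
  qed
  then have "2 - 2 * y / 3 \<le> exp (- y) * (2 + 4 * y / 3 + y\<^sup>2 / 3)"
    by (simp add: G_def)
  then have "exp y * (2 - 2 * y / 3) \<le> 2 + 4 * y / 3 + y\<^sup>2 / 3"
    by (simp add: exp_minus field_simps)
  then have "exp y \<le> (2 + 4 * y / 3 + y\<^sup>2 / 3) / (2 - 2 * y / 3)"
    using assms by (simp add: pos_le_divide_eq)
  also have "\<dots> = 1 + y + y\<^sup>2 / (2 * (1 - y / 3))"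
    using assms by (simp add: field_simps power2_eq_square)
  finally show ?thesis .
qed

lemma exp_minus_le_quadratic:
  fixes y :: real
  assumes "0 \<le> y"
  shows "exp (- y) \<le> 1 - y + y\<^sup>2 / 2"
proof -
  define G where "G = (\<lambda>y::real. 1 - y + y\<^sup>2 / 2 - exp (- y))"
  have "G 0 \<le> G y"
  proof (rule DERIV_nonneg_imp_nondecreasing[OF assms])
    fix x :: real
    have "(G has_real_derivative - 1 + x + exp (- x)) (at x)"
      unfolding G_def by (auto intro!: derivative_eq_intros)
    moreover have "0 \<le> - 1 + x + exp (- x)" using exp_ge_add_one_self[of "- x"] by simp
    ultimately show "\<exists>d. (G has_real_derivative d) (at x) \<and> 0 \<le> d" by blast
  qed
  then show ?thesis by (simp add: G_def)
qed

text \<open>The cumulant of a centred Poisson count of mean \<open>m\<close> at \<open>y\<close> is \<open>m * (exp y - 1 - y)\<close>; this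
  bound is what produces the Bernstein constants.\<close>

lemma exp_le_bernstein:
  fixes y b :: real
  assumes "\<bar>y\<bar> \<le> b" "b < 3"
  shows "exp y - 1 - y \<le> y\<^sup>2 / (2 * (1 - b / 3))"
proof (cases "0 \<le> y")
  case True
  have "exp y - 1 - y \<le> y\<^sup>2 / (2 * (1 - y / 3))"
    using exp_le_bernstein_quotient[of y] True assms by simp
  also have "\<dots> \<le> y\<^sup>2 / (2 * (1 - b / 3))"
    using assms True by (intro divide_left_mono) auto
  finally show ?thesis .
next
  case False
  have "exp y - 1 - y \<le> y\<^sup>2 / 2"
    using exp_minus_le_quadratic[of "- y"] False by simp
  also have "\<dots> \<le> y\<^sup>2 / (2 * (1 - b / 3))"
    using assms False by (intro divide_left_mono) auto
  finally show ?thesis .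
qed

text \<open>A lower tail bound for the estimated variance \<open>W\<close> contains the true variance \<open>V\<close> on both sides.
  Solving the quadratic inequality for \<open>sqrt V\<close> leaves a bound in terms of \<open>W\<close> alone, which
  has the shape of \<^const>\<open>V_tilde\<close>.\<close>

lemma quadratic_self_bound:
  fixes V W a :: real
  assumes "0 \<le> V" "0 \<le> W" "0 \<le> a" and V: "V \<le> W + sqrt (2 * a * V)"
  shows "V \<le> W + sqrt (2 * a * W) + 3 * a"
proof -
  define x w d where "x = sqrt V" and "w = sqrt W" and "d = sqrt (2 * a)"
  have [simp]: "0 \<le> x" "0 \<le> w" "0 \<le> d" using assms by (auto simp: x_def w_def d_def)
  have sq: "V = x * x" "W = w * w" "2 * a = d * d" using assms by (auto simp: x_def w_def d_def)
  have s: "sqrt (2 * a * V) = d * x" "sqrt (2 * a * W) = d * w"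
    by (simp_all add: real_sqrt_mult x_def w_def d_def)
  have *: "x * x \<le> w * w + d * x" using V s sq by simp
  have "x \<le> w + d"
  proof (rule ccontr)
    assume "\<not> x \<le> w + d"
    then have "w < x - d" by simp
    have "w * w \<le> w * (x - d)"
      using \<open>w < x - d\<close> \<open>0 \<le> w\<close> by (intro mult_left_mono) auto
    also have "\<dots> < x * (x - d)"
      using \<open>w < x - d\<close> \<open>0 \<le> w\<close> \<open>0 \<le> d\<close> by (intro mult_strict_right_mono) linarith+
    finally have "w * w < x * (x - d)" .
    with * show False by (simp add: algebra_simps)
  qed
  then have "d * x \<le> d * (w + d)" by (intro mult_left_mono) auto
  with * have "x * x \<le> w * w + d * w + d * d" by (simp add: algebra_simps)
  then show ?thesis using sq s \<open>0 \<le> a\<close> by simp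
qed

lemma square_le_exp:
  fixes x :: real
  assumes "0 \<le> x"
  shows "x\<^sup>2 \<le> 2 * exp x - 2 * x - 2"
  using exp_lower_Taylor_quadratic[OF assms] by simp

text \<open>Logarithmic factors are absorbed by an arbitrarily small part of the exponent.\<close>

lemma square_times_exp_minus_le:
  fixes L d :: real
  assumes "0 \<le> L" "0 < d"
  shows "L\<^sup>2 * exp (- (d * L)) \<le> 2 / d\<^sup>2"
proof -
  have "(d * L)\<^sup>2 \<le> 2 * exp (d * L)"
    using square_le_exp[of "d * L"] assms by (smt (verit) mult_nonneg_nonneg)
  then show ?thesis using assms by (simp add: exp_minus field_simps power_mult_distrib)
qed

lemma square_le_two_sums:
  fixes x y :: real
  shows "(x + y)\<^sup>2 \<le> 2 * x\<^sup>2 + 2 * y\<^sup>2" "(x - y)\<^sup>2 \<le> 2 * x\<^sup>2 + 2 * y\<^sup>2"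
  using zero_le_power2[of "x - y"] zero_le_power2[of "x + y"]
  by (auto simp: power2_eq_square algebra_simps)

section \<open>Poisson counts and exponential tail bounds\<close>

definition poisson_count :: "'w measure \<Rightarrow> ('w \<Rightarrow> ennreal) \<Rightarrow> real \<Rightarrow> bool" where
  "poisson_count M Z m \<longleftrightarrow> Z \<in> borel_measurable M \<and> 0 \<le> m \<and>
     (\<forall>k::nat. measure M {\<omega> \<in> space M. Z \<omega> = of_nat k} = m ^ k / fact k * exp (- m))"

lemma poisson_weights_sums:
  fixes m :: real
  shows "(\<lambda>k. x ^ k * (m ^ k / fact k * exp (- m))) sums exp (m * (x - 1))"
proof -
  have "(\<lambda>k. (x * m) ^ k / fact k) sums exp (x * m)"
    using exp_converges[of "x * m"] by (simp add: field_simps scaleR_conv_of_real)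
  from sums_mult2[OF this, of "exp (- m)"] show ?thesis
    by (simp add: power_mult_distrib mult_ac exp_add[symmetric] right_diff_distrib)
qed

context prob_space
begin

text \<open>The Poisson weights add up to one, so the infinite value and the non-integral ones have
  probability zero.\<close>

lemma poisson_count_AE_nat:
  assumes "poisson_count M Z m"
  shows "AE \<omega> in M. \<exists>k::nat. Z \<omega> = of_nat k"
proof -
  have [measurable]: "Z \<in> borel_measurable M" using assms by (simp add: poisson_count_def)
  define E where "E = (\<lambda>k::nat. {\<omega> \<in> space M. Z \<omega> = of_nat k})"
  have sets: "range E \<subseteq> sets M" unfolding E_def by auto
  have "disjoint_family E" by (auto simp: disjoint_family_on_def E_def)
  from finite_measure_UNION[OF sets this]
  have 1: "(\<lambda>k. prob (E k)) sums prob (\<Union>k. E k)" .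
  have 2: "prob (E k) = 1 ^ k * (m ^ k / fact k * exp (- m))" for k
    using assms by (simp add: poisson_count_def E_def)
  have "prob (\<Union>k. E k) = exp (m * (1 - 1))"
    using sums_unique2[OF 1[unfolded 2] poisson_weights_sums] .
  then have "prob (\<Union>k. E k) = 1" by simp
  moreover have "(\<Union>k. E k) \<in> sets M" using sets by auto
  ultimately have "AE \<omega> in M. \<omega> \<in> (\<Union>k. E k)" by (simp add: prob_eq_1)
  then show ?thesis by eventually_elim (auto simp: E_def)
qed

lemma poisson_count_nn_integral:
  fixes h :: "real \<Rightarrow> real"
  assumes Z: "poisson_count M Z m" and h: "\<And>k. 0 \<le> h (real k)"
    and s: "(\<lambda>k. h (real k) * (m ^ k / fact k * exp (- m))) sums s"
  shows "(\<integral>\<^sup>+\<omega>. ennreal (h (enn2real (Z \<omega>))) \<partial>M) = ennreal s"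
proof -
  have [measurable]: "Z \<in> borel_measurable M" and "0 \<le> m" using Z by (simp_all add: poisson_count_def)
  define E where "E = (\<lambda>k::nat. {\<omega> \<in> space M. Z \<omega> = of_nat k})"
  have [measurable]: "E k \<in> sets M" for k unfolding E_def by auto
  have pk: "prob (E k) = m ^ k / fact k * exp (- m)" for k
    using Z by (simp add: poisson_count_def E_def)
  have "(\<integral>\<^sup>+\<omega>. ennreal (h (enn2real (Z \<omega>))) \<partial>M)
      = (\<integral>\<^sup>+\<omega>. (\<Sum>k. ennreal (h (real k)) * indicator (E k) \<omega>) \<partial>M)"
  proof (rule nn_integral_cong_AE)
    show "AE \<omega> in M. ennreal (h (enn2real (Z \<omega>))) = (\<Sum>k. ennreal (h (real k)) * indicator (E k) \<omega>)"
      using poisson_count_AE_nat[OF Z] AE_space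
    proof eventually_elim
      case (elim \<omega>)
      then obtain k where k: "Z \<omega> = of_nat k" by blast
      have "(\<Sum>i. ennreal (h (real i)) * indicator (E i) \<omega>)
          = (\<Sum>i\<in>{k}. ennreal (h (real i)) * indicator (E i) \<omega>)"
        by (rule suminf_finite) (auto simp: E_def k indicator_def)
      with k elim show ?case by (simp add: E_def ennreal_of_nat_eq_real_of_nat)
    qed
  qed
  also have "\<dots> = (\<Sum>k. ennreal (h (real k)) * emeasure M (E k))"
    by (simp add: nn_integral_suminf nn_integral_cmult)
  also have "\<dots> = (\<Sum>k. ennreal (h (real k) * (m ^ k / fact k * exp (- m))))"
    by (simp only: emeasure_eq_measure pk ennreal_mult'[OF h])
  also have "\<dots> = ennreal s"
    using s h \<open>0 \<le> m\<close> by (intro suminf_ennreal_eq) auto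
  finally show ?thesis .
qed

lemma poisson_count_exp:
  assumes "poisson_count M Z m"
  shows "(\<integral>\<^sup>+\<omega>. ennreal (exp (t * enn2real (Z \<omega>))) \<partial>M) = ennreal (exp (m * (exp t - 1)))"
  using poisson_count_nn_integral[OF assms, of "\<lambda>x. exp (t * x)"] poisson_weights_sums[of "exp t" m]
  by (simp add: exp_of_nat_mult mult.commute[of t])

text \<open>The weights satisfy \<open>real (Suc k) * w (Suc k) = m * w k\<close>, which shifts the series for the mean
  onto the one for the total mass.\<close>

lemma poisson_count_mean:
  assumes "poisson_count M Z m"
  shows "(\<integral>\<^sup>+\<omega>. ennreal (enn2real (Z \<omega>)) \<partial>M) = ennreal m"
proof (rule poisson_count_nn_integral[OF assms, of "\<lambda>x. x"])
  have "(\<lambda>k. m * (m ^ k / fact k * exp (- m))) sums m"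
    using sums_mult[OF poisson_weights_sums[of 1 m], of m] by simp
  moreover have "m * (m ^ k / fact k * exp (- m))
      = real (Suc k) * (m ^ Suc k / fact (Suc k) * exp (- m))" for k
    by (simp add: divide_simps del: of_nat_Suc)
  ultimately have "(\<lambda>k. real (Suc k) * (m ^ Suc k / fact (Suc k) * exp (- m))) sums m" by (simp only:)
  then show "(\<lambda>k. real k * (m ^ k / fact k * exp (- m))) sums m"
    by (subst (asm) sums_Suc_iff) simp
qed simp

lemma chernoff_bound:
  fixes Y :: "'a \<Rightarrow> real"
  assumes [measurable]: "Y \<in> borel_measurable M" and "0 \<le> t"
    and E: "(\<integral>\<^sup>+\<omega>. ennreal (exp (t * Y \<omega>)) \<partial>M) \<le> ennreal (exp K)"
  shows "prob {\<omega> \<in> space M. Y \<omega> > x} \<le> exp (K - t * x)"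
proof -
  have "emeasure M {\<omega> \<in> space M. Y \<omega> > x} \<le> (\<integral>\<^sup>+\<omega>. ennreal (exp (- t * x)) * ennreal (exp (t * Y \<omega>)) \<partial>M)"
  proof (subst nn_integral_indicator[symmetric])
    show "{\<omega> \<in> space M. Y \<omega> > x} \<in> sets M" by measurable
    have "1 \<le> exp (- t * x) * exp (t * Y \<omega>)" if "Y \<omega> > x" for \<omega>
    proof -
      have "t * x \<le> t * Y \<omega>" using that \<open>0 \<le> t\<close> by (intro mult_left_mono) auto
      then show ?thesis by (simp add: exp_add[symmetric])
    qed
    then show "integral\<^sup>N M (indicator {\<omega> \<in> space M. x < Y \<omega>})
        \<le> (\<integral>\<^sup>+\<omega>. ennreal (exp (- t * x)) * ennreal (exp (t * Y \<omega>)) \<partial>M)"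
      by (intro nn_integral_mono)
        (auto simp: indicator_def ennreal_mult[symmetric] ennreal_1[symmetric] simp del: ennreal_1)
  qed
  also have "\<dots> = ennreal (exp (- t * x)) * (\<integral>\<^sup>+\<omega>. ennreal (exp (t * Y \<omega>)) \<partial>M)"
    by (intro nn_integral_cmult) measurable
  also have "\<dots> \<le> ennreal (exp (- t * x)) * ennreal (exp K)"
    by (intro mult_left_mono E) simp
  also have "\<dots> = ennreal (exp (K - t * x))"
    by (simp add: ennreal_mult[symmetric] exp_add[symmetric])
  finally show ?thesis by (simp add: emeasure_eq_measure)
qed

text \<open>Chernoff bound with the optimal parameter. The deviation is written so that its probability is
  exactly \<open>exp (- u)\<close>, since the thresholds are calibrated by \<open>u\<close>.\<close>

lemma bernstein_tail:
  fixes Y :: "'a \<Rightarrow> real"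
  assumes Y: "Y \<in> borel_measurable M" and "0 \<le> v" "0 < b" "0 \<le> u"
    and E: "\<And>t. 0 \<le> t \<Longrightarrow> t * b < 3 \<Longrightarrow>
      (\<integral>\<^sup>+\<omega>. ennreal (exp (t * Y \<omega>)) \<partial>M) \<le> ennreal (exp (t\<^sup>2 * v / (2 * (1 - t * b / 3))))"
  shows "prob {\<omega> \<in> space M. Y \<omega> > sqrt (2 * u * v) + u * b / 3} \<le> exp (- u)"
proof (cases "v = 0")
  case True
  \<comment> \<open>Without variance every \<open>t < 3 / b\<close> is admissible, and the bound follows as \<open>t\<close> tends to \<open>3 / b\<close>.\<close>
  have "prob {\<omega> \<in> space M. Y \<omega> > u * b / 3} \<le> exp (- (t * (u * b / 3)))" if "0 \<le> t" "t < 3 / b" for t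
    using chernoff_bound[OF Y \<open>0 \<le> t\<close>, of 0 "u * b / 3"] E[of t] that \<open>0 < b\<close> True
    by (simp add: field_simps)
  then have "\<forall>\<^sub>F t in at_left (3 / b). prob {\<omega> \<in> space M. Y \<omega> > u * b / 3} \<le> exp (- (t * (u * b / 3)))"
    using eventually_at_left_real[of 0 "3 / b"] \<open>0 < b\<close> by (auto elim!: eventually_mono)
  moreover have "((\<lambda>t. exp (- (t * (u * b / 3)))) \<longlongrightarrow> exp (- (3 / b * (u * b / 3)))) (at_left (3 / b))"
    by (intro tendsto_intros)
  ultimately have "prob {\<omega> \<in> space M. Y \<omega> > u * b / 3} \<le> exp (- (3 / b * (u * b / 3)))"
    by (intro tendsto_lowerbound) auto
  with True \<open>0 < b\<close> show ?thesis by simp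
next
  case False
  then have "0 < v" using \<open>0 \<le> v\<close> by simp
  \<comment> \<open>The optimum is \<open>t / (1 - t * b / 3) = sqrt (2 * u / v)\<close>, solved for \<open>t\<close>.\<close>
  define y where "y = sqrt (2 * u / v)"
  have "0 \<le> y" by (simp add: y_def \<open>0 \<le> u\<close> \<open>0 \<le> v\<close>)
  define t where "t = y / (1 + y * b / 3)"
  have pos: "0 < 1 + y * b / 3" using \<open>0 \<le> y\<close> \<open>0 < b\<close> by (simp add: add_pos_nonneg)
  have u: "u = v * y\<^sup>2 / 2" using \<open>0 < v\<close> \<open>0 \<le> u\<close> by (simp add: y_def)
  have sq: "sqrt (2 * u * v) = v * y"
    unfolding u using \<open>0 < v\<close> \<open>0 \<le> y\<close> by (simp add: real_sqrt_mult power2_eq_square real_sqrt_unique)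
  have tb: "1 - t * b / 3 = 1 / (1 + y * b / 3)" using pos by (simp add: t_def field_simps)
  have "0 \<le> t" using \<open>0 \<le> y\<close> pos by (simp add: t_def)
  have "0 < 1 - t * b / 3" unfolding tb using pos by simp
  then have "t * b < 3" by simp
  have ty: "t * (1 + y * b / 3) = y" using pos by (simp add: t_def)
  have e1: "t\<^sup>2 * v / (2 * (1 - t * b / 3)) = t * (t * (1 + y * b / 3)) * v / 2"
    unfolding tb by (simp add: power2_eq_square)
  have e2: "t * (v * y + u * b / 3) = t * y * v / 2 + (t * (1 + y * b / 3)) * (v * y / 2)"
    unfolding u by (simp add: field_simps power2_eq_square)
  have "t\<^sup>2 * v / (2 * (1 - t * b / 3)) - t * (v * y + u * b / 3) = - u"
    unfolding e1 e2 ty using u by (simp add: power2_eq_square)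
  with chernoff_bound[OF Y \<open>0 \<le> t\<close> E[OF \<open>0 \<le> t\<close> \<open>t * b < 3\<close>], of "v * y + u * b / 3"] sq
  show ?thesis by simp
qed

end

section \<open>Weighted sums of independent Poisson counts\<close>

text \<open>The first summand comes from the event of small noise, the others from its complement: the
  second and fourth if at least one point is expected in the support, the third if not, and the
  last from the squared mean of the coefficient. The square root is the factor \<open>\<kappa>\<close> for which
  \<open>\<kappa>\<^sup>2 * \<gamma>\<close> is the midpoint of \<open>c\<close> and \<open>\<gamma>\<close>.\<close>

definition risk_constant :: "real \<Rightarrow> real \<Rightarrow> real" where
  "risk_constant \<gamma> c =
     92 * \<gamma>\<^sup>2 / (1 - sqrt ((\<gamma> + c) / (2 * \<gamma>)))\<^sup>2 + 24 * c\<^sup>2 / (\<gamma> - c)\<^sup>2 + 4 * exp 4 * exp (exp 4) + 4 * exp 6 + 9"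

lemma risk_constant_nonneg: "0 \<le> risk_constant \<gamma> c"
  by (simp add: risk_constant_def)

text \<open>The counts of a Poisson process on the level sets of a step function that takes the values
  \<open>a i\<close> form such a family. In terms of the observation with sample size \<open>n\<close>, the quantities
  defined below are the unnormalised statistics: \<open>S\<close> is \<open>n\<close> times the empirical coefficient and
  \<open>s\<close> its mean, \<open>W\<close> is \<open>n\<^sup>2\<close> times the estimated variance and \<open>v\<close> its mean, \<open>K\<close> is the number
  of points in the support and \<open>\<mu>\<close> its mean.\<close>

locale poisson_family = prob_space M for M :: "'w measure" +
  fixes I :: "'i set" and Z :: "'i \<Rightarrow> 'w \<Rightarrow> ennreal" and m a :: "'i \<Rightarrow> real" and b :: real
  assumes finite_I: "finite I"
    and indep: "indep_vars (\<lambda>_. borel) Z I"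
    and count: "\<And>i. i \<in> I \<Longrightarrow> poisson_count M (Z i) (m i)"
    and a_bound: "\<And>i. i \<in> I \<Longrightarrow> \<bar>a i\<bar> \<le> b"
    and b_pos: "0 < b"
begin

definition S :: "'w \<Rightarrow> real" where "S \<omega> = (\<Sum>i\<in>I. a i * enn2real (Z i \<omega>))"
definition W :: "'w \<Rightarrow> real" where "W \<omega> = (\<Sum>i\<in>I. (a i)\<^sup>2 * enn2real (Z i \<omega>))"
definition K :: "'w \<Rightarrow> real" where "K \<omega> = (\<Sum>i\<in>I. enn2real (Z i \<omega>))"
definition s :: real where "s = (\<Sum>i\<in>I. a i * m i)"
definition v :: real where "v = (\<Sum>i\<in>I. (a i)\<^sup>2 * m i)"
definition \<mu> :: real where "\<mu> = (\<Sum>i\<in>I. m i)"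

lemma Z_measurable [measurable]: "i \<in> I \<Longrightarrow> Z i \<in> borel_measurable M"
  using count by (simp add: poisson_count_def)

lemma m_nonneg: "i \<in> I \<Longrightarrow> 0 \<le> m i"
  using count by (simp add: poisson_count_def)

lemma SWK_measurable [measurable]:
  "S \<in> borel_measurable M" "W \<in> borel_measurable M" "K \<in> borel_measurable M"
  unfolding S_def[abs_def] W_def[abs_def] K_def[abs_def] by measurable

lemma a_sq: "i \<in> I \<Longrightarrow> (a i)\<^sup>2 \<le> b\<^sup>2"
  using a_bound[of i] b_pos by (simp add: abs_le_square_iff[symmetric])

lemma bounds: "0 \<le> W \<omega>" "0 \<le> K \<omega>" "\<bar>S \<omega>\<bar> \<le> b * K \<omega>" "0 \<le> v" "0 \<le> \<mu>" "v \<le> b\<^sup>2 * \<mu>" "\<bar>s\<bar> \<le> b * \<mu>"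
proof -
  show "0 \<le> W \<omega>" "0 \<le> K \<omega>" "0 \<le> v" "0 \<le> \<mu>"
    unfolding W_def K_def v_def \<mu>_def by (auto intro!: sum_nonneg simp: m_nonneg)
  show "\<bar>S \<omega>\<bar> \<le> b * K \<omega>" unfolding S_def K_def sum_distrib_left
    by (rule order.trans[OF sum_abs]) (auto intro!: sum_mono mult_right_mono simp: abs_mult a_bound)
  show "\<bar>s\<bar> \<le> b * \<mu>" unfolding s_def \<mu>_def sum_distrib_left
    by (rule order.trans[OF sum_abs]) (auto intro!: sum_mono mult_right_mono simp: abs_mult a_bound m_nonneg)
  show "v \<le> b\<^sup>2 * \<mu>" unfolding v_def \<mu>_def sum_distrib_left
    by (auto intro!: sum_mono mult_right_mono simp: a_sq m_nonneg)
qed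

text \<open>Independence turns the Laplace transform into a product of the transforms of single counts.\<close>

lemma laplace_transform:
  "(\<integral>\<^sup>+\<omega>. ennreal (exp (\<Sum>i\<in>I. t i * enn2real (Z i \<omega>))) \<partial>M)
    = ennreal (exp (\<Sum>i\<in>I. m i * (exp (t i) - 1)))"
proof -
  have ind: "indep_vars (\<lambda>_. borel) (\<lambda>i \<omega>. ennreal (exp (t i * enn2real (Z i \<omega>)))) I"
    by (rule indep_vars_compose2[OF indep]) measurable
  have "(\<integral>\<^sup>+\<omega>. ennreal (exp (\<Sum>i\<in>I. t i * enn2real (Z i \<omega>))) \<partial>M)
      = (\<integral>\<^sup>+\<omega>. (\<Prod>i\<in>I. ennreal (exp (t i * enn2real (Z i \<omega>)))) \<partial>M)"
    by (simp add: exp_sum finite_I prod_ennreal)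
  also have "\<dots> = (\<Prod>i\<in>I. ennreal (exp (m i * (exp (t i) - 1))))"
    by (subst indep_vars_nn_integral[OF finite_I ind]) (simp_all add: poisson_count_exp[OF count])
  also have "\<dots> = ennreal (exp (\<Sum>i\<in>I. m i * (exp (t i) - 1)))"
    by (simp add: exp_sum finite_I prod_ennreal)
  finally show ?thesis .
qed

lemma centred_exponential_moment:
  assumes "\<bar>t\<bar> * b < 3"
  shows "(\<integral>\<^sup>+\<omega>. ennreal (exp (t * (S \<omega> - s))) \<partial>M)
    \<le> ennreal (exp (t\<^sup>2 * v / (2 * (1 - \<bar>t\<bar> * b / 3))))"
proof -
  have "exp (t * (S \<omega> - s)) = exp (- t * s) * exp (\<Sum>i\<in>I. t * a i * enn2real (Z i \<omega>))" for \<omega>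
    by (simp add: S_def exp_add[symmetric] sum_distrib_left right_diff_distrib mult.assoc)
  then have "(\<integral>\<^sup>+\<omega>. ennreal (exp (t * (S \<omega> - s))) \<partial>M)
      = ennreal (exp (- t * s)) * ennreal (exp (\<Sum>i\<in>I. m i * (exp (t * a i) - 1)))"
    by (simp add: ennreal_mult' nn_integral_cmult laplace_transform)
  also have "\<dots> = ennreal (exp (\<Sum>i\<in>I. m i * (exp (t * a i) - 1 - t * a i)))"
    by (simp add: ennreal_mult'[symmetric] exp_add[symmetric] s_def sum_distrib_left
        sum_subtractf sum_negf right_diff_distrib mult_ac)
  also have "(\<Sum>i\<in>I. m i * (exp (t * a i) - 1 - t * a i))
      \<le> (\<Sum>i\<in>I. m i * ((t * a i)\<^sup>2 / (2 * (1 - \<bar>t\<bar> * b / 3))))"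
    using assms by (intro sum_mono mult_left_mono exp_le_bernstein)
      (auto simp: m_nonneg abs_mult a_bound mult_left_mono)
  also have "\<dots> = t\<^sup>2 * v / (2 * (1 - \<bar>t\<bar> * b / 3))"
    by (simp add: v_def sum_distrib_left sum_divide_distrib power_mult_distrib mult_ac)
  finally show ?thesis by (simp add: ennreal_leI)
qed

lemma upper_deviation:
  assumes "0 \<le> u"
  shows "prob {\<omega> \<in> space M. \<bar>S \<omega> - s\<bar> > sqrt (2 * u * v) + u * b / 3} \<le> 2 * exp (- u)"
proof -
  let ?x = "sqrt (2 * u * v) + u * b / 3"
  have "prob {\<omega> \<in> space M. \<bar>S \<omega> - s\<bar> > ?x}
      \<le> prob ({\<omega> \<in> space M. S \<omega> - s > ?x} \<union> {\<omega> \<in> space M. - (S \<omega> - s) > ?x})"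
    by (intro finite_measure_mono) (auto simp: abs_if split: if_splits)
  also have "\<dots> \<le> prob {\<omega> \<in> space M. S \<omega> - s > ?x} + prob {\<omega> \<in> space M. - (S \<omega> - s) > ?x}"
    by (intro measure_Un_le) measurable
  also have "\<dots> \<le> exp (- u) + exp (- u)"
  proof (intro add_mono bernstein_tail bounds b_pos assms)
    fix t :: real assume t: "0 \<le> t" "t * b < 3"
    show "(\<integral>\<^sup>+\<omega>. ennreal (exp (t * (S \<omega> - s))) \<partial>M) \<le> ennreal (exp (t\<^sup>2 * v / (2 * (1 - t * b / 3))))"
      using centred_exponential_moment[of t] t by simp
    have "t * - (S \<omega> - s) = - t * (S \<omega> - s)" for \<omega> by (simp only: mult_minus_left mult_minus_right)
    then show "(\<integral>\<^sup>+\<omega>. ennreal (exp (t * - (S \<omega> - s))) \<partial>M) \<le> ennreal (exp (t\<^sup>2 * v / (2 * (1 - t * b / 3))))"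
      using centred_exponential_moment[of "- t"] t by (simp only: abs_minus_cancel abs_of_nonneg power2_minus)
  qed measurable
  finally show ?thesis by simp
qed

text \<open>\<open>W\<close> is a positive combination of Poisson counts, so its lower tail is sub-Gaussian with
  variance proxy \<open>b\<^sup>2 * v\<close>: only \<open>exp (- y) \<le> 1 - y + y\<^sup>2 / 2\<close> enters.\<close>

lemma lower_deviation_squares:
  assumes "0 \<le> u"
  shows "prob {\<omega> \<in> space M. v - W \<omega> > sqrt (2 * (u * b\<^sup>2) * v)} \<le> exp (- u)"
proof (cases "v = 0")
  case True
  then have "{\<omega> \<in> space M. v - W \<omega> > sqrt (2 * (u * b\<^sup>2) * v)} = {}" using bounds by (auto simp: not_less)
  then show ?thesis by (simp only:) simp
next
  case False
  define d where "d = b\<^sup>2 * v"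
  have "0 < d" using False bounds b_pos by (simp add: d_def less_le)
  have mom: "(\<integral>\<^sup>+\<omega>. ennreal (exp (t * (v - W \<omega>))) \<partial>M) \<le> ennreal (exp (t\<^sup>2 * d / 2))" if "0 \<le> t" for t
  proof -
    have "exp (t * (v - W \<omega>)) = exp (t * v) * exp (\<Sum>i\<in>I. - (t * (a i)\<^sup>2) * enn2real (Z i \<omega>))" for \<omega>
      by (simp add: W_def exp_add[symmetric] sum_distrib_left right_diff_distrib mult.assoc sum_negf)
    then have "(\<integral>\<^sup>+\<omega>. ennreal (exp (t * (v - W \<omega>))) \<partial>M)
        = (\<integral>\<^sup>+\<omega>. ennreal (exp (t * v)) * ennreal (exp (\<Sum>i\<in>I. - (t * (a i)\<^sup>2) * enn2real (Z i \<omega>))) \<partial>M)"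
      by (simp only: ennreal_mult'[OF exp_ge_zero])
    also have "\<dots> = ennreal (exp (t * v)) * ennreal (exp (\<Sum>i\<in>I. m i * (exp (- (t * (a i)\<^sup>2)) - 1)))"
      by (subst nn_integral_cmult) (measurable, simp only: laplace_transform)
    also have "\<dots> = ennreal (exp (\<Sum>i\<in>I. m i * (exp (- (t * (a i)\<^sup>2)) - 1 + t * (a i)\<^sup>2)))"
      by (simp add: ennreal_mult'[symmetric] exp_add[symmetric] v_def sum_distrib_left
          sum_subtractf sum.distrib right_diff_distrib distrib_left mult_ac)
    also have "(\<Sum>i\<in>I. m i * (exp (- (t * (a i)\<^sup>2)) - 1 + t * (a i)\<^sup>2))
        \<le> (\<Sum>i\<in>I. m i * ((t\<^sup>2 * b\<^sup>2 / 2) * (a i)\<^sup>2))"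
    proof (intro sum_mono mult_left_mono)
      fix i assume "i \<in> I"
      have "exp (- (t * (a i)\<^sup>2)) - 1 + t * (a i)\<^sup>2 \<le> (t * (a i)\<^sup>2)\<^sup>2 / 2"
        using exp_minus_le_quadratic[of "t * (a i)\<^sup>2"] \<open>0 \<le> t\<close> by simp
      also have "\<dots> = t\<^sup>2 / 2 * ((a i)\<^sup>2 * (a i)\<^sup>2)" by (simp add: power2_eq_square)
      also have "\<dots> \<le> t\<^sup>2 / 2 * (b\<^sup>2 * (a i)\<^sup>2)"
        by (intro mult_left_mono mult_right_mono a_sq \<open>i \<in> I\<close>) auto
      finally show "exp (- (t * (a i)\<^sup>2)) - 1 + t * (a i)\<^sup>2 \<le> (t\<^sup>2 * b\<^sup>2 / 2) * (a i)\<^sup>2" by simp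
    qed (simp add: m_nonneg)
    also have "\<dots> = t\<^sup>2 * d / 2"
      by (simp add: v_def d_def sum_distrib_left sum_divide_distrib mult_ac)
    finally show ?thesis by (simp add: ennreal_leI)
  qed
  \<comment> \<open>The minimiser of the Chernoff exponent \<open>t\<^sup>2 * d / 2 - t * x\<close> for the deviation \<open>x = sqrt (2 * u * d)\<close>.\<close>
  define t where "t = sqrt (2 * u / d)"
  have "0 \<le> t" using assms \<open>0 < d\<close> by (simp add: t_def)
  have u: "u = t\<^sup>2 * d / 2" using assms \<open>0 < d\<close> by (simp add: t_def)
  have "sqrt (2 * (u * b\<^sup>2) * v) = sqrt ((t * d)\<^sup>2)"
    unfolding u by (simp add: d_def power2_eq_square mult_ac)
  also have "\<dots> = t * d" using \<open>0 \<le> t\<close> \<open>0 < d\<close> by simp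
  finally have sq: "sqrt (2 * (u * b\<^sup>2) * v) = t * d" .
  have "prob {\<omega> \<in> space M. v - W \<omega> > t * d} \<le> exp (t\<^sup>2 * d / 2 - t * (t * d))"
    by (rule chernoff_bound[OF _ \<open>0 \<le> t\<close> mom[OF \<open>0 \<le> t\<close>]]) measurable
  also have "t\<^sup>2 * d / 2 - t * (t * d) = - u" by (simp add: u power2_eq_square)
  finally show ?thesis unfolding sq .
qed

lemma mean_squares: "(\<integral>\<^sup>+\<omega>. ennreal (W \<omega>) \<partial>M) = ennreal v"
proof -
  have "(\<integral>\<^sup>+\<omega>. ennreal (W \<omega>) \<partial>M)
      = (\<integral>\<^sup>+\<omega>. (\<Sum>i\<in>I. ennreal ((a i)\<^sup>2) * ennreal (enn2real (Z i \<omega>))) \<partial>M)"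
    by (simp add: W_def ennreal_mult'[symmetric] sum_ennreal)
  also have "\<dots> = (\<Sum>i\<in>I. ennreal ((a i)\<^sup>2) * ennreal (m i))"
    by (subst nn_integral_sum) (auto intro!: sum.cong simp: nn_integral_cmult poisson_count_mean[OF count])
  also have "\<dots> = ennreal v"
    by (simp add: v_def ennreal_mult'[symmetric] sum_ennreal m_nonneg)
  finally show ?thesis .
qed

subsection \<open>The data-driven threshold\<close>

text \<open>This is \<open>n\<close> times \<^const>\<open>threshold\<close>, with \<open>L\<close> in place of \<open>ln n\<close>.\<close>

definition T :: "real \<Rightarrow> real \<Rightarrow> 'w \<Rightarrow> real" where
  "T \<gamma> L \<omega> = sqrt (2 * \<gamma> * L * (W \<omega> + sqrt (2 * \<gamma> * L * W \<omega> * b\<^sup>2) + 3 * \<gamma> * L * b\<^sup>2))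
     + \<gamma> * L * b / 3"

lemma T_measurable [measurable]: "T \<gamma> L \<in> borel_measurable M"
  unfolding T_def[abs_def] by measurable

lemma T_nonneg: "0 \<le> \<gamma> \<Longrightarrow> 0 \<le> L \<Longrightarrow> \<gamma> * L * b / 3 \<le> T \<gamma> L \<omega>" "0 \<le> \<gamma> \<Longrightarrow> 0 \<le> L \<Longrightarrow> 0 \<le> T \<gamma> L \<omega>"
  using bounds(1)[of \<omega>] b_pos by (auto simp: T_def)

text \<open>Bernstein's inequality at \<open>u = \<kappa>\<^sup>2 * \<gamma> * L\<close> bounds the noise through the unknown \<open>v\<close>, and the
  lower tail of \<open>W\<close> allows \<open>v\<close> to be replaced by the corrected estimate inside \<open>T\<close>. The two
  sides of the deviation and the variance estimate contribute one \<open>exp (- u)\<close> each.\<close>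

lemma noise_exceeds_threshold:
  assumes "0 \<le> \<kappa>" "\<kappa> \<le> 1" "0 \<le> \<gamma>" "0 \<le> L"
  shows "prob {\<omega> \<in> space M. \<bar>S \<omega> - s\<bar> > \<kappa> * T \<gamma> L \<omega>} \<le> 3 * exp (- (\<kappa>\<^sup>2 * \<gamma> * L))"
proof -
  define u where "u = \<kappa>\<^sup>2 * \<gamma> * L"
  have "0 \<le> u" using assms by (simp add: u_def)
  have \<kappa>2: "\<kappa>\<^sup>2 \<le> \<kappa>" using assms by (simp add: power2_eq_square mult_left_le)
  have uL: "u \<le> \<gamma> * L" "u \<le> \<kappa> * (\<gamma> * L)"
    unfolding u_def mult.assoc
    using assms \<kappa>2 by (auto intro!: mult_right_mono mult_left_le_one_le)
  have "\<kappa> * T \<gamma> L \<omega> \<ge> sqrt (2 * u * v) + u * b / 3" if *: "v - W \<omega> \<le> sqrt (2 * (u * b\<^sup>2) * v)" for \<omega>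
  proof -
    define V where "V = W \<omega> + sqrt (2 * \<gamma> * L * W \<omega> * b\<^sup>2) + 3 * \<gamma> * L * b\<^sup>2"
    have ub: "u * b\<^sup>2 \<le> \<gamma> * L * b\<^sup>2" by (intro mult_right_mono uL) simp
    have "v \<le> W \<omega> + sqrt (2 * (u * b\<^sup>2) * W \<omega>) + 3 * (u * b\<^sup>2)"
      using * bounds \<open>0 \<le> u\<close> by (intro quadratic_self_bound) auto
    also have "sqrt (2 * (u * b\<^sup>2) * W \<omega>) \<le> sqrt (2 * (\<gamma> * L * b\<^sup>2) * W \<omega>)"
      using ub bounds by (intro real_sqrt_le_mono mult_right_mono) auto
    also have "3 * (u * b\<^sup>2) \<le> 3 * (\<gamma> * L * b\<^sup>2)" using ub by simp
    finally have "v \<le> V" by (simp add: V_def mult_ac)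
    then have "sqrt (2 * u * v) \<le> sqrt (2 * u * V)"
      using \<open>0 \<le> u\<close> by (intro real_sqrt_le_mono mult_left_mono) auto
    also have "2 * u * V = \<kappa>\<^sup>2 * (2 * \<gamma> * L * V)" by (simp add: u_def)
    also have "sqrt \<dots> = \<kappa> * sqrt (2 * \<gamma> * L * V)" using assms by (simp add: real_sqrt_mult)
    finally have "sqrt (2 * u * v) \<le> \<kappa> * sqrt (2 * \<gamma> * L * V)" .
    moreover have "u * b / 3 \<le> \<kappa> * (\<gamma> * L) * b / 3"
      using uL b_pos by (intro divide_right_mono mult_right_mono) auto
    ultimately show ?thesis by (simp add: T_def V_def algebra_simps)
  qed
  then have "prob {\<omega> \<in> space M. \<bar>S \<omega> - s\<bar> > \<kappa> * T \<gamma> L \<omega>}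
      \<le> prob ({\<omega> \<in> space M. \<bar>S \<omega> - s\<bar> > sqrt (2 * u * v) + u * b / 3}
        \<union> {\<omega> \<in> space M. v - W \<omega> > sqrt (2 * (u * b\<^sup>2) * v)})"
    by (intro finite_measure_mono) (force simp: not_less)+
  also have "\<dots> \<le> prob {\<omega> \<in> space M. \<bar>S \<omega> - s\<bar> > sqrt (2 * u * v) + u * b / 3}
        + prob {\<omega> \<in> space M. v - W \<omega> > sqrt (2 * (u * b\<^sup>2) * v)}"
    by (intro measure_Un_le) measurable
  also have "\<dots> \<le> 2 * exp (- u) + exp (- u)"
    by (intro add_mono upper_deviation lower_deviation_squares \<open>0 \<le> u\<close>)
  finally show ?thesis by (simp add: u_def)
qed

text \<open>The mixed square root inside \<open>T\<close> is a geometric mean of \<open>W\<close> and the remainder, hence no larger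
  in order than their sum.\<close>

lemma T_square_le:
  assumes "0 \<le> \<gamma>" "0 \<le> L"
  shows "(T \<gamma> L \<omega>)\<^sup>2 \<le> 8 * \<gamma> * L * W \<omega> + 15 * (\<gamma> * L * b)\<^sup>2"
proof -
  define g where "g = \<gamma> * L"
  have "0 \<le> g" using assms by (simp add: g_def)
  let ?r = "sqrt (2 * g * W \<omega> * b\<^sup>2)"
  have "2 * g * W \<omega> * b\<^sup>2 \<le> (W \<omega> + g * b\<^sup>2 / 2)\<^sup>2"
    using zero_le_power2[of "W \<omega> - g * b\<^sup>2 / 2"] by (simp add: power2_eq_square algebra_simps)
  then have "?r \<le> sqrt ((W \<omega> + g * b\<^sup>2 / 2)\<^sup>2)" by (rule real_sqrt_le_mono)
  also have "\<dots> = W \<omega> + g * b\<^sup>2 / 2" using bounds(1)[of \<omega>] \<open>0 \<le> g\<close> by simp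
  finally have r: "?r \<le> W \<omega> + g * b\<^sup>2 / 2" .
  have "(T \<gamma> L \<omega>)\<^sup>2 \<le> 2 * (sqrt (2 * g * (W \<omega> + ?r + 3 * g * b\<^sup>2)))\<^sup>2 + 2 * (g * b / 3)\<^sup>2"
    unfolding T_def g_def mult.assoc by (rule square_le_two_sums)
  also have "(sqrt (2 * g * (W \<omega> + ?r + 3 * g * b\<^sup>2)))\<^sup>2 = 2 * g * (W \<omega> + ?r + 3 * g * b\<^sup>2)"
  proof (rule real_sqrt_pow2)
    show "0 \<le> 2 * g * (W \<omega> + ?r + 3 * g * b\<^sup>2)"
      by (intro mult_nonneg_nonneg add_nonneg_nonneg real_sqrt_ge_zero)
        (use bounds(1)[of \<omega>] \<open>0 \<le> g\<close> in auto)
  qed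
  also have "\<dots> \<le> 2 * g * (W \<omega> + (W \<omega> + g * b\<^sup>2 / 2) + 3 * g * b\<^sup>2)"
    using r \<open>0 \<le> g\<close> by (intro mult_left_mono) auto
  also have "2 * \<dots> + 2 * (g * b / 3)\<^sup>2 = 8 * g * W \<omega> + (14 + 2 / 9) * (g * b)\<^sup>2"
    by (simp add: power2_eq_square field_simps)
  also have "\<dots> \<le> 8 * g * W \<omega> + 15 * (g * b)\<^sup>2" by (intro add_left_mono mult_right_mono) auto
  finally show ?thesis by (simp add: g_def mult_ac)
qed

definition thresholded :: "real \<Rightarrow> real \<Rightarrow> 'w \<Rightarrow> real" where
  "thresholded \<gamma> L \<omega> = (if T \<gamma> L \<omega> \<le> \<bar>S \<omega>\<bar> then S \<omega> else 0)"

lemma thresholded_measurable [measurable]: "thresholded \<gamma> L \<in> borel_measurable M"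
  unfolding thresholded_def[abs_def] by measurable

text \<open>The strict inequality \<open>\<kappa> < 1\<close> matters: a kept coefficient has noise at most \<open>\<kappa> * T\<close> but
  absolute value at least \<open>T\<close>, so \<open>\<bar>s\<bar>\<close> is at least \<open>(1 - \<kappa>) * T\<close> and dominates the error.
  A killed coefficient costs \<open>s\<^sup>2\<close>, and then \<open>\<bar>s\<bar>\<close> is at most \<open>(1 + \<kappa>) * T\<close>.\<close>

lemma risk_without_large_noise:
  assumes "0 \<le> \<kappa>" "\<kappa> < 1" "0 \<le> \<gamma>" "0 \<le> L" and noise: "\<bar>S \<omega> - s\<bar> \<le> \<kappa> * T \<gamma> L \<omega>"
  shows "(thresholded \<gamma> L \<omega> - s)\<^sup>2 \<le> 4 / (1 - \<kappa>)\<^sup>2 * min (s\<^sup>2) ((T \<gamma> L \<omega>)\<^sup>2)"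
proof -
  let ?T = "T \<gamma> L \<omega>" let ?e = "thresholded \<gamma> L \<omega> - s"
  have T0: "0 \<le> ?T" using T_nonneg assms by auto
  have kT: "\<kappa> * ?T \<le> ?T" "(1 - \<kappa>) * ?T \<le> ?T" using T0 assms by (auto simp: mult_left_le_one_le)
  have "(1 - \<kappa>) * \<bar>?e\<bar> \<le> 2 * min \<bar>s\<bar> ?T"
  proof (cases "?T \<le> \<bar>S \<omega>\<bar>")
    case True
    then have e: "\<bar>?e\<bar> \<le> \<kappa> * ?T" using noise by (simp add: thresholded_def)
    then have "(1 - \<kappa>) * \<bar>?e\<bar> \<le> (1 - \<kappa>) * ?T" using assms kT by (intro mult_left_mono) auto
    moreover have "(1 - \<kappa>) * ?T \<le> \<bar>s\<bar>" using True noise by (simp add: algebra_simps)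
    ultimately show ?thesis using kT T0 by simp
  next
    case False
    then have "\<bar>?e\<bar> = \<bar>s\<bar>" by (simp add: thresholded_def)
    moreover have "\<bar>s\<bar> \<le> 2 * ?T" using False noise kT by linarith
    moreover have "(1 - \<kappa>) * \<bar>s\<bar> \<le> \<bar>s\<bar>" using assms by (simp add: mult_left_le_one_le)
    ultimately show ?thesis by simp
  qed
  then have "((1 - \<kappa>) * \<bar>?e\<bar>)\<^sup>2 \<le> (2 * min \<bar>s\<bar> ?T)\<^sup>2" using assms by (intro power_mono) auto
  also have "\<dots> = 4 * min (s\<^sup>2) (?T\<^sup>2)"
    using T0 by (auto simp: min_def power_mult_distrib abs_le_square_iff[of s ?T, symmetric])
  finally have "(1 - \<kappa>)\<^sup>2 * ?e\<^sup>2 \<le> 4 * min (s\<^sup>2) (?T\<^sup>2)" by (simp add: power_mult_distrib)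
  then show ?thesis using assms by (simp add: field_simps)
qed

text \<open>The mean squared threshold is at most of order \<open>L * b\<^sup>2 * (\<mu> + L)\<close>. Its part \<open>(L * b)\<^sup>2\<close> carries no factor
  \<open>\<mu>\<close> and could not be summed over all positions. It is harmless if \<open>L \<le> \<mu>\<close>; otherwise
  \<open>s\<^sup>2 \<le> (b * \<mu>)\<^sup>2\<close> is already below \<open>b\<^sup>2 * \<mu> * L\<close>.\<close>

lemma mean_min_signal_threshold:
  assumes "1 \<le> \<gamma>" "0 \<le> L"
  shows "(\<integral>\<^sup>+\<omega>. ennreal (min (s\<^sup>2) ((T \<gamma> L \<omega>)\<^sup>2)) \<partial>M)
    \<le> ennreal (23 * \<gamma>\<^sup>2 * min (s\<^sup>2) (b\<^sup>2 * \<mu> * L))"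
proof -
  have \<gamma>1: "1 \<le> \<gamma>\<^sup>2" "\<gamma> \<le> \<gamma>\<^sup>2" using assms by (auto simp: power2_eq_square mult_le_cancel_left1 mult_ge1_I)
  have one: "(\<integral>\<^sup>+\<omega>. ennreal (min (s\<^sup>2) ((T \<gamma> L \<omega>)\<^sup>2)) \<partial>M) \<le> (\<integral>\<^sup>+\<omega>. ennreal (s\<^sup>2) \<partial>M)"
    by (intro nn_integral_mono) (simp add: ennreal_leI)
  have s_bound: "s\<^sup>2 \<le> b\<^sup>2 * \<mu> * L" if "\<mu> < L"
  proof -
    have "s\<^sup>2 \<le> (b * \<mu>)\<^sup>2" using bounds(7) power_mono[of "\<bar>s\<bar>" "b * \<mu>" 2] by simp
    also have "\<dots> = b\<^sup>2 * \<mu> * \<mu>" by (simp add: power2_eq_square)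
    also have "\<dots> \<le> b\<^sup>2 * \<mu> * L" using that bounds by (intro mult_left_mono) auto
    finally show ?thesis .
  qed
  have "(\<integral>\<^sup>+\<omega>. ennreal (min (s\<^sup>2) ((T \<gamma> L \<omega>)\<^sup>2)) \<partial>M) \<le> ennreal (23 * \<gamma>\<^sup>2 * (b\<^sup>2 * \<mu> * L))" if "L \<le> \<mu>"
  proof -
    have "(\<integral>\<^sup>+\<omega>. ennreal (min (s\<^sup>2) ((T \<gamma> L \<omega>)\<^sup>2)) \<partial>M)
        \<le> (\<integral>\<^sup>+\<omega>. ennreal (8 * \<gamma> * L) * ennreal (W \<omega>) + ennreal (15 * (\<gamma> * L * b)\<^sup>2) \<partial>M)"
      using T_square_le[of \<gamma> L] assms bounds
      by (intro nn_integral_mono)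
        (auto simp: ennreal_mult[symmetric] ennreal_plus[symmetric] min_def
          simp del: ennreal_plus intro!: ennreal_leI intro: order.trans)
    also have "\<dots> = ennreal (8 * \<gamma> * L) * ennreal v + ennreal (15 * (\<gamma> * L * b)\<^sup>2)"
      by (simp add: nn_integral_add nn_integral_cmult mean_squares emeasure_space_1)
    also have "\<dots> = ennreal (8 * \<gamma> * L * v + 15 * (\<gamma> * L * b)\<^sup>2)"
      using assms bounds by (simp add: ennreal_mult'[symmetric])
    also have "8 * \<gamma> * L * v + 15 * (\<gamma> * L * b)\<^sup>2 \<le> 8 * \<gamma>\<^sup>2 * L * (b\<^sup>2 * \<mu>) + 15 * (\<gamma>\<^sup>2 * b\<^sup>2 * L * \<mu>)"
    proof (intro add_mono mult_mono mult_left_mono)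
      have "(\<gamma> * L * b)\<^sup>2 = \<gamma>\<^sup>2 * b\<^sup>2 * L * L" by (simp add: power2_eq_square)
      also have "\<dots> \<le> \<gamma>\<^sup>2 * b\<^sup>2 * L * \<mu>" using that assms by (intro mult_left_mono) auto
      finally show "(\<gamma> * L * b)\<^sup>2 \<le> \<gamma>\<^sup>2 * b\<^sup>2 * L * \<mu>" .
    qed (use assms bounds \<gamma>1 in auto)
    also have "\<dots> = 23 * \<gamma>\<^sup>2 * (b\<^sup>2 * \<mu> * L)" by simp
    finally show ?thesis by (simp add: ennreal_leI)
  qed
  moreover have "s\<^sup>2 \<le> 23 * \<gamma>\<^sup>2 * s\<^sup>2" "s\<^sup>2 \<le> 23 * \<gamma>\<^sup>2 * (b\<^sup>2 * \<mu> * L)" if "\<mu> < L"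
  proof -
    show 1: "s\<^sup>2 \<le> 23 * \<gamma>\<^sup>2 * s\<^sup>2" using \<gamma>1 by (simp add: mult_le_cancel_right1)
    have "23 * \<gamma>\<^sup>2 * s\<^sup>2 \<le> 23 * \<gamma>\<^sup>2 * (b\<^sup>2 * \<mu> * L)"
      using s_bound[OF that] by (intro mult_left_mono) auto
    with 1 show "s\<^sup>2 \<le> 23 * \<gamma>\<^sup>2 * (b\<^sup>2 * \<mu> * L)" by linarith
  qed
  moreover have "s\<^sup>2 \<le> 23 * \<gamma>\<^sup>2 * s\<^sup>2" using \<gamma>1 by (simp add: mult_le_cancel_right1)
  ultimately show ?thesis
    using one by (cases "\<mu> < L") (auto simp: min_def emeasure_space_1 ennreal_leI intro: order.trans)
qed

subsection \<open>Noise beyond the threshold\<close>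

text \<open>Subtracting one leaves a quantity that is proportional to the mean count, because
  \<open>exp x - 1 \<le> x * exp x\<close>.\<close>

lemma mean_exp_count_excess:
  assumes "\<mu> \<le> 1"
  shows "(\<integral>\<^sup>+\<omega>. ennreal (exp (4 * K \<omega>) - 1) \<partial>M) \<le> ennreal (\<mu> * (exp 4 * exp (exp 4)))"
proof -
  let ?A = "exp 4 - 1 :: real"
  have "(\<integral>\<^sup>+\<omega>. ennreal (exp (4 * K \<omega>) - 1) \<partial>M) + 1 = (\<integral>\<^sup>+\<omega>. ennreal (exp (4 * K \<omega>) - 1) + 1 \<partial>M)"
    by (simp add: nn_integral_add emeasure_space_1)
  also have "\<dots> = (\<integral>\<^sup>+\<omega>. ennreal (exp (\<Sum>i\<in>I. 4 * enn2real (Z i \<omega>))) \<partial>M)"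
    using bounds(2)
    by (intro nn_integral_cong)
      (simp add: K_def sum_distrib_left[symmetric] ennreal_plus[symmetric] ennreal_1[symmetric]
        del: ennreal_plus ennreal_1)
  also have "\<dots> = ennreal (exp (\<mu> * ?A))"
    by (simp add: laplace_transform \<mu>_def sum_distrib_right)
  finally have "(\<integral>\<^sup>+\<omega>. ennreal (exp (4 * K \<omega>) - 1) \<partial>M) = ennreal (exp (\<mu> * ?A)) - 1"
    by (metis ennreal_add_diff_cancel_right ennreal_one_neq_top)
  also have "\<dots> = ennreal (exp (\<mu> * ?A) - 1)"
    by (simp add: ennreal_minus[symmetric] ennreal_1[symmetric] del: ennreal_1)
  also have "exp (\<mu> * ?A) - 1 \<le> \<mu> * (exp 4 * exp (exp 4))"
  proof -
    have "\<mu> * ?A \<le> 1 * ?A" by (intro mult_right_mono assms) simp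
    also have "\<dots> \<le> exp 4" by simp
    finally have A: "\<mu> * ?A \<le> exp 4" .
    have A': "0 \<le> \<mu> * ?A" "\<mu> * ?A \<le> \<mu> * exp 4"
      using bounds(5) by (auto intro!: mult_left_mono)
    have "1 - \<mu> * ?A \<le> exp (- (\<mu> * ?A))" using exp_ge_add_one_self[of "- (\<mu> * ?A)"] by simp
    then have "(1 - \<mu> * ?A) * exp (\<mu> * ?A) \<le> exp (- (\<mu> * ?A)) * exp (\<mu> * ?A)"
      by (rule mult_right_mono) simp
    also have "\<dots> = 1" by (simp only: exp_add[symmetric]) simp
    finally have "exp (\<mu> * ?A) - 1 \<le> \<mu> * ?A * exp (\<mu> * ?A)"
      unfolding left_diff_distrib by simp
    also have "\<dots> \<le> (\<mu> * exp 4) * exp (exp 4)"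
      using A A' bounds(5) by (intro mult_mono) auto
    finally show ?thesis by simp
  qed
  finally show ?thesis by (simp add: ennreal_leI)
qed

text \<open>If few points are expected, the tail bounds do not see how small \<open>\<mu>\<close> is. A kept coefficient,
  however, needs at least \<open>\<gamma> * L / 3\<close> points in the support, because every point moves \<open>S\<close> by at
  most \<open>b\<close> while the threshold is at least \<open>\<gamma> * L * b / 3\<close>. The factor \<open>exp (3 * K - \<gamma> * L) \<ge> 1\<close>
  records this at the cost of an exponential moment proportional to \<open>\<mu>\<close>.\<close>

lemma kept_noise_small_intensity:
  assumes "\<mu> \<le> 1" "1 \<le> \<gamma>" "0 \<le> L"
  shows "(\<integral>\<^sup>+\<omega>. ennreal (if T \<gamma> L \<omega> \<le> \<bar>S \<omega>\<bar> then (S \<omega>)\<^sup>2 else 0) \<partial>M)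
    \<le> ennreal (2 * exp 4 * exp (exp 4) * (b\<^sup>2 * \<mu>) * exp (- (\<gamma> * L)))"
proof -
  have pt: "(S \<omega>)\<^sup>2 \<le> (2 * b\<^sup>2 * exp (- (\<gamma> * L))) * (exp (4 * K \<omega>) - 1)" if "T \<gamma> L \<omega> \<le> \<bar>S \<omega>\<bar>" for \<omega>
  proof -
    have K0: "0 \<le> K \<omega>" using bounds by simp
    have "b * (\<gamma> * L / 3) \<le> b * K \<omega>"
      using that bounds(3)[of \<omega>] T_nonneg(1)[of \<gamma> L \<omega>] assms by (simp add: mult_ac)
    then have K: "\<gamma> * L \<le> 3 * K \<omega>" using b_pos by simp
    have "\<bar>S \<omega>\<bar>\<^sup>2 \<le> (b * K \<omega>)\<^sup>2" using bounds by (intro power_mono) auto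
    also have "\<dots> = b\<^sup>2 * (K \<omega>)\<^sup>2" by (simp add: power_mult_distrib)
    finally have S2: "(S \<omega>)\<^sup>2 \<le> b\<^sup>2 * (K \<omega>)\<^sup>2" by simp
    have "1 \<le> exp (- (\<gamma> * L)) * exp (3 * K \<omega>)" using K by (simp add: exp_add[symmetric])
    then have "(K \<omega>)\<^sup>2 \<le> (K \<omega>)\<^sup>2 * (exp (- (\<gamma> * L)) * exp (3 * K \<omega>))"
      using mult_left_mono[of 1 "exp (- (\<gamma> * L)) * exp (3 * K \<omega>)" "(K \<omega>)\<^sup>2"] by simp
    also have "\<dots> \<le> (2 * exp (K \<omega>) - 2) * (exp (- (\<gamma> * L)) * exp (3 * K \<omega>))"
      using square_le_exp[OF K0] K0 by (intro mult_right_mono) auto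
    also have "\<dots> = 2 * exp (- (\<gamma> * L)) * (exp (4 * K \<omega>) - exp (3 * K \<omega>))"
      by (simp add: algebra_simps exp_add[symmetric])
    also have "\<dots> \<le> 2 * exp (- (\<gamma> * L)) * (exp (4 * K \<omega>) - 1)"
      using K0 by (intro mult_left_mono) auto
    finally have "b\<^sup>2 * (K \<omega>)\<^sup>2 \<le> b\<^sup>2 * (2 * exp (- (\<gamma> * L)) * (exp (4 * K \<omega>) - 1))"
      by (intro mult_left_mono) auto
    with S2 show ?thesis by (simp add: mult_ac)
  qed
  have "(\<integral>\<^sup>+\<omega>. ennreal (if T \<gamma> L \<omega> \<le> \<bar>S \<omega>\<bar> then (S \<omega>)\<^sup>2 else 0) \<partial>M)
      \<le> (\<integral>\<^sup>+\<omega>. ennreal (2 * b\<^sup>2 * exp (- (\<gamma> * L))) * ennreal (exp (4 * K \<omega>) - 1) \<partial>M)"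
    using pt bounds(2) by (intro nn_integral_mono) (auto simp: ennreal_mult[symmetric] intro!: ennreal_leI)
  also have "\<dots> = ennreal (2 * b\<^sup>2 * exp (- (\<gamma> * L))) * (\<integral>\<^sup>+\<omega>. ennreal (exp (4 * K \<omega>) - 1) \<partial>M)"
    by (intro nn_integral_cmult) measurable
  also have "\<dots> \<le> ennreal (2 * b\<^sup>2 * exp (- (\<gamma> * L))) * ennreal (\<mu> * (exp 4 * exp (exp 4)))"
    by (intro mult_left_mono mean_exp_count_excess assms) simp
  also have "\<dots> = ennreal (2 * exp 4 * exp (exp 4) * (b\<^sup>2 * \<mu>) * exp (- (\<gamma> * L)))"
    by (simp add: ennreal_mult'[symmetric] mult_ac)
  finally show ?thesis .
qed

text \<open>Truncate the noise at \<open>c * L\<close> standard units \<open>b * sqrt \<mu>\<close>. Below the truncation only the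
  probability of \<open>B\<close> counts; above it a bounded exponential moment gives \<open>exp (- c * L)\<close>. The
  moment is bounded because \<open>\<mu> \<ge> 1\<close> makes a single point at most one unit.\<close>

lemma large_noise_large_intensity:
  assumes "1 \<le> \<mu>" "0 \<le> c" "0 \<le> L" and [measurable]: "B \<in> sets M"
  shows "(\<integral>\<^sup>+\<omega>. ennreal ((S \<omega> - s)\<^sup>2 * indicator B \<omega>) \<partial>M)
    \<le> ennreal (b\<^sup>2 * \<mu> * ((c * L)\<^sup>2 * prob B + 4 * exp 6 * exp (- (c * L))))"
proof -
  define \<sigma> where "\<sigma> = 1 / (b * sqrt \<mu>)"
  have "0 < \<sigma>" using assms b_pos by (simp add: \<sigma>_def)
  have \<sigma>2: "\<sigma>\<^sup>2 = 1 / (b\<^sup>2 * \<mu>)" using assms by (simp add: \<sigma>_def power_divide power_mult_distrib)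
  have \<sigma>b: "\<sigma> * b \<le> 1" using assms b_pos by (simp add: \<sigma>_def real_sqrt_ge_one)
  have \<sigma>v: "\<sigma>\<^sup>2 * v \<le> 1" using bounds assms b_pos by (simp add: \<sigma>2)
  define x where "x = c * L"
  have "0 \<le> x" using assms by (simp add: x_def)
  let ?Y = "\<lambda>\<omega>. S \<omega> - s"
  have pt: "\<sigma>\<^sup>2 * ((?Y \<omega>)\<^sup>2 * indicator B \<omega>)
      \<le> x\<^sup>2 * indicator B \<omega> + 2 * exp (- x) * (exp (2 * \<sigma> * ?Y \<omega>) + exp (- (2 * \<sigma>) * ?Y \<omega>))" for \<omega>
  proof -
    define z where "z = \<sigma> * \<bar>?Y \<omega>\<bar>"
    have z0: "0 \<le> z" using \<open>0 < \<sigma>\<close> by (simp add: z_def)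
    have z2: "z\<^sup>2 = \<sigma>\<^sup>2 * (?Y \<omega>)\<^sup>2" by (simp add: z_def power_mult_distrib)
    have "exp (2 * z) \<le> exp (2 * \<sigma> * ?Y \<omega>) + exp (- (2 * \<sigma>) * ?Y \<omega>)"
    proof (cases "0 \<le> ?Y \<omega>")
      case True
      then have "2 * z = 2 * \<sigma> * ?Y \<omega>" by (simp add: z_def)
      then show ?thesis by (simp only:) simp
    next
      case False
      then have "2 * z = - (2 * \<sigma>) * ?Y \<omega>" by (simp add: z_def algebra_simps)
      then show ?thesis by (simp only:) simp
    qed
    then have e: "2 * exp (- x) * exp (2 * z)
        \<le> 2 * exp (- x) * (exp (2 * \<sigma> * ?Y \<omega>) + exp (- (2 * \<sigma>) * ?Y \<omega>))"
      by (intro mult_left_mono) auto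
    have z2B: "\<sigma>\<^sup>2 * ((?Y \<omega>)\<^sup>2 * indicator B \<omega>) = z\<^sup>2 * indicator B \<omega>" by (simp add: z2)
    show ?thesis
    proof (cases "z \<le> x")
      case True
      then have "z\<^sup>2 * indicator B \<omega> \<le> x\<^sup>2 * indicator B \<omega>"
        using z0 by (intro mult_right_mono power_mono) auto
      moreover have "0 \<le> 2 * exp (- x) * exp (2 * z)" by simp
      ultimately show ?thesis using e unfolding z2B by linarith
    next
      case False
      have "z\<^sup>2 * indicator B \<omega> \<le> z\<^sup>2" by (simp add: indicator_def)
      also have "\<dots> \<le> 2 * exp z" using square_le_exp[OF z0] z0 by linarith
      also have "\<dots> \<le> 2 * exp (- x) * exp (2 * z)"
        using False by (simp add: mult.assoc exp_add[symmetric])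
      finally have "z\<^sup>2 * indicator B \<omega> \<le> 2 * exp (- x) * exp (2 * z)" .
      moreover have "0 \<le> x\<^sup>2 * indicator B \<omega>" by simp
      ultimately show ?thesis using e unfolding z2B by linarith
    qed
  qed
  have mom: "(\<integral>\<^sup>+\<omega>. ennreal (exp (t * ?Y \<omega>)) \<partial>M) \<le> ennreal (exp 6)" if t: "\<bar>t\<bar> = 2 * \<sigma>" for t
  proof -
    have tb: "\<bar>t\<bar> * b \<le> 2" using \<sigma>b t by simp
    have t2: "t\<^sup>2 = 4 * \<sigma>\<^sup>2" using t by (metis power2_abs power_mult_distrib four_x_squared)
    have "t\<^sup>2 * v / (2 * (1 - \<bar>t\<bar> * b / 3)) \<le> 4 / (2 / 3)"
      using tb t2 \<sigma>v by (intro frac_le) (auto simp: mult.commute[of b])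
    with centred_exponential_moment[of t] tb show ?thesis
      by (auto intro: order.trans simp: ennreal_leI)
  qed
  have "ennreal (\<sigma>\<^sup>2) * (\<integral>\<^sup>+\<omega>. ennreal ((?Y \<omega>)\<^sup>2 * indicator B \<omega>) \<partial>M)
      = (\<integral>\<^sup>+\<omega>. ennreal (\<sigma>\<^sup>2 * ((?Y \<omega>)\<^sup>2 * indicator B \<omega>)) \<partial>M)"
    by (simp add: nn_integral_cmult ennreal_mult)
  also have "\<dots> \<le> (\<integral>\<^sup>+\<omega>. ennreal (x\<^sup>2) * indicator B \<omega> + ennreal (2 * exp (- x)) *
      (ennreal (exp (2 * \<sigma> * ?Y \<omega>)) + ennreal (exp (- (2 * \<sigma>) * ?Y \<omega>))) \<partial>M)"
  proof (intro nn_integral_mono)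
    fix \<omega>
    have "ennreal (x\<^sup>2) * indicator B \<omega> = ennreal (x\<^sup>2 * indicator B \<omega>)" by (simp add: indicator_def)
    then show "ennreal (\<sigma>\<^sup>2 * ((?Y \<omega>)\<^sup>2 * indicator B \<omega>)) \<le> ennreal (x\<^sup>2) * indicator B \<omega> + ennreal (2 * exp (- x)) *
      (ennreal (exp (2 * \<sigma> * ?Y \<omega>)) + ennreal (exp (- (2 * \<sigma>) * ?Y \<omega>)))"
      using pt[of \<omega>] by (simp add: ennreal_mult[symmetric] ennreal_plus[symmetric] ennreal_leI del: ennreal_plus)
  qed
  also have "\<dots> = ennreal (x\<^sup>2) * emeasure M B + ennreal (2 * exp (- x)) *
      ((\<integral>\<^sup>+\<omega>. ennreal (exp (2 * \<sigma> * ?Y \<omega>)) \<partial>M) + (\<integral>\<^sup>+\<omega>. ennreal (exp (- (2 * \<sigma>) * ?Y \<omega>)) \<partial>M))"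
    by (simp add: nn_integral_add nn_integral_cmult nn_integral_cmult_indicator)
  also have "\<dots> \<le> ennreal (x\<^sup>2) * ennreal (prob B) + ennreal (2 * exp (- x)) * (ennreal (exp 6) + ennreal (exp 6))"
    using \<open>0 < \<sigma>\<close> by (intro add_mono mult_left_mono mom) (auto simp: emeasure_eq_measure)
  also have "\<dots> = ennreal (x\<^sup>2 * prob B + 4 * exp 6 * exp (- x))"
    by (simp add: ennreal_mult[symmetric] ennreal_plus[symmetric] del: ennreal_plus)
  finally have "ennreal (b\<^sup>2 * \<mu>) * (ennreal (\<sigma>\<^sup>2) * (\<integral>\<^sup>+\<omega>. ennreal ((?Y \<omega>)\<^sup>2 * indicator B \<omega>) \<partial>M))
      \<le> ennreal (b\<^sup>2 * \<mu>) * ennreal (x\<^sup>2 * prob B + 4 * exp 6 * exp (- x))"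
    by (rule mult_left_mono) simp
  moreover have "ennreal (b\<^sup>2 * \<mu>) * ennreal (\<sigma>\<^sup>2) = 1"
    using assms b_pos by (simp add: \<sigma>2 ennreal_mult[symmetric])
  ultimately have "(\<integral>\<^sup>+\<omega>. ennreal ((?Y \<omega>)\<^sup>2 * indicator B \<omega>) \<partial>M)
      \<le> ennreal (b\<^sup>2 * \<mu>) * ennreal (x\<^sup>2 * prob B + 4 * exp 6 * exp (- x))"
    by (simp only: mult.assoc[symmetric] mult_1_left)
  moreover have "0 \<le> b\<^sup>2 * \<mu>" using bounds(5) by simp
  ultimately show ?thesis by (simp only: ennreal_mult' x_def)
qed

subsection \<open>Risk of one thresholded coefficient\<close>

text \<open>The oracle inequality for one coefficient. Unless the noise exceeds \<open>\<kappa> * T\<close>, keeping or killing is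
  nearly optimal. On the exceptional event \<open>B\<close>, a killed coefficient costs \<open>s\<^sup>2\<close> and a kept one its
  noise, which is treated separately for large and small \<open>\<mu>\<close>: in both cases the part of the bound
  that \<open>s\<^sup>2\<close> does not cover is proportional to \<open>\<mu>\<close>.\<close>

theorem thresholded_risk:
  assumes "1 \<le> c" "c < \<gamma>" "0 \<le> L"
  shows "(\<integral>\<^sup>+\<omega>. ennreal ((thresholded \<gamma> L \<omega> - s)\<^sup>2) \<partial>M)
    \<le> ennreal (risk_constant \<gamma> c * (min (s\<^sup>2) (b\<^sup>2 * \<mu> * L) + (s\<^sup>2 + b\<^sup>2 * \<mu>) * exp (- (c * L))))"
proof -
  define \<kappa> where "\<kappa> = sqrt ((\<gamma> + c) / (2 * \<gamma>))"
  have \<kappa>: "0 \<le> \<kappa>" "\<kappa> < 1" using assms by (auto simp: \<kappa>_def)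
  have \<kappa>2: "\<kappa>\<^sup>2 * \<gamma> = c + (\<gamma> - c) / 2" using assms by (simp add: \<kappa>_def field_simps)
  define C0 where "C0 = 4 / (1 - \<kappa>)\<^sup>2"
  have C0: "0 \<le> C0" by (simp add: C0_def)
  define B where "B = {\<omega> \<in> space M. \<bar>S \<omega> - s\<bar> > \<kappa> * T \<gamma> L \<omega>}"
  have [measurable]: "B \<in> sets M" unfolding B_def by measurable
  let ?e = "exp (- (c * L))"
  let ?err = "\<lambda>\<omega>. (thresholded \<gamma> L \<omega> - s)\<^sup>2"
  let ?kept = "\<lambda>\<omega>. (if T \<gamma> L \<omega> \<le> \<bar>S \<omega>\<bar> then (S \<omega> - s)\<^sup>2 else 0) * indicator B \<omega>"
  let ?Q = "b\<^sup>2 * \<mu>"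
  have Q0: "0 \<le> ?Q" using bounds by simp
  have "prob B \<le> 3 * exp (- (\<kappa>\<^sup>2 * \<gamma> * L))"
    unfolding B_def using \<kappa> assms by (intro noise_exceeds_threshold) auto
  also have "\<kappa>\<^sup>2 * \<gamma> * L = (\<gamma> - c) / 2 * L + c * L" unfolding \<kappa>2 by (simp add: field_simps)
  finally have PB: "prob B \<le> 3 * exp (- ((\<gamma> - c) / 2 * L)) * ?e" by (simp add: mult.assoc exp_add[symmetric])
  also have "\<dots> \<le> 3 * 1 * ?e"
    using assms by (intro mult_mono mult_left_mono) (auto simp: mult_nonneg_nonneg)
  finally have PB1: "prob B \<le> 3 * ?e" by simp
  have kept: "(\<integral>\<^sup>+\<omega>. ennreal (?kept \<omega>) \<partial>M)
      \<le> ennreal ((24 * c\<^sup>2 / (\<gamma> - c)\<^sup>2 + 4 * exp 4 * exp (exp 4) + 4 * exp 6) * ?Q * ?e + 2 * s\<^sup>2 * (3 * ?e))"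
  proof (cases "1 \<le> \<mu>")
    case True
    have "(c * L)\<^sup>2 * prob B \<le> (c * L)\<^sup>2 * (3 * exp (- ((\<gamma> - c) / 2 * L)) * ?e)"
      by (intro mult_left_mono PB) auto
    also have "\<dots> = 3 * c\<^sup>2 * (L\<^sup>2 * exp (- ((\<gamma> - c) / 2 * L))) * ?e"
      by (simp add: power_mult_distrib)
    also have "\<dots> \<le> 3 * c\<^sup>2 * (2 / ((\<gamma> - c) / 2)\<^sup>2) * ?e"
      using assms by (intro mult_right_mono mult_left_mono square_times_exp_minus_le) auto
    also have "\<dots> = 24 * c\<^sup>2 / (\<gamma> - c)\<^sup>2 * ?e" by (simp add: power_divide)
    finally have cLB: "(c * L)\<^sup>2 * prob B \<le> 24 * c\<^sup>2 / (\<gamma> - c)\<^sup>2 * ?e" .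
    have "(\<integral>\<^sup>+\<omega>. ennreal (?kept \<omega>) \<partial>M) \<le> (\<integral>\<^sup>+\<omega>. ennreal ((S \<omega> - s)\<^sup>2 * indicator B \<omega>) \<partial>M)"
      by (intro nn_integral_mono ennreal_leI mult_right_mono) auto
    also have "\<dots> \<le> ennreal (?Q * ((c * L)\<^sup>2 * prob B + 4 * exp 6 * ?e))"
      using True assms by (intro large_noise_large_intensity) auto
    also have "\<dots> \<le> ennreal (?Q * (24 * c\<^sup>2 / (\<gamma> - c)\<^sup>2 * ?e + 4 * exp 6 * ?e))"
      by (intro ennreal_leI mult_left_mono add_mono cLB Q0) auto
    also have "\<dots> \<le> ennreal ((24 * c\<^sup>2 / (\<gamma> - c)\<^sup>2 + 4 * exp 4 * exp (exp 4) + 4 * exp 6) * ?Q * ?e + 2 * s\<^sup>2 * (3 * ?e))"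
    proof (intro ennreal_leI)
      have "0 \<le> 4 * exp 4 * exp (exp 4) * ?Q * ?e" using Q0 by (simp add: mult_nonneg_nonneg)
      moreover have "0 \<le> 2 * s\<^sup>2 * (3 * ?e)" by simp
      ultimately show "?Q * (24 * c\<^sup>2 / (\<gamma> - c)\<^sup>2 * ?e + 4 * exp 6 * ?e)
          \<le> (24 * c\<^sup>2 / (\<gamma> - c)\<^sup>2 + 4 * exp 4 * exp (exp 4) + 4 * exp 6) * ?Q * ?e + 2 * s\<^sup>2 * (3 * ?e)"
        by (simp only: distrib_left distrib_right mult_ac)
    qed
    finally show ?thesis .
  next
    case False
    have "(\<integral>\<^sup>+\<omega>. ennreal (?kept \<omega>) \<partial>M)
        \<le> (\<integral>\<^sup>+\<omega>. 2 * ennreal (if T \<gamma> L \<omega> \<le> \<bar>S \<omega>\<bar> then (S \<omega>)\<^sup>2 else 0)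
              + ennreal (2 * s\<^sup>2) * indicator B \<omega> \<partial>M)"
      using square_le_two_sums(2)[of "S _" s]
      by (intro nn_integral_mono)
        (auto simp: indicator_def ennreal_numeral[symmetric] ennreal_mult[symmetric]
          ennreal_plus[symmetric] simp del: ennreal_numeral ennreal_plus intro!: ennreal_leI)
    also have "\<dots> = 2 * (\<integral>\<^sup>+\<omega>. ennreal (if T \<gamma> L \<omega> \<le> \<bar>S \<omega>\<bar> then (S \<omega>)\<^sup>2 else 0) \<partial>M)
        + ennreal (2 * s\<^sup>2) * ennreal (prob B)"
      by (simp add: nn_integral_add nn_integral_cmult nn_integral_cmult_indicator emeasure_eq_measure)
    also have "\<dots> \<le> 2 * ennreal (2 * exp 4 * exp (exp 4) * ?Q * exp (- (\<gamma> * L))) + ennreal (2 * s\<^sup>2) * ennreal (3 * ?e)"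
      using False assms PB1
      by (intro add_mono mult_left_mono kept_noise_small_intensity ennreal_leI) auto
    also have "\<dots> = ennreal (4 * exp 4 * exp (exp 4) * ?Q * exp (- (\<gamma> * L)) + 2 * s\<^sup>2 * (3 * ?e))"
      using bounds(5) by (simp add: ennreal_numeral[symmetric] ennreal_mult'[symmetric]
          ennreal_plus[symmetric] mult_ac del: ennreal_numeral ennreal_plus)
    also have "\<dots> \<le> ennreal ((24 * c\<^sup>2 / (\<gamma> - c)\<^sup>2 + 4 * exp 4 * exp (exp 4) + 4 * exp 6) * ?Q * ?e + 2 * s\<^sup>2 * (3 * ?e))"
    proof (intro ennreal_leI add_mono mult_mono)
      show "exp (- (\<gamma> * L)) \<le> ?e" using assms by (simp add: mult_right_mono)
    qed (use bounds(5) in auto)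
    finally show ?thesis .
  qed
  have pt: "?err \<omega> \<le> C0 * min (s\<^sup>2) ((T \<gamma> L \<omega>)\<^sup>2) + s\<^sup>2 * indicator B \<omega> + ?kept \<omega>"
    if "\<omega> \<in> space M" for \<omega>
  proof (cases "\<omega> \<in> B")
    case True
    have "0 \<le> C0 * min (s\<^sup>2) ((T \<gamma> L \<omega>)\<^sup>2)" using C0 by simp
    then show ?thesis using True by (simp add: thresholded_def)
  next
    case False
    then show ?thesis
      using that risk_without_large_noise[of \<kappa> \<gamma> L \<omega>] \<kappa> assms by (simp add: B_def C0_def not_less)
  qed
  have "(\<integral>\<^sup>+\<omega>. ennreal (?err \<omega>) \<partial>M) \<le>
      (\<integral>\<^sup>+\<omega>. ennreal C0 * ennreal (min (s\<^sup>2) ((T \<gamma> L \<omega>)\<^sup>2)) + ennreal (s\<^sup>2) * indicator B \<omega> + ennreal (?kept \<omega>) \<partial>M)"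
  proof (intro nn_integral_mono)
    fix \<omega> assume w: "\<omega> \<in> space M"
    have "ennreal (s\<^sup>2) * indicator B \<omega> = ennreal (s\<^sup>2 * indicator B \<omega>)" by (simp add: indicator_def)
    moreover have "0 \<le> ?kept \<omega>" by simp
    ultimately show "ennreal (?err \<omega>) \<le> ennreal C0 * ennreal (min (s\<^sup>2) ((T \<gamma> L \<omega>)\<^sup>2)) + ennreal (s\<^sup>2) * indicator B \<omega> + ennreal (?kept \<omega>)"
      using ennreal_leI[OF pt[OF w]] C0
      by (simp add: ennreal_mult[symmetric] ennreal_plus[symmetric] del: ennreal_plus)
  qed
  also have "\<dots> = ennreal C0 * (\<integral>\<^sup>+\<omega>. ennreal (min (s\<^sup>2) ((T \<gamma> L \<omega>)\<^sup>2)) \<partial>M)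
      + ennreal (s\<^sup>2) * ennreal (prob B) + (\<integral>\<^sup>+\<omega>. ennreal (?kept \<omega>) \<partial>M)"
    by (simp add: nn_integral_add nn_integral_cmult nn_integral_cmult_indicator emeasure_eq_measure)
  also have "\<dots> \<le> ennreal C0 * ennreal (23 * \<gamma>\<^sup>2 * min (s\<^sup>2) (?Q * L)) + ennreal (s\<^sup>2) * ennreal (3 * ?e)
      + ennreal ((24 * c\<^sup>2 / (\<gamma> - c)\<^sup>2 + 4 * exp 4 * exp (exp 4) + 4 * exp 6) * ?Q * ?e + 2 * s\<^sup>2 * (3 * ?e))"
    using assms PB1 by (intro add_mono mult_left_mono mean_min_signal_threshold kept ennreal_leI) auto
  also have "\<dots> \<le> ennreal (risk_constant \<gamma> c * (min (s\<^sup>2) (?Q * L) + (s\<^sup>2 + ?Q) * ?e))"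
  proof -
    let ?m = "min (s\<^sup>2) (?Q * L)"
    define A where "A = C0 * (23 * \<gamma>\<^sup>2)"
    define D where "D = 24 * c\<^sup>2 / (\<gamma> - c)\<^sup>2 + 4 * exp 4 * exp (exp 4) + 4 * exp 6"
    define X Y where "X = s\<^sup>2 * ?e" and "Y = ?Q * ?e"
    have nonneg: "0 \<le> A" "0 \<le> D" "0 \<le> X" "0 \<le> Y" "0 \<le> ?m"
      using C0 Q0 \<open>0 \<le> L\<close> by (simp_all add: A_def D_def X_def Y_def)
    have "risk_constant \<gamma> c = A + D + 9"
      by (simp add: risk_constant_def A_def D_def C0_def \<kappa>_def)
    then have "risk_constant \<gamma> c * (?m + (s\<^sup>2 + ?Q) * ?e) = (A + D + 9) * (?m + (X + Y))"
      by (simp add: X_def Y_def algebra_simps)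
    also have "\<dots> \<ge> A * ?m + 9 * X + D * Y"
    proof -
      have "0 \<le> A * X" "0 \<le> A * Y" "0 \<le> D * ?m" "0 \<le> D * X"
        using nonneg by (simp_all only: mult_nonneg_nonneg)
      then show ?thesis using nonneg by (simp only: distrib_left distrib_right)
    qed
    finally have "A * ?m + 9 * X + D * Y \<le> risk_constant \<gamma> c * (?m + (s\<^sup>2 + ?Q) * ?e)" .
    moreover have "ennreal C0 * ennreal (23 * \<gamma>\<^sup>2 * ?m) + ennreal (s\<^sup>2) * ennreal (3 * ?e)
        + ennreal (D * ?Q * ?e + 2 * s\<^sup>2 * (3 * ?e)) = ennreal (A * ?m + 9 * X + D * Y)"
    proof -
      have "ennreal C0 * ennreal (23 * \<gamma>\<^sup>2 * ?m) = ennreal (A * ?m)"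
        using C0 by (simp add: ennreal_mult'[symmetric] A_def mult_ac)
      moreover have "ennreal (s\<^sup>2) * ennreal (3 * ?e) = ennreal (3 * X)"
        by (simp add: ennreal_mult'[symmetric] X_def mult_ac)
      moreover have "D * ?Q * ?e + 2 * s\<^sup>2 * (3 * ?e) = D * Y + 6 * X" by (simp add: X_def Y_def)
      ultimately show ?thesis using nonneg by (simp add: ennreal_plus[symmetric] del: ennreal_plus)
    qed
    ultimately show ?thesis unfolding D_def by (simp add: ennreal_leI)
  qed
  finally show ?thesis .
qed

end

section \<open>Orthonormality of the Haar system\<close>

text \<open>The dyadic intervals of length \<open>1 / 2 ^ i\<close>, described by the leading binary digits of their
  points, so that nesting is a statement about integer division.\<close>

definition dyadic :: "nat \<Rightarrow> int \<Rightarrow> real set" where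
  "dyadic i k = {x. \<lfloor>2 ^ i * x\<rfloor> = k}"

lemma dyadic_eq: "dyadic i k = {of_int k / 2 ^ i ..< (of_int k + 1) / 2 ^ i}"
  by (auto simp: dyadic_def floor_eq_iff field_simps)

lemma dyadic_measurable [measurable]: "dyadic i k \<in> sets lborel"
  by (simp add: dyadic_eq)

lemma integrable_dyadic: "integrable lborel (indicator (dyadic i k) :: real \<Rightarrow> real)"
  and measure_dyadic: "measure lborel (dyadic i k) = 1 / (2::real) ^ i"
proof -
  have e: "emeasure lborel (dyadic i k) = ennreal (1 / 2 ^ i)"
    unfolding dyadic_eq by (subst emeasure_lborel_Ico) (auto simp: field_simps)
  then show "integrable lborel (indicator (dyadic i k) :: real \<Rightarrow> real)"
    by (simp add: integrable_indicator_iff dyadic_eq)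
  show "measure lborel (dyadic i k) = 1 / (2::real) ^ i"
    using e by (simp add: measure_def)
qed

lemma floor_power2_mono:
  fixes x y :: real
  assumes "i \<le> j" "\<lfloor>2 ^ j * x\<rfloor> = \<lfloor>2 ^ j * y\<rfloor>"
  shows "\<lfloor>2 ^ i * x\<rfloor> = \<lfloor>2 ^ i * y\<rfloor>"
proof -
  have "\<lfloor>2 ^ i * z\<rfloor> = \<lfloor>2 ^ j * z\<rfloor> div 2 ^ (j - i)" for z :: real
  proof -
    have "2 ^ j * z / real_of_int (2 ^ (j - i)) = 2 ^ i * z"
      using power_add[of "2::real" "j - i" i] \<open>i \<le> j\<close> by simp
    then show ?thesis by (metis floor_divide_real_eq_div zero_le_numeral zero_le_power)
  qed
  with assms show ?thesis by simp
qed

text \<open>The Haar system on half-open intervals. It agrees with the system of \<^const>\<open>haar\<close> except at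
  the dyadic break points, and products of two of its members can be computed pointwise.\<close>

definition dyadic_haar :: "int \<times> int \<Rightarrow> real \<Rightarrow> real" where
  "dyadic_haar = (\<lambda>(j, k) x. if j = -1 then indicator (dyadic 0 k) x
     else 2 powr (of_int j / 2) *
       (indicator (dyadic (Suc (nat j)) (2 * k)) x - indicator (dyadic (Suc (nat j)) (2 * k + 1)) x))"

lemma wav_haar_AE: "l \<in> \<Lambda> \<Longrightarrow> AE x in lborel. wav \<phi> haar l x = dyadic_haar l x"
proof -
  assume l: "l \<in> \<Lambda>"
  obtain j k where jk: "l = (j, k)" by (cases l)
  have "j \<ge> -1" using l jk by (simp add: \<Lambda>_def)
  define i where "i = nat (j + 1)"
  have "(\<lambda>z. of_int z / 2 ^ i) ` (UNIV :: int set) \<in> null_sets lborel"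
    by (intro countable_imp_null_set_lborel) auto
  then have "AE x in lborel. x \<notin> (\<lambda>z. of_int z / 2 ^ i) ` (UNIV :: int set)"
    by (rule AE_not_in)
  then show ?thesis
  proof eventually_elim
    case (elim x)
    then have ne: "2 ^ i * x \<noteq> of_int z" for z by (auto simp: image_iff field_simps)
    show ?case
    proof (cases "j = -1")
      case True
      then have "x \<noteq> of_int (k + 1)" using ne[of "k + 1"] by (simp add: i_def)
      then show ?thesis using True
        by (auto simp: jk wav_def dyadic_haar_def \<phi>_def indicator_def dyadic_def floor_eq_iff)
    next
      case False
      then have "0 \<le> j" using \<open>j \<ge> -1\<close> by simp
      then obtain n where n: "j = int n" by (metis nonneg_int_cases)
      then have i: "i = Suc n" by (simp add: i_def nat_add_distrib)
      define y where "y = 2 ^ n * x"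
      have y: "2 * y \<noteq> of_int z" for z using ne[of z] by (simp add: i y_def mult.assoc)
      have mem: "x \<in> dyadic (Suc n) z \<longleftrightarrow> of_int z \<le> 2 * y \<and> 2 * y < of_int z + 1" for z
        by (simp add: dyadic_def y_def floor_eq_iff mult.assoc)
      have "2 powr of_int j * x = y" by (simp add: n y_def powr_realpow)
      moreover have "haar (y - of_int k) = indicator (dyadic (Suc n) (2 * k)) x - indicator (dyadic (Suc n) (2 * k + 1)) x"
      proof -
        have "2 * y \<noteq> 2 * of_int k + 1" "2 * y \<noteq> 2 * of_int k + 2"
          using y[of "2 * k + 1"] y[of "2 * k + 2"] by simp_all
        then consider "2 * y < 2 * of_int k" | "2 * of_int k \<le> 2 * y" "2 * y < 2 * of_int k + 1"
          | "2 * of_int k + 1 < 2 * y" "2 * y < 2 * of_int k + 2" | "2 * of_int k + 2 < 2 * y"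
          by linarith
        then show ?thesis by cases (simp_all add: haar_def indicator_def mem)
      qed
      ultimately show ?thesis by (simp add: jk wav_def dyadic_haar_def n)
    qed
  qed
qed

text \<open>A Haar function of level \<open>j\<close> depends on its argument only through the integer part of
  \<open>2 ^ (j + 1) * x\<close>, which every finer dyadic interval determines.\<close>

lemma dyadic_haar_cong:
  assumes "j \<ge> -1" "i \<ge> nat (j + 1)" "\<lfloor>2 ^ i * x\<rfloor> = \<lfloor>2 ^ i * y\<rfloor>"
  shows "dyadic_haar (j, k) x = dyadic_haar (j, k) y"
proof -
  have f: "\<lfloor>2 ^ nat (j + 1) * x\<rfloor> = \<lfloor>2 ^ nat (j + 1) * y\<rfloor>"
    by (rule floor_power2_mono[OF assms(2,3)])
  show ?thesis
  proof (cases "j = -1")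
    case True
    then show ?thesis using f by (simp add: dyadic_haar_def dyadic_def indicator_def)
  next
    case False
    then have "nat (j + 1) = Suc (nat j)" using assms(1) by (simp add: nat_add_distrib)
    then show ?thesis using f False by (simp add: dyadic_haar_def dyadic_def indicator_def del: power_Suc)
  qed
qed

lemma dyadic_haar_integral:
  assumes "j \<ge> 0"
  shows "(\<integral>x. dyadic_haar (j, k) x \<partial>lborel) = 0"
  using assms by (simp add: dyadic_haar_def integrable_dyadic measure_dyadic)

text \<open>On the support of the finer function the coarser one is constant, and the finer one has integral
  zero. The witness \<open>x0\<close> is the left end point of that support.\<close>

lemma dyadic_haar_orthogonal:
  assumes "j \<ge> -1" "j < j'"
  shows "(\<integral>x. dyadic_haar (j, k) x * dyadic_haar (j', k') x \<partial>lborel) = 0"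
proof -
  define x0 :: real where "x0 = of_int k' / 2 ^ nat j'"
  have "dyadic_haar (j, k) x * dyadic_haar (j', k') x = dyadic_haar (j, k) x0 * dyadic_haar (j', k') x" for x
  proof (cases "dyadic_haar (j', k') x = 0")
    case False
    then have "\<lfloor>2 * (2 ^ nat j' * x)\<rfloor> = 2 * k' \<or> \<lfloor>2 * (2 ^ nat j' * x)\<rfloor> = 2 * k' + 1"
      using assms by (auto simp: dyadic_haar_def dyadic_def indicator_def mult.assoc split: if_splits)
    then have "\<lfloor>2 ^ nat j' * x\<rfloor> = k'" by (auto simp: floor_eq_iff)
    moreover have "\<lfloor>2 ^ nat j' * x0\<rfloor> = k'" by (simp add: x0_def)
    ultimately have "dyadic_haar (j, k) x = dyadic_haar (j, k) x0"
      using assms by (intro dyadic_haar_cong[of j "nat j'"]) auto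
    then show ?thesis by simp
  qed simp
  then have "(\<integral>x. dyadic_haar (j, k) x * dyadic_haar (j', k') x \<partial>lborel)
      = dyadic_haar (j, k) x0 * (\<integral>x. dyadic_haar (j', k') x \<partial>lborel)"
    by (simp only: integral_mult_right_zero)
  also have "\<dots> = 0" using assms dyadic_haar_integral[of j' k'] by simp
  finally show ?thesis .
qed

lemma dyadic_haar_same_level:
  assumes "j \<ge> -1"
  shows "(\<integral>x. dyadic_haar (j, k) x * dyadic_haar (j, k') x \<partial>lborel) = (if k = k' then 1 else 0)"
proof (cases "k = k'")
  case False
  have "(\<lambda>x. dyadic_haar (j, k) x * dyadic_haar (j, k') x) = (\<lambda>x. 0)"
  proof
    fix x
    have "2 * k \<noteq> 2 * k'" "2 * k \<noteq> 2 * k' + 1" "2 * k + 1 \<noteq> 2 * k'" "2 * k + 1 \<noteq> 2 * k' + 1"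
      using False by presburger+
    with False show "dyadic_haar (j, k) x * dyadic_haar (j, k') x = 0"
      by (simp add: dyadic_haar_def dyadic_def indicator_def)
  qed
  then show ?thesis using False by (simp only:) simp
next
  case True
  show ?thesis
  proof (cases "j = -1")
    case True
    have "(\<lambda>x. dyadic_haar (j, k) x * dyadic_haar (j, k') x) = indicator (dyadic 0 k)"
      using True \<open>k = k'\<close> by (auto simp: fun_eq_iff dyadic_haar_def indicator_def)
    then show ?thesis using \<open>k = k'\<close> by (simp only:) (simp add: measure_dyadic)
  next
    case False
    then have "0 \<le> j" using assms by simp
    have "dyadic_haar (j, k) x * dyadic_haar (j, k) x = 2 ^ nat j *
        (indicator (dyadic (Suc (nat j)) (2 * k)) x + indicator (dyadic (Suc (nat j)) (2 * k + 1)) x)" for x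
    proof -
      have "2 powr (of_int j / 2) * 2 powr (of_int j / 2) = (2 ^ nat j :: real)"
        using \<open>0 \<le> j\<close> by (simp add: powr_add[symmetric] powr_int)
      then have "dyadic_haar (j, k) x * dyadic_haar (j, k) x = 2 ^ nat j *
        (indicator (dyadic (Suc (nat j)) (2 * k)) x - indicator (dyadic (Suc (nat j)) (2 * k + 1)) x)\<^sup>2"
        using False by (simp add: dyadic_haar_def power2_eq_square)
      then show ?thesis by (simp add: dyadic_def indicator_def)
    qed
    then show ?thesis using \<open>k = k'\<close> by (simp add: integrable_dyadic measure_dyadic)
  qed
qed

lemma wav_measurable [measurable]:
  assumes [measurable]: "g \<in> borel_measurable borel" "h \<in> borel_measurable borel"
  shows "wav g h l \<in> borel_measurable borel"
proof -
  obtain j k where "l = (j, k)" by (cases l)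
  moreover have "wav g h (j, k) = (if j = -1 then (\<lambda>x. g (x - of_int k))
      else (\<lambda>x. 2 powr (of_int j / 2) * h (2 powr of_int j * x - of_int k)))"
    by (auto simp: wav_def)
  ultimately show ?thesis by simp
qed

lemma haar_measurable [measurable]: "haar \<in> borel_measurable borel"
  and \<phi>_measurable [measurable]: "\<phi> \<in> borel_measurable borel"
  unfolding haar_def[abs_def] \<phi>_def by measurable

lemma haar_orthonormal:
  assumes "l \<in> \<Lambda>" "l' \<in> \<Lambda>"
  shows "(\<integral>x. wav \<phi> haar l x * wav \<phi> haar l' x \<partial>lborel) = (if l = l' then 1 else 0)"
proof -
  have [measurable]: "dyadic_haar l \<in> borel_measurable lborel" for l
    unfolding dyadic_haar_def by (cases l) (simp add: dyadic_eq)
  have "(\<integral>x. wav \<phi> haar l x * wav \<phi> haar l' x \<partial>lborel) = (\<integral>x. dyadic_haar l x * dyadic_haar l' x \<partial>lborel)"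
    using wav_haar_AE[OF assms(1)] wav_haar_AE[OF assms(2)]
    by (intro integral_cong_AE) (measurable, auto)
  also have "\<dots> = (if l = l' then 1 else 0)"
  proof -
    obtain j k j' k' where jk: "l = (j, k)" "l' = (j', k')" by (cases l, cases l')
    have j: "j \<ge> -1" "j' \<ge> -1" using assms by (auto simp: jk \<Lambda>_def)
    consider "j < j'" | "j' < j" | "j = j'" by linarith
    then show ?thesis
    proof cases
      case 1
      then show ?thesis using dyadic_haar_orthogonal[OF j(1)] by (simp add: jk)
    next
      case 2
      then show ?thesis using dyadic_haar_orthogonal[OF j(2), of j k' k] by (simp add: jk mult.commute)
    next
      case 3
      then show ?thesis using dyadic_haar_same_level[OF j(1)] by (simp add: jk)
    qed
  qed
  finally show ?thesis .
qed

section \<open>Wavelet bases with a step function analysis side\<close>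

text \<open>The function factors through the finite map that records which break points lie to the left
  of \<open>x\<close> and which of them equals \<open>x\<close>.\<close>

lemma finite_range_piecewise_constant:
  assumes "piecewise_constant g"
  shows "finite (range g)" and "g \<in> borel_measurable borel"
proof -
  obtain S where S: "finite S" and c: "\<And>x y. x \<le> y \<Longrightarrow> {x..y} \<inter> S = {} \<Longrightarrow> g x = g y"
    using assms by (auto simp: piecewise_constant_def)
  define cell where "cell = (\<lambda>x. (S \<inter> {..x}, S \<inter> {x}))"
  have le: "g x = g y" if "x \<le> y" "cell x = cell y" for x y
  proof (cases "x \<in> S")
    case True
    then have "x \<in> S \<inter> {y}" using that(2) by (auto simp: cell_def)
    then show ?thesis by simp
  next
    case False
    have "s \<notin> S" if "x \<le> s" "s \<le> y" for s
    proof
      assume "s \<in> S"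
      then have "s \<in> S \<inter> {..x}" using \<open>cell x = cell y\<close> \<open>s \<le> y\<close> by (auto simp: cell_def)
      with \<open>x \<le> s\<close> \<open>s \<in> S\<close> False show False by auto
    qed
    with \<open>x \<le> y\<close> show ?thesis by (intro c) auto
  qed
  have eq: "g x = g y" if "cell x = cell y" for x y
    using le[OF _ that] le[OF _ that[symmetric], symmetric] by (rule linorder_le_cases)
  define G where "G = (\<lambda>p. g (SOME x. cell x = p))"
  have "cell (SOME y. cell y = cell x) = cell x" for x by (rule someI) simp
  then have G: "g x = G (cell x)" for x unfolding G_def by (intro eq) simp
  have fin: "finite (range cell)"
    by (rule finite_subset[of _ "Pow S \<times> Pow S"]) (auto simp: cell_def S)
  then show "finite (range g)"
    by (rule finite_surj[of _ _ G]) (use G in blast)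
  have "cell -` {p} \<in> sets borel" if p: "p \<in> range cell" for p
  proof -
    obtain x where "p = cell x" using p by auto
    then have "cell -` {p} = {y. \<forall>s\<in>S. (s \<le> y) = (s \<le> x) \<and> (s = y) = (s = x)}"
      unfolding cell_def vimage_def by (simp add: set_eq_iff) blast
    also have "\<dots> \<in> sets borel" using S by measurable
    finally show ?thesis .
  qed
  then have "cell \<in> borel \<rightarrow>\<^sub>M count_space (range cell)"
    using fin by (subst measurable_count_space_eq_countable) (auto intro: countable_finite)
  moreover have "G \<in> count_space (range cell) \<rightarrow>\<^sub>M borel" by simp
  ultimately have "(\<lambda>x. G (cell x)) \<in> borel_measurable borel" by (rule measurable_compose)
  then show "g \<in> borel_measurable borel" by (simp only: G[symmetric])
qed

text \<open>The properties shared by the generating functions of both kinds of system, smooth and Haar, on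
  which integrability and the local finiteness of supports rest.\<close>

definition test_function :: "(real \<Rightarrow> real) \<Rightarrow> bool" where
  "test_function g \<longleftrightarrow> g \<in> borel_measurable borel \<and> bounded (range g) \<and> (\<exists>A. \<forall>x. g x \<noteq> 0 \<longrightarrow> \<bar>x\<bar> \<le> A)"

lemma compactly_supported_bound:
  assumes "compactly_supported g"
  shows "\<exists>A. \<forall>x. g x \<noteq> 0 \<longrightarrow> \<bar>x\<bar> \<le> A"
proof -
  have "bounded {x. g x \<noteq> 0}"
    using assms unfolding compactly_supported_def
    by (meson bounded_subset closure_subset compact_imp_bounded)
  then show ?thesis by (auto simp: bounded_iff)
qed

lemma test_function_holder:
  assumes "compactly_supported g" "g \<in> holder_space (r + 1)" "0 < r"
  shows "test_function g"
proof -
  obtain m :: nat where m: "r + 1 \<le> real m + 1"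
    and d: "\<forall>i<m. \<forall>x. (deriv ^^ i) g differentiable (at x)"
    and b: "\<forall>i\<le>m. bounded (range ((deriv ^^ i) g))"
    using assms(2) by (auto simp: holder_space_def)
  have "0 < m" using m assms(3) by simp
  then have "\<forall>x. g differentiable (at x)" using d by (metis funpow_0)
  then have "continuous_on UNIV g"
    by (auto intro!: differentiable_imp_continuous_on simp: differentiable_on_def)
  then have "g \<in> borel_measurable borel" by (rule borel_measurable_continuous_onI)
  moreover have "bounded (range g)" using b by (metis funpow_0 le0)
  ultimately show ?thesis using compactly_supported_bound[OF assms(1)] by (simp add: test_function_def)
qed

lemma test_function_\<phi>: "test_function \<phi>"
  unfolding test_function_def by (auto intro!: exI[of _ 1] boundedI[where B = 1] simp: \<phi>_def indicator_def)

lemma test_function_haar: "test_function haar"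
  unfolding test_function_def
  by (auto intro!: exI[of _ 1] boundedI[where B = 1] simp: haar_def indicator_def split: if_splits)

lemma finite_range_haar: "finite (range haar)"
  by (rule finite_subset[of _ "{1, 0, -1}"]) (auto simp: haar_def indicator_def)

lemma test_function_piecewise_constant:
  "compactly_supported g \<Longrightarrow> piecewise_constant g \<Longrightarrow> test_function g"
  using finite_range_piecewise_constant compactly_supported_bound finite_imp_bounded
  by (auto simp: test_function_def)

text \<open>The finite range of \<open>\<psi>\<close> is essential: it makes every empirical coefficient a finite combination
  of counts.\<close>

locale wavelet_basis =
  fixes \<psi> \<phi>' \<psi>' :: "real \<Rightarrow> real"
  assumes \<psi>_finite: "finite (range \<psi>)"
    and test: "test_function \<psi>" "test_function \<phi>'" "test_function \<psi>'"
    and biorthogonal: "\<And>l l'. l \<in> \<Lambda> \<Longrightarrow> l' \<in> \<Lambda> \<Longrightarrow>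
      (\<integral>x. wav \<phi> \<psi> l x * wav \<phi>' \<psi>' l' x \<partial>lborel) = (if l = l' then 1 else 0)"

lemma biorthogonal_basis_imp_wavelet_basis:
  assumes "biorthogonal_basis r \<psi> \<phi>' \<psi>'"
  shows "wavelet_basis \<psi> \<phi>' \<psi>'"
proof -
  consider "smooth_system r \<psi> \<phi>' \<psi>'" | "haar_system r \<psi> \<phi>' \<psi>'"
    using assms by (auto simp: biorthogonal_basis_def)
  then show ?thesis
  proof cases
    case 1
    then show ?thesis
      by unfold_locales
        (auto simp: smooth_system_def finite_range_piecewise_constant
          intro: test_function_piecewise_constant test_function_holder)
  next
    case 2
    then show ?thesis
      by unfold_locales
        (auto simp: haar_system_def finite_range_haar haar_orthonormal test_function_haar test_function_\<phi>)
  qed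
qed

text \<open>The father functions live at the same scale as level \<open>0\<close>, which \<open>max j 0\<close> expresses.\<close>

lemma wav_support:
  assumes "\<And>x. g x \<noteq> 0 \<Longrightarrow> \<bar>x\<bar> \<le> A" "\<And>x. h x \<noteq> 0 \<Longrightarrow> \<bar>x\<bar> \<le> A" "-1 \<le> j" "wav g h (j, k) x \<noteq> 0"
  shows "\<bar>2 powr of_int (max j 0) * x - of_int k\<bar> \<le> A"
proof (cases "j = -1")
  case False
  then have "max j 0 = j" using assms(3) by simp
  with False show ?thesis using assms by (simp add: wav_def)
qed (use assms in \<open>auto simp: wav_def\<close>)

lemma test_function_wav:
  assumes g: "test_function g" and h: "test_function h" and l: "l \<in> \<Lambda>"
  shows "test_function (wav g h l)"
proof -
  obtain j k where jk: "l = (j, k)" "-1 \<le> j" using l by (cases l) (auto simp: \<Lambda>_def)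
  obtain A A' where "\<And>x. g x \<noteq> 0 \<Longrightarrow> \<bar>x\<bar> \<le> A" "\<And>x. h x \<noteq> 0 \<Longrightarrow> \<bar>x\<bar> \<le> A'"
    using g h by (auto simp: test_function_def)
  then have s: "wav g h (j, k) x \<noteq> 0 \<Longrightarrow> \<bar>2 powr of_int (max j 0) * x - of_int k\<bar> \<le> max A A'" for x
    using jk(2) by (intro wav_support[where A = "max A A'"]) (auto simp: le_max_iff_disj)
  have "\<bar>x\<bar> \<le> max A A' + \<bar>of_int k\<bar>" if "wav g h (j, k) x \<noteq> 0" for x
  proof -
    have "1 * \<bar>x\<bar> \<le> 2 powr of_int (max j 0) * \<bar>x\<bar>"
      by (intro mult_right_mono) (auto intro: ge_one_powr_ge_zero)
    also have "\<dots> = \<bar>2 powr of_int (max j 0) * x\<bar>" by (simp add: abs_mult)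
    finally show ?thesis using s[OF that] by linarith
  qed
  moreover have "bounded (range (wav g h (j, k)))"
  proof -
    obtain B B' where "\<And>x. \<bar>g x\<bar> \<le> B" "\<And>x. \<bar>h x\<bar> \<le> B'"
      using g h by (auto simp: test_function_def bounded_iff)
    then have "\<bar>wav g h (j, k) x\<bar> \<le> max B (2 powr (of_int j / 2) * B')" for x
      by (auto simp: wav_def abs_mult le_max_iff_disj intro!: mult_left_mono)
    then show ?thesis by (auto intro!: boundedI)
  qed
  ultimately show ?thesis
    using g h unfolding jk(1) by (auto simp: test_function_def)
qed

lemma test_function_integrable_mult:
  assumes g: "test_function g" and f: "integrable lborel f"
  shows "integrable lborel (\<lambda>x. g x * f x)"
proof -
  obtain B where B: "\<And>x. \<bar>g x\<bar> \<le> B" using g by (auto simp: test_function_def bounded_iff)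
  show ?thesis
  proof (rule Bochner_Integration.integrable_bound[of _ "\<lambda>x. B * f x"])
    show "integrable lborel (\<lambda>x. B * f x)" using f by simp
    show "(\<lambda>x. g x * f x) \<in> borel_measurable lborel" using g f by (auto simp: test_function_def)
    show "AE x in lborel. norm (g x * f x) \<le> norm (B * f x)"
      using B by (auto simp: abs_mult intro!: mult_right_mono order.trans[OF B])
  qed
qed

lemma test_function_integrable:
  assumes g: "test_function g"
  shows "integrable lborel g"
proof -
  obtain A where A: "\<And>x. g x \<noteq> 0 \<Longrightarrow> \<bar>x\<bar> \<le> A" using g by (auto simp: test_function_def)
  have "integrable lborel (\<lambda>x. g x * indicator {-A..A} x)"
    by (intro test_function_integrable_mult[OF g]) (auto simp: integrable_indicator_iff emeasure_lborel_Icc_eq)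
  also have "(\<lambda>x. g x * indicator {-A..A} x) = g" using A by (force simp: indicator_def fun_eq_iff)
  finally show ?thesis .
qed

lemma epowr_less_top: "0 < a \<Longrightarrow> epowr x a < top \<longleftrightarrow> x < top"
  by (auto simp: epowr_def less_top[symmetric])

lemma L_space_2_iff: "f \<in> L_space 2 \<longleftrightarrow> f \<in> borel_measurable lborel \<and> (\<integral>\<^sup>+x. ennreal ((f x)\<^sup>2) \<partial>lborel) < \<infinity>"
proof -
  have "\<bar>f x\<bar> powr 2 = (f x)\<^sup>2" for x
    by (cases "f x = 0") (auto simp: powr_realpow[of _ 2, simplified])
  then show ?thesis by (simp add: L_space_def L_norm_def epowr_less_top)
qed

lemma test_function_L_space_2: "test_function g \<Longrightarrow> g \<in> L_space 2"
proof -
  assume g: "test_function g"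
  then have "integrable lborel (\<lambda>x. g x * g x)"
    by (intro test_function_integrable_mult test_function_integrable)
  then show ?thesis using g
    by (auto simp: L_space_2_iff test_function_def power2_eq_square nn_integral_eq_integral)
qed

lemma L_space_2_diff:
  assumes "f \<in> L_space 2" "g \<in> L_space 2"
  shows "(\<lambda>x. f x - g x) \<in> L_space 2"
proof -
  have [measurable]: "f \<in> borel_measurable lborel" "g \<in> borel_measurable lborel"
    using assms by (auto simp: L_space_2_iff)
  have "(\<integral>\<^sup>+x. ennreal ((f x - g x)\<^sup>2) \<partial>lborel) \<le> (\<integral>\<^sup>+x. 2 * ennreal ((f x)\<^sup>2) + 2 * ennreal ((g x)\<^sup>2) \<partial>lborel)"
  proof (intro nn_integral_mono)
    fix x
    have "(f x - g x)\<^sup>2 \<le> 2 * (f x)\<^sup>2 + 2 * (g x)\<^sup>2"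
      using zero_le_power2[of "f x + g x"] by (simp add: power2_eq_square algebra_simps)
    then show "ennreal ((f x - g x)\<^sup>2) \<le> 2 * ennreal ((f x)\<^sup>2) + 2 * ennreal ((g x)\<^sup>2)"
      by (simp add: ennreal_numeral[symmetric] ennreal_mult[symmetric] ennreal_plus[symmetric]
          ennreal_leI del: ennreal_numeral ennreal_plus)
  qed
  also have "\<dots> < \<infinity>"
    using assms by (simp add: nn_integral_add nn_integral_cmult L_space_2_iff ennreal_mult_less_top)
  finally show ?thesis by (simp add: L_space_2_iff)
qed

lemma finite_int_near: "finite {k::int. \<bar>y - of_int k\<bar> \<le> (A::real)}"
  by (rule finite_subset[of _ "{\<lceil>y - A\<rceil>..\<lfloor>y + A\<rfloor>}"]) (auto simp: ceiling_le_iff le_floor_iff)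

lemma card_int_near:
  assumes "0 \<le> A"
  shows "real (card {k::int. \<bar>y - of_int k\<bar> \<le> (A::real)}) \<le> 2 * A + 1"
proof -
  have "card {k::int. \<bar>y - of_int k\<bar> \<le> A} \<le> card {\<lceil>y - A\<rceil>..\<lfloor>y + A\<rfloor>}"
    by (rule card_mono) (auto simp: ceiling_le_iff le_floor_iff)
  then have "real (card {k::int. \<bar>y - of_int k\<bar> \<le> A}) \<le> real (nat (\<lfloor>y + A\<rfloor> - \<lceil>y - A\<rceil> + 1))" by simp
  also have "\<dots> \<le> 2 * A + 1" using assms by linarith
  finally show ?thesis .
qed

context wavelet_basis
begin

lemma test_analysis: "l \<in> \<Lambda> \<Longrightarrow> test_function (wav \<phi> \<psi> l)"
  and test_synthesis: "l \<in> \<Lambda> \<Longrightarrow> test_function (wav \<phi>' \<psi>' l)"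
  by (simp_all add: test_function_wav test test_function_\<phi>)

text \<open>A nonzero empirical coefficient needs a point in its support, and each point lies in finitely
  many supports of each of the finitely many levels.\<close>

lemma finite_support_coef_hat:
  assumes "finite X"
  shows "finite {l \<in> \<Gamma>_level c n. coef_hat \<psi> n X l \<noteq> 0}"
proof -
  obtain A where A: "\<And>x. \<psi> x \<noteq> 0 \<Longrightarrow> \<bar>x\<bar> \<le> A" using test(1) by (auto simp: test_function_def)
  have "l \<in> (SIGMA j:{-1..max_level c n}. \<Union>T\<in>X. {k. \<bar>2 powr of_int (max j 0) * T - of_int k\<bar> \<le> max 1 A})"
    if l: "l \<in> \<Gamma>_level c n" "coef_hat \<psi> n X l \<noteq> 0" for l
  proof -
    obtain j k where jk: "l = (j, k)" "-1 \<le> j" "j \<le> max_level c n"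
      using l(1) by (cases l) (auto simp: \<Gamma>_level_def \<Lambda>_def)
    have "(\<Sum>T\<in>X. wav \<phi> \<psi> l T) \<noteq> 0" using l(2) assms by (auto simp: coef_hat_def)
    then obtain T where "T \<in> X" "wav \<phi> \<psi> l T \<noteq> 0" using sum.not_neutral_contains_not_neutral by blast
    moreover from this have "\<bar>2 powr of_int (max j 0) * T - of_int k\<bar> \<le> max 1 A"
      using jk A by (intro wav_support[of \<phi> _ \<psi>]) (auto simp: \<phi>_def indicator_def le_max_iff_disj split: if_splits)
    ultimately show ?thesis using jk by auto
  qed
  then have "{l \<in> \<Gamma>_level c n. coef_hat \<psi> n X l \<noteq> 0}
      \<subseteq> (SIGMA j:{-1..max_level c n}. \<Union>T\<in>X. {k. \<bar>2 powr of_int (max j 0) * T - of_int k\<bar> \<le> max 1 A})"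
    by blast
  then show ?thesis
    by (rule finite_subset) (intro finite_SigmaI finite_UN_I assms finite_int_near finite_atLeastAtMost_int)
qed

text \<open>For a finite configuration the estimator is a finite sum, so that biorthogonality applies term
  by term.\<close>

lemma estimator_error:
  fixes \<gamma> c :: real and n :: nat
  assumes X: "finite X" and f: "integrable lborel f" "f \<in> L_space 2"
  defines "g \<equiv> (\<lambda>x. estimator \<psi> \<phi>' \<psi>' \<gamma> n (\<Gamma>_level c n) X x - f x)"
  shows "g \<in> L_space 2"
    and "l \<in> \<Lambda> \<Longrightarrow> coef \<psi> g l = coef_tilde \<psi> \<gamma> n (\<Gamma>_level c n) X l - coef \<psi> f l"
proof -
  define F where "F = {l \<in> \<Gamma>_level c n. coef_hat \<psi> n X l \<noteq> 0}"
  have F: "finite F" "F \<subseteq> \<Lambda>"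
    using finite_support_coef_hat[OF X] by (auto simp: F_def \<Gamma>_level_def)
  let ?t = "coef_tilde \<psi> \<gamma> n (\<Gamma>_level c n) X"
  have t0: "?t l = 0" if "l \<notin> F" for l using that by (auto simp: F_def coef_tilde_def)
  let ?e = "\<lambda>x. \<Sum>l\<in>F. ?t l * wav \<phi>' \<psi>' l x"
  have est: "estimator \<psi> \<phi>' \<psi>' \<gamma> n (\<Gamma>_level c n) X x = ?e x" for x
  proof -
    have "estimator \<psi> \<phi>' \<psi>' \<gamma> n (\<Gamma>_level c n) X x = (\<Sum>\<^sub>\<infinity>l\<in>F. ?t l * wav \<phi>' \<psi>' l x)"
      unfolding estimator_def by (rule infsum_cong_neutral) (use F t0 in auto)
    then show ?thesis using F by simp
  qed
  then have g: "g = (\<lambda>x. ?e x - f x)" by (simp add: g_def)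
  have "(\<lambda>x. 0) \<in> L_space 2" by (simp add: L_space_2_iff)
  have test_sum: "test_function ?e"
    using F
  proof (induction F rule: finite_induct)
    case empty
    show ?case by (simp add: test_function_def)
  next
    case (insert l F)
    then have 1: "test_function (wav \<phi>' \<psi>' l)" and 2: "test_function (\<lambda>x. \<Sum>l\<in>F. ?t l * wav \<phi>' \<psi>' l x)"
      by (auto intro: test_synthesis)
    obtain A B A' B' where "\<And>x. wav \<phi>' \<psi>' l x \<noteq> 0 \<Longrightarrow> \<bar>x\<bar> \<le> A" "\<And>x. \<bar>wav \<phi>' \<psi>' l x\<bar> \<le> B"
        "\<And>x. (\<Sum>l\<in>F. ?t l * wav \<phi>' \<psi>' l x) \<noteq> 0 \<Longrightarrow> \<bar>x\<bar> \<le> A'" "\<And>x. \<bar>\<Sum>l\<in>F. ?t l * wav \<phi>' \<psi>' l x\<bar> \<le> B'"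
      using 1 2 by (auto simp: test_function_def bounded_iff)
    note b = this
    have "\<bar>x\<bar> \<le> max A A'" if "?t l * wav \<phi>' \<psi>' l x + (\<Sum>l\<in>F. ?t l * wav \<phi>' \<psi>' l x) \<noteq> 0" for x
      using b(1)[of x] b(3)[of x] that by (cases "wav \<phi>' \<psi>' l x = 0") (auto simp: le_max_iff_disj)
    moreover have "\<bar>?t l * wav \<phi>' \<psi>' l x + (\<Sum>l\<in>F. ?t l * wav \<phi>' \<psi>' l x)\<bar> \<le> \<bar>?t l\<bar> * B + B'" for x
      using b(2)[of x] b(4)[of x] by (intro abs_triangle_ineq[THEN order.trans] add_mono) (auto simp: abs_mult mult_left_mono)
    then have "bounded (range (\<lambda>x. ?t l * wav \<phi>' \<psi>' l x + (\<Sum>l\<in>F. ?t l * wav \<phi>' \<psi>' l x)))"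
      by (auto intro!: boundedI)
    ultimately show ?case
      using insert 1 2 by (auto simp: test_function_def)
  qed
  then show "g \<in> L_space 2" unfolding g by (intro L_space_2_diff test_function_L_space_2 f)
  assume l: "l \<in> \<Lambda>"
  have int: "integrable lborel (\<lambda>x. wav \<phi> \<psi> l x * wav \<phi>' \<psi>' l' x)" if "l' \<in> F" for l'
    using that F l by (intro test_function_integrable_mult test_function_integrable test_analysis test_synthesis) auto
  have "coef \<psi> g l = (\<integral>x. (\<Sum>l'\<in>F. ?t l' * (wav \<phi> \<psi> l x * wav \<phi>' \<psi>' l' x)) - wav \<phi> \<psi> l x * f x \<partial>lborel)"
    unfolding coef_def g by (intro Bochner_Integration.integral_cong) (auto simp: right_diff_distrib sum_distrib_left mult_ac)
  also have "\<dots> = (\<integral>x. (\<Sum>l'\<in>F. ?t l' * (wav \<phi> \<psi> l x * wav \<phi>' \<psi>' l' x)) \<partial>lborel) - coef \<psi> f l"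
    unfolding coef_def using int
    by (intro Bochner_Integration.integral_diff test_function_integrable_mult test_analysis l f) auto
  also have "(\<integral>x. (\<Sum>l'\<in>F. ?t l' * (wav \<phi> \<psi> l x * wav \<phi>' \<psi>' l' x)) \<partial>lborel)
      = (\<Sum>l'\<in>F. ?t l' * (if l = l' then 1 else 0))"
    using int F by (subst Bochner_Integration.integral_sum) (auto intro!: sum.cong simp: biorthogonal[OF l])
  also have "\<dots> = ?t l" using F t0[of l] by (simp add: if_distrib sum.delta' cong: if_cong)
  finally show "coef \<psi> g l = ?t l - coef \<psi> f l" .
qed

end

section \<open>Empirical coefficients of a Poisson process\<close>

definition mass :: "(real \<Rightarrow> real) \<Rightarrow> real set \<Rightarrow> real" where
  "mass f A = (\<integral>x. indicator A x * f x \<partial>lborel)"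

lemma integrable_indicator_mult:
  fixes f :: "real \<Rightarrow> real"
  assumes "integrable lborel f" "A \<in> sets borel"
  shows "integrable lborel (\<lambda>x. indicator A x * f x)"
  using integrable_mult_indicator[of A lborel f] assms by simp

lemma mass_nonneg: "(\<And>x. 0 \<le> f x) \<Longrightarrow> 0 \<le> mass f A"
  unfolding mass_def by (intro Bochner_Integration.integral_nonneg) auto

lemma finite_range_level_decomposition:
  fixes g :: "real \<Rightarrow> real"
  assumes "finite (range g)"
  shows "g x = (\<Sum>y\<in>range g - {0}. y * indicator (g -` {y}) x)"
    and "indicator {x. g x \<noteq> 0} x = (\<Sum>y\<in>range g - {0}. indicator (g -` {y}) x :: real)"
proof -
  have "(\<Sum>y\<in>range g - {0}. y * indicator (g -` {y}) x) = (\<Sum>y\<in>range g - {0}. if g x = y then y else 0)"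
    by (intro sum.cong) (auto simp: indicator_def)
  then show "g x = (\<Sum>y\<in>range g - {0}. y * indicator (g -` {y}) x)"
    using assms by (simp add: sum.delta')
  have "(\<Sum>y\<in>range g - {0}. indicator (g -` {y}) x :: real) = (\<Sum>y\<in>range g - {0}. if g x = y then 1 else 0)"
    by (intro sum.cong) (auto simp: indicator_def)
  then show "indicator {x. g x \<noteq> 0} x = (\<Sum>y\<in>range g - {0}. indicator (g -` {y}) x :: real)"
    using assms by (simp add: sum.delta')
qed

text \<open>The passage from sums over points to weighted counts; \<open>w\<close> is the identity for the coefficient
  and the square for its estimated variance.\<close>

lemma sum_over_points_eq_sum_over_values:
  fixes g :: "real \<Rightarrow> real" and w :: "real \<Rightarrow> real"
  assumes "finite X" "finite (range g)" "w 0 = 0"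
  shows "(\<Sum>T\<in>X. w (g T))
    = (\<Sum>y\<in>range g - {0}. w y * enn2real (emeasure (count_space UNIV) (X \<inter> g -` {y})))"
proof -
  have "(\<Sum>T\<in>X. w (g T)) = (\<Sum>y\<in>range g. \<Sum>T\<in>{T \<in> X. g T = y}. w (g T))"
    using assms by (subst sum.group) auto
  also have "\<dots> = (\<Sum>y\<in>range g. w y * enn2real (emeasure (count_space UNIV) (X \<inter> g -` {y})))"
  proof (rule sum.cong[OF refl])
    fix y
    have "{T \<in> X. g T = y} = X \<inter> g -` {y}" by auto
    moreover have "finite (X \<inter> g -` {y})" using assms by simp
    ultimately show "(\<Sum>T\<in>{T \<in> X. g T = y}. w (g T)) = w y * enn2real (emeasure (count_space UNIV) (X \<inter> g -` {y}))"
      by (simp add: emeasure_count_space ennreal_of_nat_eq_real_of_nat)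
  qed
  also have "\<dots> = (\<Sum>y\<in>range g - {0}. w y * enn2real (emeasure (count_space UNIV) (X \<inter> g -` {y})))"
    using assms by (intro sum.mono_neutral_right) auto
  finally show ?thesis .
qed

lemma sup_norm_bound:
  assumes "test_function g"
  shows "\<bar>g x\<bar> \<le> sup_norm g"
proof -
  obtain B where "\<And>x. \<bar>g x\<bar> \<le> B" using assms by (auto simp: test_function_def bounded_iff)
  then have "bdd_above (range (\<lambda>x. \<bar>g x\<bar>))" by (intro bdd_aboveI) auto
  then show ?thesis unfolding sup_norm_def by (rule cSUP_upper[OF UNIV_I])
qed

lemma (in prob_space) indep_vars_reindex:
  assumes h: "inj_on h I" and ind: "indep_vars M' X (h ` I)"
  shows "indep_vars (\<lambda>i. M' (h i)) (\<lambda>i. X (h i)) I"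
proof -
  let ?E = "\<lambda>p. {X p -` A \<inter> space M |A. A \<in> sets (M' p)}"
  have rv: "\<forall>p\<in>h ` I. random_variable (M' p) (X p)" and sets: "indep_sets ?E (h ` I)"
    using ind by (auto simp: indep_vars_def2)
  have "indep_sets (\<lambda>i. ?E (h i)) I"
  proof (rule indep_setsI)
    show "?E (h i) \<subseteq> events" if "i \<in> I" for i using that sets by (auto simp: indep_sets_def)
    fix A J assume J: "J \<noteq> {}" "J \<subseteq> I" "finite J" and A: "\<forall>j\<in>J. A j \<in> ?E (h j)"
    define A' where "A' = (\<lambda>p. A (the_inv_into I h p))"
    have A': "A' (h j) = A j" if "j \<in> J" for j
      using that J(2) h by (auto simp: A'_def the_inv_into_f_f)
    have "prob (\<Inter>p\<in>h ` J. A' p) = (\<Prod>p\<in>h ` J. prob (A' p))"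
    proof (rule indep_setsD[OF sets])
      show "\<forall>p\<in>h ` J. A' p \<in> ?E p" using A A' by simp
    qed (use J in auto)
    moreover have "(\<Inter>p\<in>h ` J. A' p) = (\<Inter>j\<in>J. A j)" using A' by simp
    moreover have "(\<Prod>p\<in>h ` J. prob (A' p)) = (\<Prod>j\<in>J. prob (A j))"
      using inj_on_subset[OF h J(2)] A' by (simp add: prod.reindex)
    ultimately show "prob (\<Inter>j\<in>J. A j) = (\<Prod>j\<in>J. prob (A j))" by simp
  qed
  with rv show ?thesis by (simp add: indep_vars_def2)
qed

locale poisson_observation =
  fixes M :: "'w measure" and N :: "'w \<Rightarrow> real set" and n :: nat and f :: "real \<Rightarrow> real"
  assumes process: "poisson_intensity M N n f"
    and n_pos: "0 < n"
    and f_nonneg: "\<And>x. 0 \<le> f x"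
    and f_int: "integrable lborel f"
begin

sublocale prob_space M
  using process by (simp add: poisson_intensity_def poisson_process_def)

lemma f_meas [measurable]: "f \<in> borel_measurable borel" using f_int by auto

lemma emeasure_intensity:
  assumes "A \<in> sets borel"
  shows "emeasure (density lborel (\<lambda>x. ennreal (real n * f x))) A = ennreal (real n * mass f A)"
proof -
  have "emeasure (density lborel (\<lambda>x. ennreal (real n * f x))) A
      = (\<integral>\<^sup>+x. ennreal (real n * (indicator A x * f x)) \<partial>lborel)"
    using assms by (subst emeasure_density) (auto intro!: nn_integral_cong simp: indicator_def)
  also have "\<dots> = ennreal (\<integral>x. real n * (indicator A x * f x) \<partial>lborel)"
    using assms f_nonneg by (intro nn_integral_eq_integral) (auto simp: integrable_indicator_mult[OF f_int])
  also have "(\<integral>x. real n * (indicator A x * f x) \<partial>lborel) = real n * mass f A"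
    unfolding mass_def by (rule integral_mult_right_zero)
  finally show ?thesis .
qed

lemma count_poisson:
  assumes "A \<in> sets borel"
  shows "poisson_count M (point_count N A) (real n * mass f A)"
proof -
  have "measure (density lborel (\<lambda>x. ennreal (real n * f x))) A = real n * mass f A"
    using emeasure_intensity[OF assms] mass_nonneg[of f A] f_nonneg by (simp add: measure_def)
  with process emeasure_intensity[OF assms] assms mass_nonneg[of f A] f_nonneg show ?thesis
    by (auto simp: poisson_count_def poisson_intensity_def poisson_process_def)
qed

text \<open>The total count is Poisson with finite mean. On this event all sums over the points are finite
  sums.\<close>

lemma AE_finite_points: "AE \<omega> in M. finite (N \<omega>)"
  using poisson_count_AE_nat[OF count_poisson[of UNIV, simplified]]
proof eventually_elim
  case (elim \<omega>)
  then obtain k :: nat where "emeasure (count_space UNIV) (N \<omega>) = of_nat k"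
    by (auto simp: point_count_def)
  then show ?case
    by (cases "finite (N \<omega>)") (auto simp: emeasure_count_space)
qed

text \<open>The definition of a Poisson process speaks about families indexed by natural numbers; level sets
  are indexed by values.\<close>

lemma counts_independent:
  assumes "finite I" "\<And>i. i \<in> I \<Longrightarrow> A i \<in> sets borel" "disjoint_family_on A (I :: 'i set)"
  shows "indep_vars (\<lambda>_. borel) (\<lambda>i. point_count N (A i)) I"
proof -
  obtain h :: "'i \<Rightarrow> nat" where h: "inj_on h I"
    using assms(1) by (meson finite_imp_inj_to_nat_seg)
  define A' where "A' = (\<lambda>k. A (the_inv_into I h k))"
  have A': "A' (h i) = A i" if "i \<in> I" for i using that h by (simp add: A'_def the_inv_into_f_f)
  have "indep_vars (\<lambda>_. borel) (\<lambda>k. point_count N (A' k)) (h ` I)"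
  proof -
    have "finite (h ` I)" "A' ` (h ` I) \<subseteq> sets (density lborel (\<lambda>x. ennreal (real n * f x)))"
      using assms A' by auto
    moreover have "disjoint_family_on A' (h ` I)"
      unfolding disjoint_family_on_def
    proof (intro ballI impI)
      fix p q assume "p \<in> h ` I" "q \<in> h ` I" "p \<noteq> q"
      then obtain i k where "i \<in> I" "k \<in> I" "p = h i" "q = h k" "i \<noteq> k" by auto
      then show "A' p \<inter> A' q = {}" using assms(3) A' by (simp add: disjoint_family_on_def)
    qed
    ultimately show ?thesis
      using process unfolding poisson_intensity_def poisson_process_def by blast
  qed
  from indep_vars_reindex[OF h this]
  have "indep_vars (\<lambda>_. borel) (\<lambda>i. point_count N (A' (h i))) I" .
  then show ?thesis using A' by (subst indep_vars_cong[where Y = "\<lambda>i. point_count N (A' (h i))"]) auto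
qed

end

context wavelet_basis
begin

text \<open>The only values besides the scaled ones of \<open>\<psi>\<close> are those of \<^const>\<open>\<phi>\<close>.\<close>

lemma finite_range_wav: "finite (range (wav \<phi> \<psi> l))"
proof -
  obtain j k where jk: "l = (j, k)" by (cases l)
  have "range (wav \<phi> \<psi> l) \<subseteq> {0, 1} \<union> (\<lambda>y. 2 powr (of_int j / 2) * y) ` range \<psi>"
    by (auto simp: jk wav_def \<phi>_def indicator_def)
  then show ?thesis by (rule finite_subset) (simp add: \<psi>_finite)
qed

lemma sup_norm_wav_pos:
  assumes "l \<in> \<Lambda>"
  shows "0 < sup_norm (wav \<phi> \<psi> l)"
proof (rule ccontr)
  assume "\<not> 0 < sup_norm (wav \<phi> \<psi> l)"
  then have "wav \<phi> \<psi> l x = 0" for x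
    using sup_norm_bound[OF test_analysis[OF assms], of x] by simp
  then show False using biorthogonal[OF assms assms] by simp
qed

end

context poisson_observation
begin

text \<open>The counts on the level sets of the analysis function form a \<open>poisson_family\<close> whose
  statistics are those of the estimator times \<open>n\<close> or \<open>n\<^sup>2\<close>. The random error agrees almost surely
  with a measurable function \<open>g\<close>, and this form is needed to integrate the series of all errors.\<close>

theorem coefficient_risk:
  assumes basis: "wavelet_basis \<psi> \<phi>' \<psi>'" and l: "l \<in> \<Lambda>" "l \<in> \<Gamma>" and "1 \<le> c" "c < \<gamma>"
  defines "b \<equiv> sup_norm (wav \<phi> \<psi> l)" and "F \<equiv> mass f {x. wav \<phi> \<psi> l x \<noteq> 0}" and "\<beta> \<equiv> coef \<psi> f l"
  shows "\<exists>g \<in> borel_measurable M.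
    (AE \<omega> in M. ennreal ((coef_tilde \<psi> \<gamma> n \<Gamma> (N \<omega>) l - \<beta>)\<^sup>2) = g \<omega>) \<and>
    (\<integral>\<^sup>+\<omega>. g \<omega> \<partial>M) \<le> ennreal (risk_constant \<gamma> c *
      (min (\<beta>\<^sup>2) (b\<^sup>2 * F * ln (real n) / real n) + (\<beta>\<^sup>2 + b\<^sup>2 * F / real n) * real n powr (- c)))"
proof -
  interpret wavelet_basis \<psi> \<phi>' \<psi>' by (fact basis)
  let ?w = "wav \<phi> \<psi> l"
  let ?I = "range ?w - {0}"
  note fin = finite_range_wav[of l]
  have [measurable]: "?w \<in> borel_measurable borel" using test_analysis[OF l(1)] by (simp add: test_function_def)
  have meas: "?w -` {y} \<in> sets borel" for y
    using measurable_sets[of ?w borel borel "{y}"] by simp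
  define m where "m = (\<lambda>y. real n * mass f (?w -` {y}))"
  interpret P: poisson_family M ?I "\<lambda>y. point_count N (?w -` {y})" m "\<lambda>y. y" b
  proof unfold_locales
    show "finite ?I" using fin by simp
    show "indep_vars (\<lambda>_. borel) (\<lambda>y. point_count N (?w -` {y})) ?I"
      by (rule counts_independent) (use fin meas in \<open>auto simp: disjoint_family_on_def\<close>)
    show "poisson_count M (point_count N (?w -` {y})) (m y)" for y
      unfolding m_def by (rule count_poisson[OF meas])
    show "\<bar>y\<bar> \<le> b" if "y \<in> ?I" for y
      using that sup_norm_bound[OF test_analysis[OF l(1)]] by (auto simp: b_def)
    show "0 < b" unfolding b_def by (rule sup_norm_wav_pos[OF l(1)])
  qed
  have int: "integrable lborel (\<lambda>x. indicator (?w -` {y}) x * f x)" for y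
    by (rule integrable_indicator_mult[OF f_int meas])
  have s: "P.s = real n * \<beta>"
  proof -
    have "\<beta> = (\<integral>x. (\<Sum>y\<in>?I. y * (indicator (?w -` {y}) x * f x)) \<partial>lborel)"
      unfolding \<beta>_def coef_def
      by (subst (1) finite_range_level_decomposition(1)[OF fin]) (simp add: sum_distrib_right mult.assoc)
    also have "\<dots> = (\<Sum>y\<in>?I. y * mass f (?w -` {y}))"
      unfolding mass_def using int by (subst Bochner_Integration.integral_sum) auto
    finally show ?thesis unfolding P.s_def by (simp add: m_def sum_distrib_left mult_ac)
  qed
  have \<mu>: "P.\<mu> = real n * F"
  proof -
    have "F = (\<integral>x. (\<Sum>y\<in>?I. indicator (?w -` {y}) x * f x) \<partial>lborel)"
      unfolding F_def mass_def
      by (subst finite_range_level_decomposition(2)[OF fin]) (simp add: sum_distrib_right)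
    also have "\<dots> = (\<Sum>y\<in>?I. mass f (?w -` {y}))"
      unfolding mass_def using int by (subst Bochner_Integration.integral_sum) auto
    finally show ?thesis unfolding P.\<mu>_def by (simp add: m_def sum_distrib_left)
  qed
  let ?L = "ln (real n)"
  have n: "0 < real n" using n_pos by simp
  have L0: "0 \<le> ?L" using n_pos by simp
  have est: "coef_tilde \<psi> \<gamma> n \<Gamma> (N \<omega>) l = P.thresholded \<gamma> ?L \<omega> / real n" if "finite (N \<omega>)" for \<omega>
  proof -
    have S: "P.S \<omega> = real n * coef_hat \<psi> n (N \<omega>) l"
      using sum_over_points_eq_sum_over_values[OF that fin, of "\<lambda>y. y"] that n
      by (simp add: P.S_def coef_hat_def point_count_def)
    have W: "P.W \<omega> = (real n)\<^sup>2 * V_hat \<psi> n (N \<omega>) l"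
      using sum_over_points_eq_sum_over_values[OF that fin, of "\<lambda>y. y\<^sup>2"] that n
      by (simp add: P.W_def V_hat_def point_count_def)
    let ?V = "V_hat \<psi> n (N \<omega>) l"
    have "sqrt (2 * \<gamma> * ?L * P.W \<omega> * b\<^sup>2) = (real n)\<^sup>2 * sqrt (2 * \<gamma> * ?L * ?V * (b\<^sup>2 / (real n)\<^sup>2))"
    proof -
      have "2 * \<gamma> * ?L * P.W \<omega> * b\<^sup>2 = ((real n)\<^sup>2)\<^sup>2 * (2 * \<gamma> * ?L * ?V * (b\<^sup>2 / (real n)\<^sup>2))"
        using n by (simp add: W field_simps power2_eq_square)
      then have "sqrt (2 * \<gamma> * ?L * P.W \<omega> * b\<^sup>2)
          = sqrt (((real n)\<^sup>2)\<^sup>2) * sqrt (2 * \<gamma> * ?L * ?V * (b\<^sup>2 / (real n)\<^sup>2))"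
        by (metis real_sqrt_mult)
      then show ?thesis unfolding real_sqrt_abs abs_power2 .
    qed
    then have "P.W \<omega> + sqrt (2 * \<gamma> * ?L * P.W \<omega> * b\<^sup>2) + 3 * \<gamma> * ?L * b\<^sup>2
        = (real n)\<^sup>2 * V_tilde \<psi> \<gamma> n (N \<omega>) l"
      using n by (simp add: V_tilde_def W b_def[symmetric] distrib_left)
    then have "2 * \<gamma> * ?L * (P.W \<omega> + sqrt (2 * \<gamma> * ?L * P.W \<omega> * b\<^sup>2) + 3 * \<gamma> * ?L * b\<^sup>2)
        = (real n)\<^sup>2 * (2 * \<gamma> * V_tilde \<psi> \<gamma> n (N \<omega>) l * ?L)" by (simp add: mult_ac)
    then have T: "P.T \<gamma> ?L \<omega> = real n * threshold \<psi> \<gamma> n (N \<omega>) l"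
      using n by (simp add: P.T_def threshold_def b_def[symmetric] real_sqrt_mult distrib_left)
    show ?thesis using n l(2)
      by (simp add: P.thresholded_def coef_tilde_def S T abs_mult)
  qed
  define g where "g = (\<lambda>\<omega>. ennreal (1 / (real n)\<^sup>2) * ennreal ((P.thresholded \<gamma> ?L \<omega> - P.s)\<^sup>2))"
  have 1: "g \<in> borel_measurable M" unfolding g_def by measurable
  have 2: "AE \<omega> in M. ennreal ((coef_tilde \<psi> \<gamma> n \<Gamma> (N \<omega>) l - \<beta>)\<^sup>2) = g \<omega>"
    using AE_finite_points
  proof eventually_elim
    case (elim \<omega>)
    have "coef_tilde \<psi> \<gamma> n \<Gamma> (N \<omega>) l - \<beta> = (P.thresholded \<gamma> ?L \<omega> - P.s) / real n"
      using n by (simp add: est[OF elim] s field_simps)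
    then show ?case by (simp add: g_def ennreal_mult'[symmetric] power_divide)
  qed
  have "(\<integral>\<^sup>+\<omega>. g \<omega> \<partial>M) = ennreal (1 / (real n)\<^sup>2) * (\<integral>\<^sup>+\<omega>. ennreal ((P.thresholded \<gamma> ?L \<omega> - P.s)\<^sup>2) \<partial>M)"
    unfolding g_def by (rule nn_integral_cmult) measurable
  also have "\<dots> \<le> ennreal (1 / (real n)\<^sup>2) * ennreal (risk_constant \<gamma> c *
      (min (P.s\<^sup>2) (b\<^sup>2 * P.\<mu> * ?L) + (P.s\<^sup>2 + b\<^sup>2 * P.\<mu>) * exp (- (c * ?L))))"
    by (intro mult_left_mono P.thresholded_risk assms L0) simp
  also have "\<dots> = ennreal (1 / (real n)\<^sup>2 * (risk_constant \<gamma> c *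
      (min (P.s\<^sup>2) (b\<^sup>2 * P.\<mu> * ?L) + (P.s\<^sup>2 + b\<^sup>2 * P.\<mu>) * exp (- (c * ?L)))))"
    by (rule ennreal_mult'[symmetric]) simp
  also have "1 / (real n)\<^sup>2 * (risk_constant \<gamma> c *
      (min (P.s\<^sup>2) (b\<^sup>2 * P.\<mu> * ?L) + (P.s\<^sup>2 + b\<^sup>2 * P.\<mu>) * exp (- (c * ?L))))
      = risk_constant \<gamma> c * (min (\<beta>\<^sup>2) (b\<^sup>2 * F * ?L / real n) + (\<beta>\<^sup>2 + b\<^sup>2 * F / real n) * real n powr (- c))"
  proof -
    have "exp (- (c * ?L)) = real n powr (- c)" using n by (simp add: powr_def)
    moreover have "min (P.s\<^sup>2) (b\<^sup>2 * P.\<mu> * ?L) = (real n)\<^sup>2 * min (\<beta>\<^sup>2) (b\<^sup>2 * F * ?L / real n)"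
    proof -
      have "P.s\<^sup>2 = (real n)\<^sup>2 * \<beta>\<^sup>2" "b\<^sup>2 * P.\<mu> * ?L = (real n)\<^sup>2 * (b\<^sup>2 * F * ?L / real n)"
        using n by (simp_all add: s \<mu> power_mult_distrib power2_eq_square)
      then show ?thesis using n by (simp add: min_mult_distrib_left)
    qed
    moreover have "P.s\<^sup>2 + b\<^sup>2 * P.\<mu> = (real n)\<^sup>2 * (\<beta>\<^sup>2 + b\<^sup>2 * F / real n)"
      using n by (simp add: s \<mu> power_mult_distrib distrib_left power2_eq_square)
    ultimately have "min (P.s\<^sup>2) (b\<^sup>2 * P.\<mu> * ?L) + (P.s\<^sup>2 + b\<^sup>2 * P.\<mu>) * exp (- (c * ?L))
        = (real n)\<^sup>2 * (min (\<beta>\<^sup>2) (b\<^sup>2 * F * ?L / real n) + (\<beta>\<^sup>2 + b\<^sup>2 * F / real n) * real n powr (- c))"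
      by (simp add: distrib_left mult.assoc)
    then show ?thesis using n by simp
  qed
  finally show ?thesis using 1 2 by blast
qed

text \<open>Monotone convergence along an enumeration of the index set. The terms \<open>e i\<close> need only be
  almost surely equal to measurable ones.\<close>

lemma nn_integral_infsum_le:
  fixes e :: "'i::countable \<Rightarrow> 'w \<Rightarrow> ennreal"
  assumes A: "infinite A"
    and g: "\<And>i. i \<in> A \<Longrightarrow> g i \<in> borel_measurable M" "\<And>i. i \<in> A \<Longrightarrow> AE \<omega> in M. e i \<omega> = g i \<omega>"
    and le: "\<And>F. finite F \<Longrightarrow> F \<subseteq> A \<Longrightarrow> (\<Sum>i\<in>F. \<integral>\<^sup>+\<omega>. g i \<omega> \<partial>M) \<le> B"
  shows "(\<integral>\<^sup>+\<omega>. C * (\<Sum>\<^sub>\<infinity>i\<in>A. e i \<omega>) \<partial>M) \<le> C * B"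
proof -
  define h where "h = from_nat_into A"
  have h: "bij_betw h UNIV A"
    unfolding h_def by (rule bij_betw_from_nat_into[OF countableI_type A])
  then have hA: "h k \<in> A" for k by (auto simp: bij_betw_def)
  have infsum_eq: "(\<Sum>\<^sub>\<infinity>i\<in>A. x i) = (\<Sum>k. x (h k))" for x :: "'i \<Rightarrow> ennreal"
  proof -
    have "(\<Sum>\<^sub>\<infinity>i\<in>A. x i) = (\<Sum>\<^sub>\<infinity>k. x (h k))"
      by (rule infsum_reindex_bij_betw[OF h, symmetric])
    moreover have "((\<lambda>k. x (h k)) has_sum (\<Sum>\<^sub>\<infinity>k. x (h k))) UNIV"
      by (intro has_sum_infsum nonneg_summable_on_complete) simp
    ultimately show ?thesis using has_sum_imp_sums sums_unique by metis
  qed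
  have "AE \<omega> in M. \<forall>k. e (h k) \<omega> = g (h k) \<omega>"
    using g(2)[OF hA] by (simp add: AE_all_countable)
  then have "(\<integral>\<^sup>+\<omega>. C * (\<Sum>\<^sub>\<infinity>i\<in>A. e i \<omega>) \<partial>M) = (\<integral>\<^sup>+\<omega>. C * (\<Sum>k. g (h k) \<omega>) \<partial>M)"
    by (intro nn_integral_cong_AE) (auto simp: infsum_eq)
  also have "\<dots> = C * (\<integral>\<^sup>+\<omega>. (\<Sum>k. g (h k) \<omega>) \<partial>M)"
    using g(1)[OF hA] by (intro nn_integral_cmult) measurable
  also have "(\<integral>\<^sup>+\<omega>. (\<Sum>k. g (h k) \<omega>) \<partial>M) = (\<Sum>k. \<integral>\<^sup>+\<omega>. g (h k) \<omega> \<partial>M)"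
    by (rule nn_integral_suminf[OF g(1)[OF hA]])
  also have "C * (\<Sum>k. \<integral>\<^sup>+\<omega>. g (h k) \<omega> \<partial>M) \<le> C * B"
  proof (intro mult_left_mono suminf_le_const)
    fix k
    have "inj_on h {..<k}" using h by (auto simp: bij_betw_def inj_on_def)
    then have "(\<Sum>i<k. \<integral>\<^sup>+\<omega>. g (h i) \<omega> \<partial>M) = (\<Sum>i\<in>h ` {..<k}. \<integral>\<^sup>+\<omega>. g i \<omega> \<partial>M)"
      by (simp add: sum.reindex)
    also have "\<dots> \<le> B" using hA by (intro le) auto
    finally show "(\<Sum>i<k. \<integral>\<^sup>+\<omega>. g (h i) \<omega> \<partial>M) \<le> B" .
  qed simp_all
  finally show ?thesis .
qed

end

section \<open>Coefficients level by level\<close>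

context wavelet_basis
begin

text \<open>A point lies in the support for \<open>k\<close> only if \<open>k\<close> is within \<open>A\<close> of a fixed real number.\<close>

lemma card_overlap:
  assumes A: "1 \<le> A" "\<And>x. \<psi> x \<noteq> 0 \<Longrightarrow> \<bar>x\<bar> \<le> A" and "-1 \<le> j" "finite I"
  shows "(\<Sum>k\<in>I. indicator {x. wav \<phi> \<psi> (j, k) x \<noteq> 0} x) \<le> 2 * A + 1"
proof -
  let ?N = "{k. \<bar>2 powr of_int (max j 0) * x - of_int k\<bar> \<le> A}"
  have "wav \<phi> \<psi> (j, k) x \<noteq> 0 \<Longrightarrow> k \<in> ?N" for k
    using wav_support[of \<phi> A \<psi> j k x] A assms(3)
    by (auto simp: \<phi>_def indicator_def split: if_splits)
  then have "(\<Sum>k\<in>I. indicator {x. wav \<phi> \<psi> (j, k) x \<noteq> 0} x) \<le> (\<Sum>k\<in>I. if k \<in> ?N then 1 else (0::real))"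
    by (intro sum_mono) (auto simp: indicator_def)
  also have "\<dots> = real (card (I \<inter> ?N))" using assms(4) by (simp add: sum.If_cases)
  also have "\<dots> \<le> real (card ?N)"
    using card_mono[OF finite_int_near, of "I \<inter> ?N"] by simp
  also have "\<dots> \<le> 2 * A + 1" using A by (intro card_int_near) auto
  finally show ?thesis .
qed

lemma sum_mass_level:
  assumes A: "1 \<le> A" "\<And>x. \<psi> x \<noteq> 0 \<Longrightarrow> \<bar>x\<bar> \<le> A" and j: "-1 \<le> j" "finite I"
    and f: "integrable lborel f" "\<And>x. 0 \<le> f x"
  shows "(\<Sum>k\<in>I. mass f {x. wav \<phi> \<psi> (j, k) x \<noteq> 0}) \<le> (2 * A + 1) * (\<integral>x. f x \<partial>lborel)"
proof -
  have int: "integrable lborel (\<lambda>x. indicator {x. wav \<phi> \<psi> (j, k) x \<noteq> 0} x * f x)" for k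
  proof (rule integrable_indicator_mult[OF f(1)])
    have "(j, k) \<in> \<Lambda>" using j by (simp add: \<Lambda>_def)
    then have [measurable]: "wav \<phi> \<psi> (j, k) \<in> borel_measurable borel"
      using test_analysis by (simp add: test_function_def)
    show "{x. wav \<phi> \<psi> (j, k) x \<noteq> 0} \<in> sets borel" by measurable
  qed
  have "(\<Sum>k\<in>I. mass f {x. wav \<phi> \<psi> (j, k) x \<noteq> 0})
      = (\<integral>x. (\<Sum>k\<in>I. indicator {x. wav \<phi> \<psi> (j, k) x \<noteq> 0} x) * f x \<partial>lborel)"
    unfolding mass_def using int
    by (subst Bochner_Integration.integral_sum[symmetric]) (simp_all add: sum_distrib_right)
  also have "\<dots> \<le> (\<integral>x. (2 * A + 1) * f x \<partial>lborel)"
  proof (rule integral_mono)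
    show "integrable lborel (\<lambda>x. (\<Sum>k\<in>I. indicator {x. wav \<phi> \<psi> (j, k) x \<noteq> 0} x) * f x)"
      using int by (simp add: sum_distrib_right)
    show "(\<Sum>k\<in>I. indicator {x. wav \<phi> \<psi> (j, k) x \<noteq> 0} x) * f x \<le> (2 * A + 1) * f x" for x
      by (intro mult_right_mono card_overlap A j f)
  qed (simp add: f)
  also have "\<dots> = (2 * A + 1) * (\<integral>x. f x \<partial>lborel)" by (rule integral_mult_right_zero)
  finally show ?thesis .
qed

text \<open>Numbering the levels by \<open>i = j + 1\<close> puts the father functions at \<open>i = 0\<close> and gives one bound for
  all levels.\<close>

lemma sup_norm_level:
  assumes B: "1 \<le> B" "\<And>x. \<bar>\<psi> x\<bar> \<le> B"
  shows "(sup_norm (wav \<phi> \<psi> (int i - 1, k)))\<^sup>2 \<le> B\<^sup>2 * 2 ^ i"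
proof -
  have "\<bar>wav \<phi> \<psi> (int i - 1, k) x\<bar> \<le> B * 2 powr (real i / 2)" for x
  proof (cases i)
    case 0
    have "\<bar>\<phi> y\<bar> \<le> B" for y using B(1) by (simp add: \<phi>_def indicator_def)
    then show ?thesis using 0 by (simp add: wav_def)
  next
    case (Suc i')
    have "2 powr (real i' / 2) * \<bar>\<psi> (2 powr real i' * x - of_int k)\<bar> \<le> 2 powr (real i / 2) * B"
      using B Suc by (intro mult_mono) auto
    then show ?thesis using Suc by (simp add: wav_def abs_mult mult_ac)
  qed
  then have "sup_norm (wav \<phi> \<psi> (int i - 1, k)) \<le> B * 2 powr (real i / 2)"
    unfolding sup_norm_def by (intro cSUP_least) auto
  moreover have "0 \<le> sup_norm (wav \<phi> \<psi> (int i - 1, k))"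
    using sup_norm_bound[OF test_analysis[of "(int i - 1, k)"], of 0] by (simp add: \<Lambda>_def)
  ultimately have "(sup_norm (wav \<phi> \<psi> (int i - 1, k)))\<^sup>2 \<le> (B * 2 powr (real i / 2))\<^sup>2"
    by (intro power_mono)
  also have "\<dots> = B\<^sup>2 * 2 ^ i"
    by (simp add: power_mult_distrib power2_eq_square powr_add[symmetric] powr_realpow)
  finally show ?thesis .
qed

lemma coef_le_sup_norm_mass:
  assumes l: "l \<in> \<Lambda>" and f: "integrable lborel f" "\<And>x. 0 \<le> f x"
  shows "\<bar>coef \<psi> f l\<bar> \<le> sup_norm (wav \<phi> \<psi> l) * mass f {x. wav \<phi> \<psi> l x \<noteq> 0}"
proof -
  let ?w = "wav \<phi> \<psi> l" and ?A = "{x. wav \<phi> \<psi> l x \<noteq> 0}"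
  have [measurable]: "?w \<in> borel_measurable borel" using test_analysis[OF l] by (simp add: test_function_def)
  have int: "integrable lborel (\<lambda>x. indicator ?A x * f x)"
    by (rule integrable_indicator_mult[OF f(1)]) measurable
  have int': "integrable lborel (\<lambda>x. ?w x * f x)"
    by (rule test_function_integrable_mult[OF test_analysis[OF l] f(1)])
  have "\<bar>coef \<psi> f l\<bar> \<le> (\<integral>x. \<bar>?w x * f x\<bar> \<partial>lborel)" unfolding coef_def by (rule integral_abs_bound)
  also have "\<dots> \<le> (\<integral>x. sup_norm ?w * (indicator ?A x * f x) \<partial>lborel)"
  proof (rule integral_mono)
    show "\<bar>?w x * f x\<bar> \<le> sup_norm ?w * (indicator ?A x * f x)" for x
      using sup_norm_bound[OF test_analysis[OF l], of x] f(2)[of x]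
      by (auto simp: indicator_def abs_mult intro: mult_right_mono)
  qed (use int int' in simp_all)
  also have "\<dots> = sup_norm ?w * mass f ?A" unfolding mass_def by (rule integral_mult_right_zero)
  finally show ?thesis .
qed

end

text \<open>Entries below \<open>t\<close> are charged to the \<open>l\<^sub>1\<close> norm, the others to the \<open>l\<^sub>p\<close> norm; \<open>p > 2\<close> makes the
  power \<open>2 - p\<close> negative.\<close>

lemma sum_squares_interpolation:
  fixes x :: "'i \<Rightarrow> real"
  assumes "2 < p" "0 < t"
  shows "(\<Sum>k\<in>I. (x k)\<^sup>2) \<le> t * (\<Sum>k\<in>I. \<bar>x k\<bar>) + t powr (2 - p) * (\<Sum>k\<in>I. \<bar>x k\<bar> powr p)"
proof -
  have "(x k)\<^sup>2 \<le> t * \<bar>x k\<bar> + t powr (2 - p) * \<bar>x k\<bar> powr p" for k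
  proof (cases "\<bar>x k\<bar> \<le> t")
    case True
    then have "\<bar>x k\<bar> * \<bar>x k\<bar> \<le> t * \<bar>x k\<bar>" by (intro mult_right_mono) auto
    moreover have "0 \<le> t powr (2 - p) * \<bar>x k\<bar> powr p" by simp
    moreover have "(x k)\<^sup>2 = \<bar>x k\<bar> * \<bar>x k\<bar>" by (simp add: power2_eq_square)
    ultimately show ?thesis by linarith
  next
    case False
    then have "\<bar>x k\<bar> powr (2 - p) \<le> t powr (2 - p)"
      using assms by (intro powr_mono2') auto
    then have "\<bar>x k\<bar> powr (2 - p) * \<bar>x k\<bar> powr p \<le> t powr (2 - p) * \<bar>x k\<bar> powr p"
      by (intro mult_right_mono) auto
    moreover have "\<bar>x k\<bar> powr (2 - p) * \<bar>x k\<bar> powr p = (x k)\<^sup>2"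
      using False \<open>0 < t\<close> by (simp add: powr_add[symmetric] powr_numeral)
    moreover have "0 \<le> t * \<bar>x k\<bar>" using assms by simp
    ultimately show ?thesis by linarith
  qed
  then have "(\<Sum>k\<in>I. (x k)\<^sup>2) \<le> (\<Sum>k\<in>I. t * \<bar>x k\<bar> + t powr (2 - p) * \<bar>x k\<bar> powr p)" by (rule sum_mono)
  then show ?thesis by (simp add: sum.distrib sum_distrib_left)
qed

lemma epowr_mono: "0 \<le> a \<Longrightarrow> x \<le> y \<Longrightarrow> epowr x a \<le> epowr y a"
  by (auto simp: epowr_def top_unique intro!: ennreal_leI powr_mono2 enn2real_mono less_top[THEN iffD1])

lemma epowr_epowr_inverse: "0 < a \<Longrightarrow> epowr (epowr x a) (1 / a) = x"
  by (auto simp: epowr_def powr_powr enn2real_nonneg ennreal_enn2real less_top)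

lemma infsum_ge_sum_ennreal:
  fixes g :: "'i \<Rightarrow> ennreal"
  assumes "finite F" "F \<subseteq> A"
  shows "sum g F \<le> infsum g A"
  by (subst nonneg_infsum_complete) (use assms in \<open>auto intro!: SUP_upper\<close>)

text \<open>Each level is controlled by the Besov norm whatever \<open>q\<close> is, so the constants do not depend on
  \<open>q\<close>.\<close>

lemma seq_norm_ge:
  assumes "1 \<le> q"
  shows "a i \<le> seq_norm q a"
proof (cases "q = \<infinity>")
  case True
  then show ?thesis by (simp add: seq_norm_def SUP_upper)
next
  case False
  define r where "r = enn2real q"
  have "0 < r" using assms False by (auto simp: r_def enn2real_positive_iff less_top[symmetric] intro: less_le_trans[of 0 1])
  have "a i = epowr (epowr (a i) r) (1 / r)" using \<open>0 < r\<close> by (simp add: epowr_epowr_inverse)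
  also have "\<dots> \<le> epowr (\<Sum>\<^sub>\<infinity>i. epowr (a i) r) (1 / r)"
    using infsum_ge_sum_ennreal[of "{i}" UNIV "\<lambda>i. epowr (a i) r"] \<open>0 < r\<close> by (intro epowr_mono) auto
  finally show ?thesis using False by (simp add: seq_norm_def r_def)
qed

lemma seq_norm_top_bound:
  assumes "seq_norm \<infinity> (\<lambda>k. ennreal \<bar>x k\<bar>) \<le> ennreal B" "0 \<le> B"
  shows "\<bar>x k\<bar> \<le> B"
proof -
  have "ennreal \<bar>x k\<bar> \<le> ennreal B"
    using seq_norm_ge[of \<infinity> "\<lambda>k. ennreal \<bar>x k\<bar>" k] assms(1) by (simp add: order.trans)
  then show ?thesis using assms(2) by simp
qed

lemma seq_norm_finite_bound:
  assumes "seq_norm p (\<lambda>k. ennreal \<bar>x k\<bar>) \<le> ennreal B" "0 \<le> B" "1 \<le> p" "p \<noteq> \<infinity>" "finite I"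
  shows "(\<Sum>k\<in>I. \<bar>x k\<bar> powr enn2real p) \<le> B powr enn2real p"
proof -
  define r where "r = enn2real p"
  have "0 < r" using assms by (auto simp: r_def enn2real_positive_iff less_top[symmetric] intro: less_le_trans[of 0 1])
  let ?s = "\<Sum>\<^sub>\<infinity>k. epowr (ennreal \<bar>x k\<bar>) r"
  have "epowr ?s (1 / r) \<le> ennreal B" using assms by (simp add: seq_norm_def r_def)
  then have "epowr (epowr ?s (1 / r)) r \<le> epowr (ennreal B) r" using \<open>0 < r\<close> by (intro epowr_mono) auto
  moreover have "epowr (epowr ?s (1 / r)) r = ?s" using epowr_epowr_inverse[of "1 / r" ?s] \<open>0 < r\<close> by simp
  ultimately have "?s \<le> ennreal (B powr r)" using assms(2) by (simp add: epowr_def)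
  moreover have "(\<Sum>k\<in>I. ennreal (\<bar>x k\<bar> powr r)) \<le> ?s"
    using infsum_ge_sum_ennreal[OF assms(5), of UNIV "\<lambda>k. epowr (ennreal \<bar>x k\<bar>) r"] by (simp add: epowr_def)
  ultimately have "(\<Sum>k\<in>I. ennreal (\<bar>x k\<bar> powr r)) \<le> ennreal (B powr r)" by (rule order.trans[rotated])
  then have "ennreal (\<Sum>k\<in>I. \<bar>x k\<bar> powr r) \<le> ennreal (B powr r)" by (simp add: sum_ennreal)
  then show ?thesis by (simp add: r_def)
qed

lemma finite_exponent:
  fixes p :: ennreal
  assumes "2 < p" "p \<noteq> \<infinity>"
  shows "2 < enn2real p" and "enn2real (1 / p) = 1 / enn2real p"
proof -
  have pP: "p = ennreal (enn2real p)" using assms by (simp add: less_top)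
  show P: "2 < enn2real p"
    using assms(1) by (subst (asm) pP) (simp add: ennreal_numeral[symmetric] ennreal_less_iff del: ennreal_numeral)
  have "1 / p = ennreal (1 / enn2real p)"
    using P by (subst pP) (simp add: divide_ennreal[symmetric])
  then show "enn2real (1 / p) = 1 / enn2real p" by simp
qed

text \<open>The truncation \<open>t = 2 powr (- (\<rho> + 1/2) * j)\<close> balances the two parts of
  \<open>sum_squares_interpolation\<close> for the \<open>l\<^sub>1\<close> bound \<open>G * 2 powr (j / 2)\<close> and the \<open>l\<^sub>p\<close> bound of the
  Besov ball. For \<open>p = \<infinity>\<close> the largest entry takes the role of \<open>t\<close>.\<close>

lemma besov_level_sum:
  fixes \<alpha> R G :: real and p q :: ennreal and \<psi> f :: "real \<Rightarrow> real"
  defines "\<rho> \<equiv> \<alpha> / (1 - enn2real (1 / p))"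
  assumes "2 < p" "1 \<le> q" "0 < R" "0 \<le> G" and f: "f \<in> besov_ball \<psi> \<alpha> p q R" and "finite I"
    and G: "(\<Sum>k\<in>I. \<bar>coef \<psi> f (int j, k)\<bar>) \<le> G * 2 powr (real j / 2)"
  shows "(\<Sum>k\<in>I. (coef \<psi> f (int j, k))\<^sup>2) \<le> (G + R powr enn2real p + R * G) * 2 powr (- \<rho> * real j)"
proof -
  define e where "e = \<alpha> + 1/2 - enn2real (1 / p)"
  let ?x = "\<lambda>k. coef \<psi> f (int j, k)"
  let ?s = "seq_norm p (\<lambda>k. ennreal \<bar>?x k\<bar>)"
  define B where "B = R * 2 powr (- (real j * e))"
  have "0 \<le> B" using assms by (simp add: B_def)
  have "1 < p" using \<open>2 < p\<close> by (rule less_trans[rotated]) simp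
  have "ennreal (2 powr (real j * e)) * ?s \<le> ennreal R"
  proof -
    have "ennreal (2 powr (real j * e)) * ?s
        \<le> seq_norm q (\<lambda>j::nat. ennreal (2 powr (real j * e)) * seq_norm p (\<lambda>k. ennreal \<bar>coef \<psi> f (int j, k)\<bar>))"
      by (rule seq_norm_ge[OF \<open>1 \<le> q\<close>])
    also have "\<dots> \<le> besov_norm \<psi> \<alpha> p q f"
      unfolding besov_norm_def e_def by simp
    also have "\<dots> \<le> ennreal R" using f by (simp add: besov_ball_def)
    finally show ?thesis .
  qed
  then have "ennreal (2 powr (- (real j * e))) * (ennreal (2 powr (real j * e)) * ?s)
      \<le> ennreal (2 powr (- (real j * e))) * ennreal R"
    by (rule mult_left_mono) simp
  moreover have "ennreal (2 powr (- (real j * e))) * ennreal (2 powr (real j * e)) = 1"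
    by (simp add: ennreal_mult[symmetric] powr_add[symmetric])
  ultimately have s: "?s \<le> ennreal B"
    using \<open>0 < R\<close> by (simp add: mult.assoc[symmetric] ennreal_mult'[symmetric] B_def mult.commute)
  show ?thesis
  proof (cases "p = \<infinity>")
    case True
    have B: "\<bar>?x k\<bar> \<le> B" for k using s \<open>0 \<le> B\<close> unfolding True by (rule seq_norm_top_bound)
    have \<rho>: "\<rho> = \<alpha>" and e: "e = \<alpha> + 1 / 2" using True by (simp_all add: \<rho>_def e_def)
    have "(\<Sum>k\<in>I. (?x k)\<^sup>2) \<le> (\<Sum>k\<in>I. B * \<bar>?x k\<bar>)"
    proof (rule sum_mono)
      fix k
      have "\<bar>?x k\<bar> * \<bar>?x k\<bar> \<le> B * \<bar>?x k\<bar>" using B by (intro mult_right_mono) auto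
      then show "(?x k)\<^sup>2 \<le> B * \<bar>?x k\<bar>" by (simp add: power2_eq_square)
    qed
    also have "\<dots> \<le> B * (G * 2 powr (real j / 2))"
      using G \<open>0 \<le> B\<close> by (simp add: sum_distrib_left[symmetric] mult_left_mono)
    also have "\<dots> = R * G * (2 powr (- (real j * e)) * 2 powr (real j / 2))" by (simp add: B_def)
    also have "\<dots> = R * G * 2 powr (- \<rho> * real j)"
      by (simp add: powr_add[symmetric] \<rho> e algebra_simps)
    also have "\<dots> \<le> (G + R powr enn2real p + R * G) * 2 powr (- \<rho> * real j)"
      using assms by (intro mult_right_mono) auto
    finally show ?thesis .
  next
    case False
    define P where "P = enn2real p"
    have "2 < P" and ip: "enn2real (1 / p) = 1 / P"
      unfolding P_def using \<open>2 < p\<close> False by (rule finite_exponent)+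
    have \<rho>: "\<rho> * (P - 1) = \<alpha> * P" using \<open>2 < P\<close> by (simp add: \<rho>_def ip field_simps)
    define t where "t = 2 powr (- ((\<rho> + 1 / 2) * real j))"
    have sp: "(\<Sum>k\<in>I. \<bar>?x k\<bar> powr P) \<le> B powr P"
      unfolding P_def using s \<open>0 \<le> B\<close> \<open>1 < p\<close> False \<open>finite I\<close> by (intro seq_norm_finite_bound) auto
    have "(\<Sum>k\<in>I. (?x k)\<^sup>2) \<le> t * (\<Sum>k\<in>I. \<bar>?x k\<bar>) + t powr (2 - P) * (\<Sum>k\<in>I. \<bar>?x k\<bar> powr P)"
      using \<open>2 < P\<close> by (intro sum_squares_interpolation) (auto simp: t_def)
    also have "\<dots> \<le> t * (G * 2 powr (real j / 2)) + t powr (2 - P) * B powr P"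
      by (intro add_mono mult_left_mono G sp) (auto simp: t_def)
    also have "t * (G * 2 powr (real j / 2)) = G * 2 powr (- \<rho> * real j)"
      by (simp add: t_def powr_add[symmetric] algebra_simps)
    also have "t powr (2 - P) * B powr P = R powr P * 2 powr (- \<rho> * real j)"
    proof -
      have "t powr (2 - P) * B powr P
          = R powr P * 2 powr (- ((\<rho> + 1 / 2) * real j) * (2 - P) + - (real j * e) * P)"
      proof -
        have "t powr (2 - P) = 2 powr (- ((\<rho> + 1 / 2) * real j) * (2 - P))"
          by (simp only: t_def powr_powr)
        moreover have "B powr P = R powr P * 2 powr (- (real j * e) * P)"
          unfolding B_def using \<open>0 < R\<close> by (subst powr_mult) (simp_all only: powr_powr powr_ge_zero less_imp_le)
        ultimately show ?thesis by (simp only: powr_add mult_ac)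
      qed
      also have "- ((\<rho> + 1 / 2) * real j) * (2 - P) + - (real j * e) * P
          = real j * ((\<rho> * (P - 1)) - \<rho> - 1 - (\<alpha> * P) + P * (1 / P))"
        using \<open>2 < P\<close> by (simp add: e_def ip field_simps)
      also have "\<dots> = - \<rho> * real j" using \<open>2 < P\<close> by (simp add: \<rho>)
      finally show ?thesis .
    qed
    also have "G * 2 powr (- \<rho> * real j) + R powr P * 2 powr (- \<rho> * real j)
        \<le> (G + R powr enn2real p + R * G) * 2 powr (- \<rho> * real j)"
      using assms by (simp add: P_def[symmetric] distrib_right)
    finally show ?thesis .
  qed
qed

lemma sum_powers_of_two_le: "(\<Sum>i\<le>m. if i \<le> k then 2 ^ i else (0::real)) \<le> 2 ^ Suc k"
proof -
  have "(\<Sum>i\<le>m. if i \<le> k then 2 ^ i else (0::real)) = (\<Sum>i\<in>{..m} \<inter> {..k}. 2 ^ i)"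
    by (simp add: sum.If_cases atMost_def)
  also have "\<dots> \<le> (\<Sum>i<Suc k. 2 ^ i)" by (rule sum_mono2) auto
  also have "\<dots> \<le> 2 ^ Suc k" by (subst sum_gp_strict) simp
  finally show ?thesis .
qed

lemma sum_geometric_tail_le:
  fixes x :: real
  assumes "0 < x" "x < 1"
  shows "(\<Sum>i\<le>m. if i \<le> k then 0 else x ^ (i - 1)) \<le> x ^ k / (1 - x)"
proof -
  have "(1 - x) * (\<Sum>i\<le>m. if i \<le> k then 0 else x ^ (i - 1)) \<le> x ^ k - x ^ max m k"
  proof (induction m)
    case (Suc m)
    show ?case
    proof (cases "Suc m \<le> k")
      case False
      then have "max m k = m" "max (Suc m) k = Suc m" by auto
      then show ?thesis using Suc False by (simp add: distrib_left algebra_simps)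
    qed (use Suc in simp)
  qed simp
  also have "\<dots> \<le> x ^ k" using assms by simp
  finally show ?thesis using assms by (simp add: field_simps)
qed

lemma max_level_bounds:
  assumes "1 \<le> c" "2 \<le> n"
  shows "2 powr of_int (max_level c n) \<le> real n powr c * ln (real n) powr (- c)"
    and "real n powr c * ln (real n) powr (- c) < 2 powr (of_int (max_level c n) + 1)"
proof -
  define x where "x = real n powr c * ln (real n) powr (- c)"
  have "0 < x" using assms by (simp add: x_def)
  then have x: "x = 2 powr log 2 x" by simp
  have iff: "2 powr of_int j \<le> x \<and> x < 2 powr (of_int j + 1) \<longleftrightarrow> j = \<lfloor>log 2 x\<rfloor>" for j :: int
    by (subst (1 2) x) (auto simp: floor_eq_iff eq_commute[of j "\<lfloor>log 2 x\<rfloor>"])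
  have "max_level c n = \<lfloor>log 2 x\<rfloor>"
    unfolding max_level_def x_def[symmetric] iff by simp
  then show "2 powr of_int (max_level c n) \<le> real n powr c * ln (real n) powr (- c)"
    and "real n powr c * ln (real n) powr (- c) < 2 powr (of_int (max_level c n) + 1)"
    using iff[of "max_level c n"] by (simp_all add: x_def)
qed

text \<open>The sum of the oracle bounds: variance terms \<open>w\<close> up to level \<open>J\<close>, squared coefficients \<open>z\<close>
  beyond it, and the two remainders of the exceptional events. Geometric growth and geometric decay
  leave the boundary level only.\<close>

lemma sum_over_levels_le:
  fixes w z :: "nat \<Rightarrow> 'k \<Rightarrow> real"
  assumes w: "\<And>i. (\<Sum>k\<in>I. w i k) \<le> G * 2 ^ i" and z: "\<And>i. 1 \<le> i \<Longrightarrow> (\<Sum>k\<in>I. z i k) \<le> H * x ^ (i - 1)"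
    and z_total: "(\<Sum>i\<le>m. \<Sum>k\<in>I. z i k) \<le> Q"
    and "0 < x" "x < 1" "0 \<le> G" "0 \<le> H" "0 \<le> a" "0 \<le> \<epsilon>" "0 \<le> \<delta>"
  shows "(\<Sum>i\<le>m. \<Sum>k\<in>I. (if i \<le> Suc J then w i k * a else z i k) + z i k * \<epsilon>
      + (if i \<le> Suc J' then w i k * \<delta> else 0))
    \<le> 4 * G * 2 ^ J * a + H * (x ^ Suc J / (1 - x)) + Q * \<epsilon> + 4 * G * 2 ^ J' * \<delta>"
proof -
  have w_levels: "(\<Sum>i\<le>m. if i \<le> Suc l then (\<Sum>k\<in>I. w i k) * u else 0) \<le> 4 * G * 2 ^ l * u"
    if "0 \<le> u" for l u
  proof -
    have "(\<Sum>i\<le>m. if i \<le> Suc l then (\<Sum>k\<in>I. w i k) * u else 0)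
        \<le> (\<Sum>i\<le>m. (G * u) * (if i \<le> Suc l then 2 ^ i else 0))"
    proof (rule sum_mono)
      fix i
      have "(\<Sum>k\<in>I. w i k) * u \<le> (G * 2 ^ i) * u" using w that by (rule mult_right_mono)
      then show "(if i \<le> Suc l then (\<Sum>k\<in>I. w i k) * u else 0) \<le> (G * u) * (if i \<le> Suc l then 2 ^ i else 0)"
        by (simp add: mult_ac)
    qed
    also have "\<dots> = (G * u) * (\<Sum>i\<le>m. if i \<le> Suc l then 2 ^ i else 0)" by (rule sum_distrib_left[symmetric])
    also have "\<dots> \<le> (G * u) * 2 ^ Suc (Suc l)"
      using that assms by (intro mult_left_mono sum_powers_of_two_le) auto
    finally show ?thesis by (simp add: mult_ac)
  qed
  have "(\<Sum>i\<le>m. if i \<le> Suc J then 0 else \<Sum>k\<in>I. z i k)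
      \<le> (\<Sum>i\<le>m. H * (if i \<le> Suc J then 0 else x ^ (i - 1)))"
    using z by (intro sum_mono) auto
  also have "\<dots> = H * (\<Sum>i\<le>m. if i \<le> Suc J then 0 else x ^ (i - 1))" by (rule sum_distrib_left[symmetric])
  also have "\<dots> \<le> H * (x ^ Suc J / (1 - x))"
    using assms by (intro mult_left_mono sum_geometric_tail_le) auto
  finally have z_tail: "(\<Sum>i\<le>m. if i \<le> Suc J then 0 else \<Sum>k\<in>I. z i k) \<le> H * (x ^ Suc J / (1 - x))" .
  have "(\<Sum>k\<in>I. (if i \<le> Suc J then w i k * a else z i k) + z i k * \<epsilon> + (if i \<le> Suc J' then w i k * \<delta> else 0))
      = (if i \<le> Suc J then (\<Sum>k\<in>I. w i k) * a else 0) + (if i \<le> Suc J then 0 else \<Sum>k\<in>I. z i k)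
        + (\<Sum>k\<in>I. z i k) * \<epsilon> + (if i \<le> Suc J' then (\<Sum>k\<in>I. w i k) * \<delta> else 0)" for i
    by (cases "i \<le> Suc J"; cases "i \<le> Suc J'") (simp_all add: sum.distrib sum_distrib_right)
  then have "(\<Sum>i\<le>m. \<Sum>k\<in>I. (if i \<le> Suc J then w i k * a else z i k) + z i k * \<epsilon>
        + (if i \<le> Suc J' then w i k * \<delta> else 0))
      = (\<Sum>i\<le>m. (if i \<le> Suc J then (\<Sum>k\<in>I. w i k) * a else 0) + (if i \<le> Suc J then 0 else \<Sum>k\<in>I. z i k)
        + (\<Sum>k\<in>I. z i k) * \<epsilon> + (if i \<le> Suc J' then (\<Sum>k\<in>I. w i k) * \<delta> else 0))"
    by (rule sum.cong[OF refl])
  also have "\<dots> = (\<Sum>i\<le>m. if i \<le> Suc J then (\<Sum>k\<in>I. w i k) * a else 0)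
        + (\<Sum>i\<le>m. if i \<le> Suc J then 0 else \<Sum>k\<in>I. z i k)
        + (\<Sum>i\<le>m. \<Sum>k\<in>I. z i k) * \<epsilon>
        + (\<Sum>i\<le>m. if i \<le> Suc J' then (\<Sum>k\<in>I. w i k) * \<delta> else 0)"
    unfolding sum.distrib by (simp only: sum_distrib_right[where r = \<epsilon>])
  also have "\<dots> \<le> 4 * G * 2 ^ J * a + H * (x ^ Suc J / (1 - x)) + Q * \<epsilon> + 4 * G * 2 ^ J' * \<delta>"
    using assms by (intro add_mono w_levels z_tail mult_right_mono z_total) auto
  finally show ?thesis .
qed

lemma L_ball_1_integral:
  assumes "f \<in> L_ball 1 R" "\<And>x. 0 \<le> f x" "0 < R"
  shows "integrable lborel f" and "(\<integral>x. f x \<partial>lborel) \<le> R"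
proof -
  have [measurable]: "f \<in> borel_measurable borel" using assms by (simp add: L_ball_def)
  have "(\<integral>\<^sup>+x. ennreal (f x) \<partial>lborel) \<le> ennreal R"
    using assms by (auto simp: L_ball_def L_norm_def epowr_def top_unique ennreal_enn2real less_top split: if_splits)
  then show int: "integrable lborel f"
    using assms(2) by (intro integrableI_nonneg) (auto intro: le_less_trans)
  have "ennreal (\<integral>x. f x \<partial>lborel) \<le> ennreal R"
    using \<open>(\<integral>\<^sup>+x. ennreal (f x) \<partial>lborel) \<le> ennreal R\<close> nn_integral_eq_integral[OF int] assms(2) by simp
  then show "(\<integral>x. f x \<partial>lborel) \<le> R" using assms(3) by simp
qed

lemma sum_coef_squares_le:
  assumes c1: "0 < c1" "ennreal c1 * (\<Sum>\<^sub>\<infinity>l\<in>\<Lambda>. ennreal ((coef \<psi> f l)\<^sup>2)) \<le> (L_norm 2 f)\<^sup>2"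
    and f: "f \<in> L_ball 2 R" and "0 < R" "finite F" "F \<subseteq> \<Lambda>"
  shows "(\<Sum>l\<in>F. (coef \<psi> f l)\<^sup>2) \<le> R\<^sup>2 / c1"
proof -
  have "ennreal c1 * (\<Sum>l\<in>F. ennreal ((coef \<psi> f l)\<^sup>2)) \<le> ennreal c1 * (\<Sum>\<^sub>\<infinity>l\<in>\<Lambda>. ennreal ((coef \<psi> f l)\<^sup>2))"
    by (intro mult_left_mono infsum_ge_sum_ennreal assms) simp
  also have "\<dots> \<le> (L_norm 2 f)\<^sup>2" by (fact c1(2))
  also have "\<dots> \<le> (ennreal R)\<^sup>2" using f by (intro power_mono) (auto simp: L_ball_def)
  finally have "ennreal (c1 * (\<Sum>l\<in>F. (coef \<psi> f l)\<^sup>2)) \<le> ennreal (R\<^sup>2)"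
    using c1(1) \<open>0 < R\<close> by (simp add: sum_ennreal ennreal_mult'[symmetric] ennreal_power)
  then have "c1 * (\<Sum>l\<in>F. (coef \<psi> f l)\<^sup>2) \<le> R\<^sup>2" by simp
  then show ?thesis using c1(1) by (simp add: field_simps)
qed

text \<open>Finite sets of indices are enlarged to rectangles of levels and positions.\<close>

lemma sum_le_sum_over_levels:
  fixes u :: "int \<times> int \<Rightarrow> real"
  assumes "finite F" "F \<subseteq> \<Lambda>" "\<And>l. 0 \<le> u l"
  shows "\<exists>m. sum u F \<le> (\<Sum>i\<le>m. \<Sum>k\<in>snd ` F. u (int i - 1, k))"
proof -
  obtain m where m: "(\<lambda>l. nat (fst l + 1)) ` F \<subseteq> {..m}"
    using assms(1) finite_nat_set_iff_bounded_le[of "(\<lambda>l. nat (fst l + 1)) ` F"] by auto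
  let ?h = "\<lambda>(i, k). (int i - 1, k)"
  have "F \<subseteq> ?h ` ({..m} \<times> snd ` F)"
  proof
    fix l assume l: "l \<in> F"
    then have "l = ?h (nat (fst l + 1), snd l)" using assms(2) by (auto simp: \<Lambda>_def)
    moreover have "(nat (fst l + 1), snd l) \<in> {..m} \<times> snd ` F" using m l by auto
    ultimately show "l \<in> ?h ` ({..m} \<times> snd ` F)" by (rule image_eqI)
  qed
  then have "sum u F \<le> sum u (?h ` ({..m} \<times> snd ` F))"
    using assms by (intro sum_mono2) auto
  also have "\<dots> = (\<Sum>(i, k)\<in>{..m} \<times> snd ` F. u (int i - 1, k))"
    by (subst sum.reindex) (auto simp: inj_on_def case_prod_unfold comp_def)
  also have "\<dots> = (\<Sum>i\<le>m. \<Sum>k\<in>snd ` F. u (int i - 1, k))" by (rule sum.cartesian_product[symmetric])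
  finally show ?thesis by blast
qed

section \<open>Risk of the estimator over Besov balls\<close>

text \<open>The level \<open>J\<close> is the integer part of \<open>log 2 y\<close> for the balancing point
  \<open>y = a powr (- 1 / (\<rho> + 1))\<close>. Since \<open>1 / (\<rho> + 1) \<le> 1 \<le> c\<close>, \<open>y\<close> is at most
  \<open>(1 / a) powr c\<close>, and so \<open>J\<close> does not exceed the finest level of the estimator.\<close>

lemma balancing_level:
  fixes \<rho> c :: real and n :: nat
  assumes "0 < \<rho>" "1 \<le> c" "2 \<le> n"
  defines "a \<equiv> ln (real n) / real n"
  obtains J :: nat where "2 ^ J * a \<le> a powr (\<rho> / (\<rho> + 1))"
    and "(2 powr (- \<rho>)) ^ Suc J \<le> a powr (\<rho> / (\<rho> + 1))"
    and "int J \<le> max_level c n"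
proof -
  have n: "0 < real n" "0 < ln (real n)" using assms(3) by auto
  have a: "0 < a" "a \<le> 1" using n ln_le_minus_one[of "real n"] by (auto simp: a_def field_simps)
  define y where "y = (1 / a) powr (1 / (\<rho> + 1))"
  have "1 \<le> 1 / a" using a by simp
  then have "1 \<le> y" using assms unfolding y_def by (intro ge_one_powr_ge_zero) auto
  then have "0 \<le> log 2 y" by simp
  define J where "J = nat \<lfloor>log 2 y\<rfloor>"
  have J: "real J \<le> log 2 y" "log 2 y < real J + 1" using \<open>0 \<le> log 2 y\<close> by (auto simp: J_def)
  have J1: "2 ^ J \<le> y"
  proof -
    have "2 powr real J \<le> y" using J(1) \<open>1 \<le> y\<close> by (subst (asm) le_log_iff) auto
    then show ?thesis by (simp add: powr_realpow)
  qed
  have J2: "y \<le> 2 powr real (Suc J)"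
  proof -
    have "log 2 y \<le> real (Suc J)" using J(2) by simp
    then show ?thesis using \<open>1 \<le> y\<close> by (subst (asm) log_le_iff) auto
  qed
  have y: "y = a powr (- (1 / (\<rho> + 1)))"
    unfolding y_def using a by (simp add: powr_divide powr_minus_divide)
  show thesis
  proof (rule that[of J])
    have "2 ^ J * a \<le> y * a" using J1 a by (intro mult_right_mono) auto
    also have "\<dots> = a powr (- (1 / (\<rho> + 1))) * a powr 1" using a by (simp add: y)
    also have "\<dots> = a powr (- (1 / (\<rho> + 1)) + 1)" by (simp only: powr_add)
    also have "- (1 / (\<rho> + 1)) + 1 = \<rho> / (\<rho> + 1)" using assms(1) by (simp add: field_simps)
    finally show "2 ^ J * a \<le> a powr (\<rho> / (\<rho> + 1))" .
    have "(2 powr (- \<rho>)) ^ Suc J = (2 powr (- \<rho>)) powr real (Suc J)" by (rule powr_realpow[symmetric]) simp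
    also have "\<dots> = (2 powr real (Suc J)) powr (- \<rho>)" by (simp only: powr_powr mult.commute)
    also have "\<dots> \<le> y powr (- \<rho>)" using J2 \<open>1 \<le> y\<close> assms(1) by (intro powr_mono2') auto
    also have "\<dots> = a powr (\<rho> / (\<rho> + 1))" by (simp add: y powr_powr)
    finally show "(2 powr (- \<rho>)) ^ Suc J \<le> a powr (\<rho> / (\<rho> + 1))" .
    have "2 powr real J \<le> y" using J1 by (simp add: powr_realpow)
    also have "y \<le> (1 / a) powr c"
    proof -
      have "1 * 1 \<le> c * (\<rho> + 1)" using assms(1,2) by (intro mult_mono) auto
      then have "1 / (\<rho> + 1) \<le> c" using assms(1) by (simp add: divide_le_eq)
      then show ?thesis unfolding y_def using \<open>1 \<le> 1 / a\<close> by (rule powr_mono)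
    qed
    also have "\<dots> = real n powr c * ln (real n) powr (- c)"
      using n by (simp add: a_def powr_divide powr_minus_divide)
    also have "\<dots> < 2 powr (of_int (max_level c n) + 1)" using max_level_bounds(2) assms by simp
    finally have "real J < of_int (max_level c n) + 1" by simp
    then show "int J \<le> max_level c n" by linarith
  qed
qed

theorem theorem4:
  fixes \<psi> \<phi>' \<psi>' :: "real \<Rightarrow> real" and r R R' \<alpha> c \<gamma> :: real and p :: ennreal
  assumes "biorthogonal_basis r \<psi> \<phi>' \<psi>'"
    and "R > 0" and "R' > 0"
    and "2 < p"
    and "0 < \<alpha>" and "\<alpha> < r + 1"
    and "c \<ge> 1" and "\<gamma> > c"
  shows "\<exists>C::real. \<forall>q::ennreal. 1 \<le> q \<longrightarrow> (\<forall>n::nat. n \<ge> 2 \<longrightarrow>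
    (\<forall>f \<in> besov_ball \<psi> \<alpha> p q R \<inter> L_ball 1 R' \<inter> L_ball 2 R'. (\<forall>x. f x \<ge> 0) \<longrightarrow>
      (\<forall>(M::'w measure) N. poisson_intensity M N n f \<longrightarrow>
        (\<integral>\<^sup>+\<omega>. (L_norm 2 (\<lambda>x. estimator \<psi> \<phi>' \<psi>' \<gamma> n (\<Gamma>_level c n) (N \<omega>) x - f x))\<^sup>2 \<partial>M)
          \<le> ennreal (C * (ln (real n) / real n) powr (\<alpha> / (\<alpha> + 1 - enn2real (1 / p)))))))"
proof -
  note basis = assms(1) and pos = assms(2,3,5) and p = assms(4) and c = assms(7,8)
  have wb: "wavelet_basis \<psi> \<phi>' \<psi>'" by (rule biorthogonal_basis_imp_wavelet_basis[OF basis])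
  interpret wavelet_basis \<psi> \<phi>' \<psi>' by (fact wb)
  obtain c1 c2 where c12: "0 < c1" "0 < c2"
    and norm_low: "\<And>f. f \<in> L_space 2 \<Longrightarrow> ennreal c1 * (\<Sum>\<^sub>\<infinity>l\<in>\<Lambda>. ennreal ((coef \<psi> f l)\<^sup>2)) \<le> (L_norm 2 f)\<^sup>2"
    and norm_up: "\<And>f. f \<in> L_space 2 \<Longrightarrow> (L_norm 2 f)\<^sup>2 \<le> ennreal c2 * (\<Sum>\<^sub>\<infinity>l\<in>\<Lambda>. ennreal ((coef \<psi> f l)\<^sup>2))"
    using basis unfolding biorthogonal_basis_def norm_equivalence_def by blast
  obtain A where A: "1 \<le> A" "\<And>x. \<psi> x \<noteq> 0 \<Longrightarrow> \<bar>x\<bar> \<le> A"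
  proof -
    obtain A' where "\<And>x. \<psi> x \<noteq> 0 \<Longrightarrow> \<bar>x\<bar> \<le> A'" using test(1) by (auto simp: test_function_def)
    then show thesis by (intro that[of "max 1 A'"]) (auto simp: le_max_iff_disj)
  qed
  obtain B where B: "1 \<le> B" "\<And>x. \<bar>\<psi> x\<bar> \<le> B"
  proof -
    obtain B' where "\<And>x. \<bar>\<psi> x\<bar> \<le> B'" using test(1) by (auto simp: test_function_def bounded_iff)
    then show thesis by (intro that[of "max 1 B'"]) (auto simp: le_max_iff_disj)
  qed
  define \<rho> where "\<rho> = \<alpha> / (1 - enn2real (1 / p))"
  define x where "x = 2 powr (- \<rho>)"
  have ip: "enn2real (1 / p) < 1"
  proof (cases "p = \<infinity>")
    case False
    then show ?thesis using finite_exponent[OF p] by simp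
  qed simp
  have \<rho>: "0 < \<rho>" using pos ip by (simp add: \<rho>_def)
  have \<theta>: "\<alpha> / (\<alpha> + 1 - enn2real (1 / p)) = \<rho> / (\<rho> + 1)"
  proof -
    define d where "d = 1 - enn2real (1 / p)"
    have "0 < d" and sum: "\<alpha> + 1 - enn2real (1 / p) = \<alpha> + d" using ip by (auto simp: d_def)
    have "\<rho> = \<alpha> / d" by (simp add: \<rho>_def d_def)
    then show ?thesis unfolding sum using \<open>0 < d\<close> pos \<rho> by (simp add: field_simps)
  qed
  have x: "0 < x" "x < 1" using \<rho> by (simp_all add: x_def powr_less_one)
  define G0 where "G0 = (2 * A + 1) * R'"
  define G where "G = B\<^sup>2 * G0"
  define G1 where "G1 = 2 * B * G0"
  define H where "H = G1 + R powr enn2real p + R * G1"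
  define Q where "Q = R'\<^sup>2 / c1"
  define D where "D = risk_constant \<gamma> c + 1"
  have nonneg: "0 \<le> G0" "0 \<le> G" "0 \<le> G1" "0 \<le> H" "0 \<le> Q" "1 \<le> D" "risk_constant \<gamma> c \<le> D"
    using A B pos c12 risk_constant_nonneg[of \<gamma> c]
    by (simp_all add: G0_def G_def G1_def H_def Q_def D_def)
  define E where "E = 4 * G + H / (1 - x) + (Q + 4 * G * ln 2 powr (- c)) / ln 2"
  show ?thesis
  proof (intro exI[of _ "c2 * (D * E)"] allI ballI impI)
    fix q :: ennreal and n :: nat and f :: "real \<Rightarrow> real" and M :: "'w measure" and N
    assume q: "1 \<le> q" and n2: "2 \<le> n" and f: "f \<in> besov_ball \<psi> \<alpha> p q R \<inter> L_ball 1 R' \<inter> L_ball 2 R'"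
      and f0: "\<forall>x. 0 \<le> f x" and poi: "poisson_intensity M N n f"
    have f_int: "integrable lborel f" and f_mass: "(\<integral>x. f x \<partial>lborel) \<le> R'"
      using L_ball_1_integral[of f R'] f f0 pos by auto
    have f_L2: "f \<in> L_space 2"
      using f by (auto simp: L_ball_def L_space_def intro: le_less_trans)
    interpret poisson_observation M N n f
      by unfold_locales (use poi n2 f0 f_int in auto)
    let ?\<Gamma> = "\<Gamma>_level c n"
    let ?F = "\<lambda>l. mass f {x. wav \<phi> \<psi> l x \<noteq> 0}"
    let ?b = "\<lambda>l. sup_norm (wav \<phi> \<psi> l)"
    let ?\<beta> = "coef \<psi> f"
    define a where "a = ln (real n) / real n"
    define \<epsilon> where "\<epsilon> = real n powr (- c)"
    have n: "0 < real n" "ln 2 \<le> ln (real n)" "0 < ln (real n)" using n2 by auto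
    have a: "0 < a" "a \<le> 1" using n ln_le_minus_one[of "real n"] by (auto simp: a_def field_simps)
    obtain J where J: "2 ^ J * a \<le> a powr (\<rho> / (\<rho> + 1))" "x ^ Suc J \<le> a powr (\<rho> / (\<rho> + 1))"
        "int J \<le> max_level c n"
      using balancing_level[OF \<rho> c(1) n2] unfolding x_def a_def by blast
    define J' where "J' = nat (max_level c n)"
    have J': "max_level c n = int J'" using J(3) by (simp add: J'_def)
    \<comment> \<open>\<open>u l\<close> bounds the risk of the coefficient \<open>l\<close>: the oracle bound if \<open>l\<close> is estimated, the full
    squared coefficient otherwise.\<close>
    define u where "u = (\<lambda>l. if l \<in> ?\<Gamma> then risk_constant \<gamma> c *
      (min ((?\<beta> l)\<^sup>2) ((?b l)\<^sup>2 * ?F l * ln (real n) / real n) + ((?\<beta> l)\<^sup>2 + (?b l)\<^sup>2 * ?F l / real n) * \<epsilon>)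
      else (?\<beta> l)\<^sup>2)"
    have F0: "0 \<le> ?F l" for l using f0 by (intro mass_nonneg) auto
    have u0: "0 \<le> u l" for l
      using F0[of l] n risk_constant_nonneg by (simp add: u_def \<epsilon>_def)
    define w where "w = (\<lambda>i k. (?b (int i - 1, k))\<^sup>2 * ?F (int i - 1, k))"
    define z where "z = (\<lambda>i k. (?\<beta> (int i - 1, k))\<^sup>2)"
    have w0: "0 \<le> w i k" for i k using F0 by (simp add: w_def)
    have z0: "0 \<le> z i k" for i k by (simp add: z_def)
    \<comment> \<open>The minimum in the oracle bound is replaced by its variance part up to level \<open>J\<close> and by the
    squared coefficient beyond; levels that are not estimated lie beyond \<open>J\<close>.\<close>
    have u_le: "u (int i - 1, k) \<le> D * ((if i \<le> Suc J then w i k * a else z i k) + z i k * \<epsilon>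
        + (if i \<le> Suc J' then w i k * (\<epsilon> / real n) else 0))" for i k
    proof -
      have mem: "(int i - 1, k) \<in> ?\<Gamma> \<longleftrightarrow> i \<le> Suc J'"
        by (auto simp: \<Gamma>_level_def \<Lambda>_def J')
      have JJ: "J \<le> J'" using J(3) J' by simp
      have "0 \<le> \<epsilon>" by (simp add: \<epsilon>_def)
      show ?thesis
      proof (cases "i \<le> Suc J'")
        case True
        have "u (int i - 1, k) = risk_constant \<gamma> c * (min (z i k) (w i k * a) + (z i k + w i k / real n) * \<epsilon>)"
          using True mem by (simp add: u_def z_def w_def a_def)
        also have "\<dots> \<le> D * (min (z i k) (w i k * a) + (z i k + w i k / real n) * \<epsilon>)"
          using nonneg w0 z0 a \<open>0 \<le> \<epsilon>\<close> by (intro mult_right_mono) auto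
        also have "\<dots> \<le> D * ((if i \<le> Suc J then w i k * a else z i k) + (z i k + w i k / real n) * \<epsilon>)"
          using nonneg by (intro mult_left_mono add_right_mono) auto
        also have "\<dots> = D * ((if i \<le> Suc J then w i k * a else z i k) + z i k * \<epsilon>
            + (if i \<le> Suc J' then w i k * (\<epsilon> / real n) else 0))"
          using True by (simp add: distrib_right)
        finally show ?thesis .
      next
        case False
        then have "u (int i - 1, k) = 1 * z i k" using mem by (simp add: u_def z_def)
        also have "\<dots> \<le> D * (z i k + z i k * \<epsilon>)"
          using nonneg z0[of i k] \<open>0 \<le> \<epsilon>\<close> by (intro mult_mono) auto
        finally show ?thesis using False JJ by simp
      qed
    qed
    have w_level: "(\<Sum>k\<in>I. w i k) \<le> G * 2 ^ i" if I: "finite I" for I i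
    proof -
      have "(\<Sum>k\<in>I. w i k) \<le> (\<Sum>k\<in>I. (B\<^sup>2 * 2 ^ i) * ?F (int i - 1, k))"
        unfolding w_def using F0 by (intro sum_mono mult_right_mono sup_norm_level B) auto
      also have "\<dots> = (B\<^sup>2 * 2 ^ i) * (\<Sum>k\<in>I. ?F (int i - 1, k))" by (rule sum_distrib_left[symmetric])
      also have "\<dots> \<le> (B\<^sup>2 * 2 ^ i) * ((2 * A + 1) * (\<integral>x. f x \<partial>lborel))"
        using A I f_int f0 by (intro mult_left_mono sum_mass_level) auto
      also have "\<dots> \<le> (B\<^sup>2 * 2 ^ i) * G0"
        unfolding G0_def using f_mass A by (intro mult_left_mono) auto
      finally show ?thesis by (simp add: G_def mult_ac)
    qed
    have coef_level: "(\<Sum>k\<in>I. \<bar>?\<beta> (int j, k)\<bar>) \<le> G1 * 2 powr (real j / 2)" if I: "finite I" for I j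
    proof -
      have b: "?b (int j, k) \<le> 2 * B * 2 powr (real j / 2)" for k
      proof (rule power2_le_imp_le)
        have "(?b (int j, k))\<^sup>2 \<le> B\<^sup>2 * 2 ^ Suc j" using sup_norm_level[OF B, of "Suc j" k] by simp
        also have "\<dots> \<le> 4 * B\<^sup>2 * 2 ^ j" by simp
        also have "\<dots> = (2 * B * 2 powr (real j / 2))\<^sup>2"
          by (simp add: power_mult_distrib power2_eq_square powr_add[symmetric] powr_realpow)
        finally show "(?b (int j, k))\<^sup>2 \<le> (2 * B * 2 powr (real j / 2))\<^sup>2" .
      qed (use B in simp)
      have "(\<Sum>k\<in>I. \<bar>?\<beta> (int j, k)\<bar>) \<le> (\<Sum>k\<in>I. (2 * B * 2 powr (real j / 2)) * ?F (int j, k))"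
      proof (rule sum_mono)
        fix k
        have "\<bar>?\<beta> (int j, k)\<bar> \<le> ?b (int j, k) * ?F (int j, k)"
          using f0 f_int by (intro coef_le_sup_norm_mass) (auto simp: \<Lambda>_def)
        also have "\<dots> \<le> (2 * B * 2 powr (real j / 2)) * ?F (int j, k)"
          by (intro mult_right_mono b F0)
        finally show "\<bar>?\<beta> (int j, k)\<bar> \<le> (2 * B * 2 powr (real j / 2)) * ?F (int j, k)" .
      qed
      also have "\<dots> = (2 * B * 2 powr (real j / 2)) * (\<Sum>k\<in>I. ?F (int j, k))" by (rule sum_distrib_left[symmetric])
      also have "\<dots> \<le> (2 * B * 2 powr (real j / 2)) * ((2 * A + 1) * (\<integral>x. f x \<partial>lborel))"
        using A B I f_int f0 by (intro mult_left_mono sum_mass_level) auto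
      also have "\<dots> \<le> (2 * B * 2 powr (real j / 2)) * G0"
        unfolding G0_def using f_mass A B by (intro mult_left_mono) auto
      finally show ?thesis by (simp add: G1_def mult_ac)
    qed
    have z_level: "(\<Sum>k\<in>I. z i k) \<le> H * x ^ (i - 1)" if I: "finite I" and "1 \<le> i" for I i
    proof -
      obtain j where i: "i = Suc j" using \<open>1 \<le> i\<close> by (cases i) auto
      have "(\<Sum>k\<in>I. (?\<beta> (int j, k))\<^sup>2) \<le> H * 2 powr (- \<rho> * real j)"
        unfolding H_def \<rho>_def
        using p q pos nonneg f I coef_level[OF I] by (intro besov_level_sum) auto
      also have "2 powr (- \<rho> * real j) = x ^ j"
        using powr_realpow[OF x(1), of j] by (simp add: x_def powr_powr)
      finally show ?thesis by (simp add: i z_def)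
    qed
    have sum_u: "sum u F \<le> D * (E * a powr (\<rho> / (\<rho> + 1)))" if F: "finite F" "F \<subseteq> \<Lambda>" for F
    proof -
      let ?I = "snd ` F"
      have I: "finite ?I" using F by simp
      obtain m where "sum u F \<le> (\<Sum>i\<le>m. \<Sum>k\<in>?I. u (int i - 1, k))"
        using sum_le_sum_over_levels[of F u, OF F u0] by blast
      also have "\<dots> \<le> (\<Sum>i\<le>m. \<Sum>k\<in>?I. D * ((if i \<le> Suc J then w i k * a else z i k) + z i k * \<epsilon>
        + (if i \<le> Suc J' then w i k * (\<epsilon> / real n) else 0)))"
        by (intro sum_mono u_le)
      also have "\<dots> = D * (\<Sum>i\<le>m. \<Sum>k\<in>?I. (if i \<le> Suc J then w i k * a else z i k) + z i k * \<epsilon>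
        + (if i \<le> Suc J' then w i k * (\<epsilon> / real n) else 0))"
        by (simp only: sum_distrib_left)
      also have "\<dots> \<le> D * (4 * G * 2 ^ J * a + H * (x ^ Suc J / (1 - x)) + Q * \<epsilon> + 4 * G * 2 ^ J' * (\<epsilon> / real n))"
      proof (intro mult_left_mono sum_over_levels_le)
        have "(\<Sum>i\<le>m. \<Sum>k\<in>?I. z i k) = (\<Sum>l\<in>(\<lambda>(i, k). (int i - 1, k)) ` ({..m} \<times> ?I). (?\<beta> l)\<^sup>2)"
          by (subst sum.reindex) (auto simp: inj_on_def z_def case_prod_unfold comp_def sum.cartesian_product)
        also have "\<dots> \<le> Q"
          unfolding Q_def using I f pos
          by (intro sum_coef_squares_le[OF c12(1) norm_low[OF f_L2]]) (auto simp: \<Lambda>_def)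
        finally show "(\<Sum>i\<le>m. \<Sum>k\<in>?I. z i k) \<le> Q" .
      qed (use w_level[OF I] z_level[OF I] x nonneg a n in \<open>auto simp: \<epsilon>_def\<close>)
      also have "\<dots> \<le> D * (E * a powr (\<rho> / (\<rho> + 1)))"
      proof (intro mult_left_mono)
        let ?t = "a powr (\<rho> / (\<rho> + 1))"
        \<comment> \<open>The remainders are of order \<open>1 / n\<close>, hence at most of the order of the rate \<open>?t\<close>, because \<open>a \<le> 1\<close> and the
        exponent of the rate is at most one. The number \<open>2 ^ J'\<close> of the finest scale is compensated by \<open>\<epsilon>\<close>.\<close>
        have "a powr 1 \<le> ?t" using a \<rho> by (intro powr_mono') auto
        then have "a \<le> ?t" using a by simp
        have "1 / real n \<le> a / ln 2" using n by (simp add: a_def field_simps)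
        also have "\<dots> \<le> ?t / ln 2" using \<open>a \<le> ?t\<close> by (intro divide_right_mono) auto
        finally have inv_n: "1 / real n \<le> ?t / ln 2" .
        have "\<epsilon> \<le> real n powr (- 1)" unfolding \<epsilon>_def using n2 c by (intro powr_mono) auto
        then have "\<epsilon> \<le> ?t / ln 2" using inv_n n by (simp add: powr_minus_divide)
        then have t3: "Q * \<epsilon> \<le> Q * (?t / ln 2)" using nonneg by (intro mult_left_mono)
        have "2 ^ J' * \<epsilon> \<le> real n powr c * ln (real n) powr (- c) * \<epsilon>"
          using max_level_bounds(1)[OF c(1) n2] unfolding J'
          by (intro mult_right_mono) (auto simp: powr_realpow \<epsilon>_def)
        also have "\<dots> = ln (real n) powr (- c)" using n by (simp add: \<epsilon>_def powr_minus)
        also have "\<dots> \<le> ln 2 powr (- c)" using n c by (intro powr_mono2') auto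
        finally have "2 ^ J' * \<epsilon> * (1 / real n) \<le> ln 2 powr (- c) * (?t / ln 2)"
          using inv_n by (intro mult_mono) auto
        then have "4 * G * (2 ^ J' * \<epsilon> * (1 / real n)) \<le> 4 * G * (ln 2 powr (- c) * (?t / ln 2))"
          using nonneg by (intro mult_left_mono) auto
        moreover have "4 * G * (2 ^ J * a) \<le> 4 * G * ?t" using J(1) nonneg by (intro mult_left_mono) auto
        moreover have "H * (x ^ Suc J / (1 - x)) \<le> H * (?t / (1 - x))"
          using J(2) nonneg x by (intro mult_left_mono divide_right_mono) auto
        moreover note t3
        moreover have "4 * G * ?t + H * (?t / (1 - x)) + Q * (?t / ln 2) + 4 * G * (ln 2 powr (- c) * (?t / ln 2)) = E * ?t"
          by (simp add: E_def distrib_right add_divide_distrib)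
        ultimately show "4 * G * 2 ^ J * a + H * (x ^ Suc J / (1 - x)) + Q * \<epsilon> + 4 * G * 2 ^ J' * (\<epsilon> / real n) \<le> E * ?t"
          by (simp add: mult.assoc)
      qed (use nonneg in simp)
      finally show ?thesis .
    qed
    define err where "err = (\<lambda>l \<omega>. ennreal ((coef_tilde \<psi> \<gamma> n ?\<Gamma> (N \<omega>) l - ?\<beta> l)\<^sup>2))"
    have "\<exists>g\<in>borel_measurable M. (AE \<omega> in M. err l \<omega> = g \<omega>) \<and> (\<integral>\<^sup>+\<omega>. g \<omega> \<partial>M) \<le> ennreal (u l)"
      if l: "l \<in> \<Lambda>" for l
    proof (cases "l \<in> ?\<Gamma>")
      case True
      then show ?thesis
        using coefficient_risk[OF wb l True c] by (simp add: u_def err_def \<epsilon>_def)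
    next
      case False
      then have "err l \<omega> = ennreal ((?\<beta> l)\<^sup>2)" for \<omega> by (simp add: err_def coef_tilde_def)
      then show ?thesis using False
        by (intro bexI[of _ "\<lambda>_. ennreal ((?\<beta> l)\<^sup>2)"]) (auto simp: u_def emeasure_space_1)
    qed
    then obtain g where g: "\<And>l. l \<in> \<Lambda> \<Longrightarrow> g l \<in> borel_measurable M"
        "\<And>l. l \<in> \<Lambda> \<Longrightarrow> AE \<omega> in M. err l \<omega> = g l \<omega>"
        "\<And>l. l \<in> \<Lambda> \<Longrightarrow> (\<integral>\<^sup>+\<omega>. g l \<omega> \<partial>M) \<le> ennreal (u l)"
      by metis
    have inf: "infinite \<Lambda>"
    proof
      assume "finite \<Lambda>"
      then have "finite (range (\<lambda>k::int. (0::int, k)))"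
        by (rule rev_finite_subset) (auto simp: \<Lambda>_def)
      then show False by (simp add: finite_image_iff inj_on_def)
    qed
    have "(\<integral>\<^sup>+\<omega>. (L_norm 2 (\<lambda>x. estimator \<psi> \<phi>' \<psi>' \<gamma> n ?\<Gamma> (N \<omega>) x - f x))\<^sup>2 \<partial>M)
        \<le> (\<integral>\<^sup>+\<omega>. ennreal c2 * (\<Sum>\<^sub>\<infinity>l\<in>\<Lambda>. err l \<omega>) \<partial>M)"
    proof (rule nn_integral_mono_AE)
      show "AE \<omega> in M. (L_norm 2 (\<lambda>x. estimator \<psi> \<phi>' \<psi>' \<gamma> n ?\<Gamma> (N \<omega>) x - f x))\<^sup>2
          \<le> ennreal c2 * (\<Sum>\<^sub>\<infinity>l\<in>\<Lambda>. err l \<omega>)"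
        using AE_finite_points
      proof eventually_elim
        case (elim \<omega>)
        let ?g = "\<lambda>x. estimator \<psi> \<phi>' \<psi>' \<gamma> n ?\<Gamma> (N \<omega>) x - f x"
        have "(L_norm 2 ?g)\<^sup>2 \<le> ennreal c2 * (\<Sum>\<^sub>\<infinity>l\<in>\<Lambda>. ennreal ((coef \<psi> ?g l)\<^sup>2))"
          by (rule norm_up[OF estimator_error(1)[OF elim f_int f_L2]])
        also have "(\<Sum>\<^sub>\<infinity>l\<in>\<Lambda>. ennreal ((coef \<psi> ?g l)\<^sup>2)) = (\<Sum>\<^sub>\<infinity>l\<in>\<Lambda>. err l \<omega>)"
          by (intro infsum_cong) (simp add: err_def estimator_error(2)[OF elim f_int f_L2])
        finally show ?case .
      qed
    qed
    also have "\<dots> \<le> ennreal c2 * ennreal (D * (E * a powr (\<rho> / (\<rho> + 1))))"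
    proof (rule nn_integral_infsum_le[OF inf g(1) g(2)])
      fix F :: "(int \<times> int) set" assume F: "finite F" "F \<subseteq> \<Lambda>"
      have "(\<Sum>l\<in>F. \<integral>\<^sup>+\<omega>. g l \<omega> \<partial>M) \<le> (\<Sum>l\<in>F. ennreal (u l))" using F g(3) by (intro sum_mono) auto
      also have "\<dots> = ennreal (sum u F)" using u0 by (simp add: sum_ennreal)
      also have "\<dots> \<le> ennreal (D * (E * a powr (\<rho> / (\<rho> + 1))))" by (intro ennreal_leI sum_u F)
      finally show "(\<Sum>l\<in>F. \<integral>\<^sup>+\<omega>. g l \<omega> \<partial>M) \<le> ennreal (D * (E * a powr (\<rho> / (\<rho> + 1))))" .
    qed
    also have "\<dots> = ennreal (c2 * (D * E) * (ln (real n) / real n) powr (\<alpha> / (\<alpha> + 1 - enn2real (1 / p))))"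
      using c12 by (simp add: ennreal_mult'[symmetric] a_def \<theta> mult.assoc)
    finally show "(\<integral>\<^sup>+\<omega>. (L_norm 2 (\<lambda>x. estimator \<psi> \<phi>' \<psi>' \<gamma> n ?\<Gamma> (N \<omega>) x - f x))\<^sup>2 \<partial>M)
      \<le> ennreal (c2 * (D * E) * (ln (real n) / real n) powr (\<alpha> / (\<alpha> + 1 - enn2real (1 / p))))" .
  qed
qed

end
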